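(* Let $m\in\mathbb{R}$ and let $f\colon\mathbb{R}\to\mathbb{R}$ be a $C^1$, odd function such that for some $p>1$ and some constant $C>0$, $|f'(u)|\le C|u|^{p-1}$ for all $|u|<1$. Consider the system $$\partial_t u_1=u_2,\qquad \partial_t u_2=\partial_x^2u_1+m u_1+f(u_1),\qquad x\in\mathbb{R}.$$ There exists $\varepsilon>0$ such that any odd (in $x$) global $H^1\times L^2$ solution $(u_1,u_2)$ of this system satisfying $$\sup_{t\ge 0}\|(u_1(t),u_2(t))\|_{H^1(\mathbb{R})\times L^2(\mathbb{R})}<\varepsilon$$ satisfies $$\lim_{t\to+\infty}\|(u_1(t),u_2(t))\|_{H^1(I)\times L^2(I)}=0$$ for any bounded interval $I\subset\mathbb{R}$. In particular, no odd, small breather solutions exist for the equation $\partial_t^2u-\partial_x^2u=mu+f(u)$; that is, there is no not identically zero odd breather with $\sup_{t\ge0}\|(u(t),\partial_tu(t))\|_{H^1\times L^2}<\varepsilon$.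
   Context: All functions are real-valued. The system is the first-order form of the scalar equation $\partial_t^2u-\partial_x^2u=mu+f(u)$, $(t,x)\in\mathbb{R}\times\mathbb{R}$, with $u_1=u$, $u_2=\partial_tu$. A global $H^1\times L^2$ solution is a solution defined for all $t\ge 0$ with $(u_1,u_2)\in C([0,+\infty),H^1(\mathbb{R})\times L^2(\mathbb{R}))$, the equation being understood in the usual (distributional, equivalently Duhamel) sense. The solution is odd if $x\mapsto u_1(t,x)$ and $x\mapsto u_2(t,x)$ are odd for every $t$. A breather is a solution in $H^1\times L^2$ which is periodic in time, up to the symmetries of the equation; since only odd solutions are considered, the space-translation and Lorentz invariances are irrelevant, and a breather here is a time-periodic solution in $H^1\times L^2$. The number $\varepsilon$ may depend on $m$ and $f$. *)

theory Defs
  imports "HOL-Analysis.Analysis"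
begin

text \<open>
  Elements of \<open>L\<^sup>2\<close> and \<open>H\<^sup>1\<close> are represented by Borel functions. Every notion below depends
  on them only up to Lebesgue-null sets.
\<close>


subsection \<open>Test functions\<close>

text \<open>
  In finite dimension, \<open>f\<close> is \<open>C\<^sup>k\<^sup>+\<^sup>1\<close> iff it is differentiable and all its directional
  derivatives are \<open>C\<^sup>k\<close>.
\<close>

primrec Ck :: "nat \<Rightarrow> ('a::euclidean_space \<Rightarrow> real) \<Rightarrow> bool" where
  "Ck 0 f \<longleftrightarrow> continuous_on UNIV f"
| "Ck (Suc k) f \<longleftrightarrow> (\<forall>x. f differentiable (at x)) \<and>
      (\<forall>v. Ck k (\<lambda>x. frechet_derivative f (at x) v))"

definition test_function_on :: "'a::euclidean_space set \<Rightarrow> ('a \<Rightarrow> real) \<Rightarrow> bool" where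
  "test_function_on U \<phi> \<longleftrightarrow> (\<forall>k. Ck k \<phi>) \<and>
     compact (closure {x. \<phi> x \<noteq> 0}) \<and> closure {x. \<phi> x \<noteq> 0} \<subseteq> U"


subsection \<open>\<open>L\<^sup>2(S)\<close> and \<open>H\<^sup>1(S)\<close> for an interval \<open>S\<close> of the real line\<close>

definition L2_on :: "real set \<Rightarrow> (real \<Rightarrow> real) \<Rightarrow> bool" where
  "L2_on S u \<longleftrightarrow> set_borel_measurable lborel S u \<and> set_integrable lborel S (\<lambda>x. (u x)\<^sup>2)"

definition L2_norm_on :: "real set \<Rightarrow> (real \<Rightarrow> real) \<Rightarrow> real" where
  "L2_norm_on S u = sqrt (LBINT x:S. (u x)\<^sup>2)"

definition weak_derivative_on :: "real set \<Rightarrow> (real \<Rightarrow> real) \<Rightarrow> (real \<Rightarrow> real) \<Rightarrow> bool" where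
  "weak_derivative_on S u v \<longleftrightarrow>
     (\<forall>\<phi>. test_function_on (interior S) \<phi> \<longrightarrow>
        (LBINT x:S. u x * deriv \<phi> x) = - (LBINT x:S. v x * \<phi> x))"

definition H1_on :: "real set \<Rightarrow> (real \<Rightarrow> real) \<Rightarrow> bool" where
  "H1_on S u \<longleftrightarrow> L2_on S u \<and> (\<exists>v. L2_on S v \<and> weak_derivative_on S u v)"

text \<open>
  The weak derivative is unique up to null sets on \<open>interior S\<close>, so the choice does not affect
  the norm when \<open>S\<close> is an interval.
\<close>

definition weak_deriv :: "real set \<Rightarrow> (real \<Rightarrow> real) \<Rightarrow> real \<Rightarrow> real" where
  "weak_deriv S u = (SOME v. L2_on S v \<and> weak_derivative_on S u v)"

definition H1_norm_on :: "real set \<Rightarrow> (real \<Rightarrow> real) \<Rightarrow> real" where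
  "H1_norm_on S u = sqrt ((L2_norm_on S u)\<^sup>2 + (L2_norm_on S (weak_deriv S u))\<^sup>2)"

definition H1L2_norm_on :: "real set \<Rightarrow> (real \<Rightarrow> real) \<Rightarrow> (real \<Rightarrow> real) \<Rightarrow> real" where
  "H1L2_norm_on S u v = sqrt ((H1_norm_on S u)\<^sup>2 + (L2_norm_on S v)\<^sup>2)"


subsection \<open>Solutions\<close>

text \<open>
  Solutions are written \<open>u t x\<close>; only times \<open>t \<ge> 0\<close> matter.
\<close>

definition continuous_H1L2 :: "(real \<Rightarrow> real \<Rightarrow> real) \<Rightarrow> (real \<Rightarrow> real \<Rightarrow> real) \<Rightarrow> bool" where
  "continuous_H1L2 u1 u2 \<longleftrightarrow>
     (\<forall>t\<ge>0. H1_on UNIV (u1 t) \<and> L2_on UNIV (u2 t)) \<and>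
     (\<forall>t\<ge>0. ((\<lambda>s. H1L2_norm_on UNIV (\<lambda>x. u1 s x - u1 t x) (\<lambda>x. u2 s x - u2 t x))
               \<longlongrightarrow> 0) (at t within {0..}))"

text \<open>
  The system in the sense of distributions on \<open>(0,\<infinity>) \<times> \<real>\<close>. The space-time integrals are
  iterated: continuity in time with values in \<open>L\<^sup>2\<close> makes the outer integrands continuous with
  compact support, whereas pointwise representatives \<open>u t\<close> need not be jointly measurable.
\<close>

definition distributional_solution ::
  "real \<Rightarrow> (real \<Rightarrow> real) \<Rightarrow> (real \<Rightarrow> real \<Rightarrow> real) \<Rightarrow> (real \<Rightarrow> real \<Rightarrow> real) \<Rightarrow> bool" where
  "distributional_solution m f u1 u2 \<longleftrightarrow>
     (\<forall>\<phi> :: real \<times> real \<Rightarrow> real. test_function_on ({0<..} \<times> UNIV) \<phi> \<longrightarrow>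
        - (LBINT t:{0<..}. (LBINT x. u1 t x * deriv (\<lambda>s. \<phi> (s, x)) t)) =
          (LBINT t:{0<..}. (LBINT x. u2 t x * \<phi> (t, x))) \<and>
        - (LBINT t:{0<..}. (LBINT x. u2 t x * deriv (\<lambda>s. \<phi> (s, x)) t)) =
          (LBINT t:{0<..}. (LBINT x. u1 t x * (deriv ^^ 2) (\<lambda>y. \<phi> (t, y)) x
                                      + (m * u1 t x + f (u1 t x)) * \<phi> (t, x))))"

definition global_solution ::
  "real \<Rightarrow> (real \<Rightarrow> real) \<Rightarrow> (real \<Rightarrow> real \<Rightarrow> real) \<Rightarrow> (real \<Rightarrow> real \<Rightarrow> real) \<Rightarrow> bool" where
  "global_solution m f u1 u2 \<longleftrightarrow> continuous_H1L2 u1 u2 \<and> distributional_solution m f u1 u2"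

definition odd_in_space :: "(real \<Rightarrow> real \<Rightarrow> real) \<Rightarrow> bool" where
  "odd_in_space u \<longleftrightarrow> (\<forall>t\<ge>0. AE x in lborel. u t (- x) = - u t x)"

definition time_periodic :: "(real \<Rightarrow> real \<Rightarrow> real) \<Rightarrow> (real \<Rightarrow> real \<Rightarrow> real) \<Rightarrow> bool" where
  "time_periodic u1 u2 \<longleftrightarrow>
     (\<exists>T>0. \<forall>t\<ge>0. AE x in lborel. u1 (t + T) x = u1 t x \<and> u2 (t + T) x = u2 t x)"

definition breather ::
  "real \<Rightarrow> (real \<Rightarrow> real) \<Rightarrow> (real \<Rightarrow> real \<Rightarrow> real) \<Rightarrow> (real \<Rightarrow> real \<Rightarrow> real) \<Rightarrow> bool" where
  "breather m f u1 u2 \<longleftrightarrow> global_solution m f u1 u2 \<and> time_periodic u1 u2"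

definition identically_zero :: "(real \<Rightarrow> real \<Rightarrow> real) \<Rightarrow> (real \<Rightarrow> real \<Rightarrow> real) \<Rightarrow> bool" where
  "identically_zero u1 u2 \<longleftrightarrow> (\<forall>t\<ge>0. AE x in lborel. u1 t x = 0 \<and> u2 t x = 0)"

text \<open>The supremum is taken in the extended reals, so that it is infinite for unbounded solutions.\<close>

definition sup_H1L2_norm :: "(real \<Rightarrow> real \<Rightarrow> real) \<Rightarrow> (real \<Rightarrow> real \<Rightarrow> real) \<Rightarrow> ereal" where
  "sup_H1L2_norm u1 u2 = (SUP t\<in>{0..}. ereal (H1L2_norm_on UNIV (u1 t) (u2 t)))"

end

theory Submission
  imports Defs "HOL-Real_Asymp.Real_Asymp"
begin

text \<open>
  Write \<open>p\<close> for the weak space derivative of \<open>u\<^sub>1\<close>. The functions \<open>u\<^sub>2 + p\<close> and \<open>u\<^sub>2 - p\<close>, as well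
  as \<open>u\<^sub>1\<close> itself, solve first-order transport equations whose right-hand sides are continuous
  in time with values in \<open>L\<^sup>2\<close>. Products of two functions transported in the same direction can
  therefore be differentiated in time after integration against a Lipschitz weight, without
  regularising the solution.

  With \<open>\<psi>(x) = sgn x (1 - exp (-2 \<bar>x\<bar>)) / 2\<close> the virial functional
  \<open>\<integral> \<psi> p u\<^sub>2 + \<psi>' u\<^sub>1 u\<^sub>2 / 2\<close> has derivative \<open>- D + N\<close>, where
  \<open>D = \<integral> exp (-2 \<bar>x\<bar>) (p - sgn x u\<^sub>1)\<^sup>2\<close>; this uses only \<open>u\<^sub>1(t, 0) = 0\<close>, which is what oddness
  provides, and the linear term \<open>m u\<^sub>1\<close> drops out. Integrating \<open>exp (-2 \<bar>x\<bar>) \<bar>u\<^sub>1\<bar>\<^sup>q\<close> by parts, where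
  \<open>f' (y) = O(\<bar>y\<bar>\<^sup>q\<^sup>-\<^sup>2)\<close> and \<open>q > 2\<close>, bounds the nonlinear term \<open>N\<close> by a small multiple of \<open>D\<close>.
  The defect \<open>D\<close> controls \<open>u\<^sub>1\<close> and its space derivative with the weight \<open>exp (-3 \<bar>x\<bar>)\<close>, and a second
  functional \<open>\<integral> exp (-3 \<bar>x\<bar>) u\<^sub>1 u\<^sub>2\<close> recovers \<open>u\<^sub>2\<close>. A combination of the two is bounded and decreases
  at least at the rate of the weighted energy, whose growth is at most exponential; hence this
  energy tends to zero.
\<close>

section \<open>Test functions\<close>

text \<open>The weight is dictated by the formal identity in which the virial functional has
  derivative \<open>- \<integral> psi' p^2 + \<integral> psi''' u^2 / 4\<close> plus nonlinear
  terms. Away from \<open>0\<close> the chosen \<open>psi\<close> satisfies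
  \<open>psi''' = 4 psi'\<close>, so this is \<open>- \<integral> psi' (p^2 - u^2)\<close>; the
  point mass of \<open>psi'''\<close> at \<open>0\<close> is harmless because \<open>u\<close>
  vanishes there. Writing \<open>u = exp \<bar>x\<bar> v\<close> turns \<open>D\<close> into
  \<open>\<integral> v_x^2\<close>. With \<open>v\<close> zero at the origin this is coercive, but
  it cannot bound \<open>\<integral> v^2\<close>, which is \<open>u\<close> with the weight of rate
  2; any faster rate works, and 3 is convenient. The obstacle is regularity: in
  \<open>H^1 \<times> L^2\<close> there is no second space derivative for the formal integrations by
  parts, and the weights have kinks. Every quadratic density is therefore split into products of
  quantities moving with one common speed: \<open>4 p u2 = (u2 + p)^2 - (u2 - p)^2\<close>, while
  \<open>u\<close> obeys a transport equation for each speed and can be paired with either factor. A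
  dissipation bound alone would give smallness only on average in time; the one-sided growth bound
  on the energy rules out short peaks.\<close>

lemma Ck_imp_continuous: "Ck k f \<Longrightarrow> continuous_on UNIV f"
  by (cases k) (auto simp: continuous_on_eq_continuous_at intro: differentiable_imp_continuous_within)

lemma Ck_SucD: "Ck (Suc k) f \<Longrightarrow> Ck k f"
proof (induction k arbitrary: f)
  case 0
  then show ?case using Ck_imp_continuous[of "Suc 0" f] by simp
next
  case (Suc k)
  then show ?case by (metis Ck.simps(2))
qed

lemma Ck_add: "Ck k f \<Longrightarrow> Ck k g \<Longrightarrow> Ck k (\<lambda>x. f x + g x)"
proof (induction k arbitrary: f g)
  case 0
  then show ?case by (auto intro: continuous_intros)
next
  case (Suc k)
  have "frechet_derivative (\<lambda>x. f x + g x) (at x) = (\<lambda>v. frechet_derivative f (at x) v + frechet_derivative g (at x) v)" for x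
    using Suc.prems
    by (intro frechet_derivative_at[symmetric] has_derivative_add) (auto simp: frechet_derivative_works)
  with Suc show ?case by auto
qed

lemma Ck_mult: "Ck k f \<Longrightarrow> Ck k g \<Longrightarrow> Ck k (\<lambda>x. f x * g x)"
proof (induction k arbitrary: f g)
  case 0
  then show ?case by (auto intro: continuous_intros)
next
  case (Suc k)
  have "frechet_derivative (\<lambda>x. f x * g x) (at x) = (\<lambda>v. f x * frechet_derivative g (at x) v + frechet_derivative f (at x) v * g x)" for x
    using Suc.prems
    by (intro frechet_derivative_at[symmetric] has_derivative_mult) (auto simp: frechet_derivative_works)
  with Suc show ?case
    by (auto intro!: Ck_add Suc.IH intro: Ck_SucD)
qed

lemma Ck_const: "Ck k (\<lambda>x. c)"
  by (induction k arbitrary: c) (auto intro: continuous_intros simp: frechet_derivative_const)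

lemma Ck_cmult: "Ck k f \<Longrightarrow> Ck k (\<lambda>x. c * f x)"
  by (intro Ck_mult Ck_const)

text \<open>A derivative of the composite in direction \<open>v\<close> is a derivative of
  \<open>f\<close> in direction \<open>L v\<close>, composed with the same affine map, so the
  induction closes. The domain and codomain of \<open>L\<close> may differ, which is what lifts
  functions of one variable to space-time.\<close>

lemma Ck_affine:
  assumes "bounded_linear L"
  shows "Ck k f \<Longrightarrow> Ck k (\<lambda>x. f (L x + c))"
proof (induction k arbitrary: f)
  case 0
  then show ?case
    using continuous_on_compose2[of UNIV f UNIV "\<lambda>x. L x + c"]
      continuous_on_add[OF linear_continuous_on[OF assms] continuous_on_const]
    by simp
next
  case (Suc k)
  have d: "((\<lambda>x. f (L x + c)) has_derivative (\<lambda>v. frechet_derivative f (at (L x + c)) (L v))) (at x)" for x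
  proof -
    have "(f has_derivative frechet_derivative f (at (L x + c))) (at (L x + c))"
      using Suc.prems by (auto simp: frechet_derivative_works)
    moreover have "((\<lambda>x. L x + c) has_derivative L) (at x)"
      using assms by (auto intro!: derivative_eq_intros bounded_linear_imp_has_derivative)
    ultimately show ?thesis
      using has_derivative_compose by blast
  qed
  show ?case
    using d frechet_derivative_at[OF d, symmetric] Suc.prems Suc.IH[of "\<lambda>x. frechet_derivative f (at x) _"]
    by (auto simp: differentiable_def)
qed

lemma frechet_derivative_real:
  fixes f :: "real \<Rightarrow> real"
  assumes "(f has_real_derivative d) (at x)"
  shows "frechet_derivative f (at x) v = d * v"
  using frechet_derivative_at[of f "(*) d" x] assms by (simp add: has_field_derivative_def)

lemma Ck_SucI_real:
  fixes f g :: "real \<Rightarrow> real"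
  assumes "\<And>x. (f has_real_derivative g x) (at x)" "Ck k g"
  shows "Ck (Suc k) f"
  using assms frechet_derivative_real[OF assms(1)]
  by (auto simp: real_differentiable_def intro!: Ck_mult Ck_const)

lemma Ck_Suc_real:
  fixes f :: "real \<Rightarrow> real"
  assumes "Ck (Suc k) f"
  shows "(f has_real_derivative deriv f x) (at x)" and "Ck k (deriv f)"
proof -
  have 1: "(f has_real_derivative deriv f x) (at x)" for x
    using assms DERIV_imp_deriv by (fastforce simp: real_differentiable_def)
  then show "(f has_real_derivative deriv f x) (at x)" .
  have "deriv f = (\<lambda>x. frechet_derivative f (at x) 1)"
    using frechet_derivative_real[OF 1] by auto
  then show "Ck k (deriv f)" using assms by auto
qed

text \<open>\<open>bump 0\<close> is the classical smooth function exp (-1/x) extended by zero. The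
  powers of \<open>inverse x\<close> close the family under differentiation up to linear
  combinations, so that smoothness of all members is a single induction.\<close>

definition bump :: "nat \<Rightarrow> real \<Rightarrow> real" where
  "bump n x = (if x \<le> 0 then 0 else inverse x ^ n * exp (- inverse x))"

lemma bump_tendsto: "(bump n \<longlongrightarrow> 0) (at 0)"
proof -
  have "((\<lambda>y. y ^ n / exp y) \<longlongrightarrow> (0::real)) at_top"
    by (rule tendsto_power_div_exp_0)
  then have "((\<lambda>x::real. inverse x ^ n / exp (inverse x)) \<longlongrightarrow> 0) (at_right 0)"
    by (rule filterlim_compose) (rule filterlim_inverse_at_top_right)
  moreover have "\<forall>\<^sub>F x in at_right 0. inverse x ^ n / exp (inverse x) = bump n x"
    unfolding eventually_at_right_field by (auto simp: bump_def exp_minus field_simps intro!: exI[of _ 1])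
  ultimately have "(bump n \<longlongrightarrow> 0) (at_right 0)"
    by (rule Lim_transform_eventually)
  moreover have "(bump n \<longlongrightarrow> 0) (at_left 0)"
    by (rule tendsto_eventually) (auto simp: eventually_at_left_field bump_def intro!: exI[of _ "-1"])
  ultimately show ?thesis
    by (simp add: filterlim_split_at)
qed

lemma bump_deriv: "(bump n has_real_derivative bump (n + 2) x - real n * bump (n + 1) x) (at x)"
proof -
  consider "x < 0" | "x > 0" | "x = 0" by linarith
  then show ?thesis
  proof cases
    case 1
    have "(bump n has_real_derivative 0) (at x)"
      by (rule DERIV_cong_ev[THEN iffD2, OF refl _ refl, of _ "\<lambda>_. 0"])
         (use 1 in \<open>auto simp: bump_def eventually_nhds intro!: exI[of _ "{..<0}"]\<close>)
    with 1 show ?thesis by (simp add: bump_def)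
  next
    case 2
    have "((\<lambda>x. inverse x ^ n * exp (- inverse x)) has_real_derivative bump (n + 2) x - real n * bump (n + 1) x) (at x)"
    proof (cases n)
      case 0
      then show ?thesis using 2
        by (auto intro!: derivative_eq_intros simp: bump_def field_simps power2_eq_square)
    next
      case (Suc k)
      have "((\<lambda>x. inverse x ^ n) has_real_derivative real n * (inverse x ^ k * - (inverse x * 1 * inverse x))) (at x)"
        using 2 DERIV_power[OF DERIV_inverse'[OF DERIV_ident], of x "Suc k"] unfolding Suc
        by (simp add: mult_ac del: power_inverse)
      then have "((\<lambda>x. inverse x ^ n * exp (- inverse x)) has_real_derivative
          real n * (inverse x ^ k * - (inverse x * 1 * inverse x)) * exp (- inverse x) +
          exp (- inverse x) * (inverse x * inverse x) * inverse x ^ n) (at x)"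
        by (rule DERIV_mult) (use 2 in \<open>auto intro!: derivative_eq_intros\<close>)
      then show ?thesis
        by (rule DERIV_cong) (use 2 Suc in \<open>simp add: bump_def algebra_simps\<close>)
    qed
    then show ?thesis
      by (rule DERIV_cong_ev[THEN iffD2, OF refl _ refl, rotated])
         (use 2 in \<open>auto simp: bump_def eventually_nhds intro!: exI[of _ "{0<..}"]\<close>)
  next
    case 3
    \<comment> \<open>Dividing by \<open>h\<close> raises the power of \<open>inverse h\<close> by
      one, so the difference quotient of \<open>bump n\<close> at \<open>0\<close> is
      \<open>bump (n + 1) h\<close>.\<close>
    have "((\<lambda>h. bump (n+1) h) \<longlongrightarrow> 0) (at 0)" by (rule bump_tendsto)
    then have "((\<lambda>h. (bump n (0 + h) - bump n 0) / h) \<longlongrightarrow> 0) (at 0)"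
      by (rule Lim_transform_eventually)
         (auto simp: eventually_at_filter bump_def field_simps)
    then show ?thesis using 3 by (simp add: DERIV_def bump_def)
  qed
qed

lemma Ck_bump: "Ck k (bump n)"
proof (induction k arbitrary: n)
  case 0
  have "isCont (bump n) x" for x using bump_deriv DERIV_isCont by blast
  then show ?case by (simp add: continuous_on_eq_continuous_at)
next
  case (Suc k)
  have "Ck k (\<lambda>x. bump (n + 2) x + - real n * bump (n + 1) x)"
    by (intro Ck_add Ck_cmult Suc)
  then show ?case
    using bump_deriv by (intro Ck_SucI_real[of _ "\<lambda>x. bump (n + 2) x + - real n * bump (n + 1) x"]) auto
qed

abbreviation test_fun :: "(real \<Rightarrow> real) \<Rightarrow> bool" where
  "test_fun \<equiv> test_function_on UNIV"

lemma test_function_onD: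
  assumes "test_function_on U \<phi>"
  shows "Ck k \<phi>" "compact (closure {x. \<phi> x \<noteq> 0})" "closure {x. \<phi> x \<noteq> 0} \<subseteq> U"
  using assms by (auto simp: test_function_on_def)

lemma test_function_onI:
  assumes "\<And>k. Ck k \<phi>" "compact K" "K \<subseteq> U" "\<And>x. \<phi> x \<noteq> 0 \<Longrightarrow> x \<in> K"
  shows "test_function_on U \<phi>"
proof -
  have "closure {x. \<phi> x \<noteq> 0} \<subseteq> K"
    using assms by (intro closure_minimal) (auto simp: compact_imp_closed)
  then show ?thesis unfolding test_function_on_def
    using assms by (auto intro: compact_closure[THEN iffD2] bounded_subset compact_imp_bounded
      bounded_subset[OF _ closure_subset])
qed

lemma test_function_on_mono: "test_function_on U \<phi> \<Longrightarrow> U \<subseteq> V \<Longrightarrow> test_function_on V \<phi>"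
  by (auto simp: test_function_on_def)

text \<open>Compactness of the support leaves a margin at both ends. For nonempty support the new
  endpoints are midpoints between the ends of the interval and the extreme points of the
  support.\<close>

lemma test_function_on_obtain:
  fixes \<phi> :: "real \<Rightarrow> real"
  assumes "test_function_on {a<..<b} \<phi>" "a < b"
  obtains a' b' where "a < a'" "a' < b'" "b' < b" "\<And>x. \<phi> x \<noteq> 0 \<Longrightarrow> a' < x \<and> x < b'"
proof (cases "closure {x. \<phi> x \<noteq> 0} = {}")
  case True
  then have "\<And>x. \<phi> x = 0" by auto
  with \<open>a < b\<close> show ?thesis
    by (intro that[of "(2*a+b)/3" "(a+2*b)/3"]) (auto simp: field_simps)
next
  case False
  note K = test_function_onD[OF assms(1)]
  obtain l where l: "l \<in> closure {x. \<phi> x \<noteq> 0}" "\<And>x. x \<in> closure {x. \<phi> x \<noteq> 0} \<Longrightarrow> l \<le> x"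
    using compact_attains_inf[OF K(2) False] by blast
  obtain r where r: "r \<in> closure {x. \<phi> x \<noteq> 0}" "\<And>x. x \<in> closure {x. \<phi> x \<noteq> 0} \<Longrightarrow> x \<le> r"
    using compact_attains_sup[OF K(2) False] by blast
  have lr: "a < l" "l < b" "a < r" "r < b" "l \<le> r" using l r K(3) by auto
  show ?thesis
  proof (rule that[of "(a+l)/2" "(b+r)/2"])
    fix x assume "\<phi> x \<noteq> 0"
    then have "x \<in> closure {x. \<phi> x \<noteq> 0}" using closure_subset[of "{x. \<phi> x \<noteq> 0}"] by auto
    then have "l \<le> x" "x \<le> r" using l r by auto
    then show "(a+l)/2 < x \<and> x < (b+r)/2" using lr by auto
  qed (use lr in auto)
qed

lemma test_fun_obtain:
  assumes "test_fun \<phi>"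
  obtains K where "K > 0" "\<And>x. \<phi> x \<noteq> 0 \<Longrightarrow> \<bar>x\<bar> < K"
proof -
  have "bounded {x. \<phi> x \<noteq> 0}"
    using test_function_onD(2)[OF assms] compact_imp_bounded bounded_subset closure_subset by blast
  then obtain K where "\<And>x. \<phi> x \<noteq> 0 \<Longrightarrow> \<bar>x\<bar> \<le> K" by (auto simp: bounded_iff)
  then show ?thesis by (intro that[of "\<bar>K\<bar> + 1"]) force+
qed

lemma test_function_on_add:
  assumes "test_function_on U f" "test_function_on U g"
  shows "test_function_on U (\<lambda>x. f x + g x)"
proof (rule test_function_onI[of _ "closure {x. f x \<noteq> 0} \<union> closure {x. g x \<noteq> 0}"])
  show "f x + g x \<noteq> 0 \<Longrightarrow> x \<in> closure {x. f x \<noteq> 0} \<union> closure {x. g x \<noteq> 0}" for x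
    using closure_subset[of "{x. f x \<noteq> 0}"] closure_subset[of "{x. g x \<noteq> 0}"]
    by (cases "f x = 0") auto
qed (use assms in \<open>auto simp: test_function_on_def intro: Ck_add\<close>)

lemma test_function_on_mult:
  assumes "test_function_on U f" "\<And>k. Ck k g"
  shows "test_function_on U (\<lambda>x. f x * g x)"
  by (rule test_function_onI[of _ "closure {x. f x \<noteq> 0}"])
     (use assms closure_subset[of "{x. f x \<noteq> 0}"] in \<open>auto simp: test_function_on_def intro: Ck_mult\<close>)

lemma test_function_on_cmult:
  "test_function_on U f \<Longrightarrow> test_function_on U (\<lambda>x. c * f x)"
  using test_function_on_mult[of U f "\<lambda>_. c"] by (simp add: Ck_const mult.commute)

lemma test_function_has_deriv:
  fixes \<phi> :: "real \<Rightarrow> real"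
  shows "test_function_on U \<phi> \<Longrightarrow> (\<phi> has_real_derivative deriv \<phi> x) (at x)"
  using Ck_Suc_real(1) test_function_onD(1) by blast

lemma test_function_on_deriv:
  fixes \<phi> :: "real \<Rightarrow> real"
  assumes "test_function_on U \<phi>"
  shows "test_function_on U (deriv \<phi>)"
proof (rule test_function_onI[of _ "closure {x. \<phi> x \<noteq> 0}"])
  show "Ck k (deriv \<phi>)" for k
    using Ck_Suc_real(2) test_function_onD(1)[OF assms] by blast
  fix x assume "deriv \<phi> x \<noteq> 0"
  show "x \<in> closure {x. \<phi> x \<noteq> 0}"
  proof (rule ccontr)
    assume x: "x \<notin> closure {x. \<phi> x \<noteq> 0}"
    have "(\<phi> has_real_derivative 0) (at x)"
    proof (rule DERIV_cong_ev[THEN iffD2, OF refl _ refl, of _ "\<lambda>_. 0"])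
      show "\<forall>\<^sub>F x in nhds x. \<phi> x = 0" unfolding eventually_nhds
        using x closure_subset[of "{x. \<phi> x \<noteq> 0}"]
        by (intro exI[of _ "- closure {x. \<phi> x \<noteq> 0}"]) auto
    qed simp
    then show False using \<open>deriv \<phi> x \<noteq> 0\<close> DERIV_imp_deriv by blast
  qed
qed (use assms in \<open>auto simp: test_function_on_def\<close>)

text \<open>For \<open>y > 0\<close> the value exp (-1/(n y)) tends to 1 as \<open>n\<close> grows,
  and for \<open>y \<le> 0\<close> it is 0. Dilation alone thus turns a product of two bumps into a
  smooth approximation from below of the indicator of \<open>{a<..<b}\<close>.\<close>

definition plateau :: "real \<Rightarrow> real \<Rightarrow> nat \<Rightarrow> real \<Rightarrow> real" where
  "plateau a b n x = bump 0 (real n * (x - a)) * bump 0 (real n * (b - x))"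

lemma Ck_plateau: "Ck k (plateau a b n)"
proof -
  have 1: "Ck k (\<lambda>x. bump 0 (real n * x + (- real n * a)))"
    by (rule Ck_affine[of "\<lambda>x. real n * x", OF bounded_linear_mult_right Ck_bump])
  have 2: "Ck k (\<lambda>x. bump 0 ((- real n) * x + (real n * b)))"
    by (rule Ck_affine[of "\<lambda>x. (- real n) * x", OF bounded_linear_mult_right Ck_bump])
  show ?thesis
    using Ck_mult[OF 1 2] unfolding plateau_def by (simp add: algebra_simps)
qed

lemma plateau_nz: "plateau a b n x \<noteq> 0 \<Longrightarrow> a < x \<and> x < b"
  by (auto simp: plateau_def bump_def mult_le_0_iff split: if_splits)

lemma plateau_bounds: "0 \<le> plateau a b n x" "plateau a b n x \<le> 1"
proof -
  have "0 \<le> bump 0 y \<and> bump 0 y \<le> 1" for y by (auto simp: bump_def)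
  then show "0 \<le> plateau a b n x" "plateau a b n x \<le> 1"
    unfolding plateau_def by (auto intro: mult_le_one)
qed

lemma plateau_tendsto: "(\<lambda>n. plateau a b n x) \<longlonglongrightarrow> indicator {a<..<b} x"
proof (cases "a < x \<and> x < b")
  case True
  have *: "(\<lambda>n. exp (- inverse (real n * c))) \<longlonglongrightarrow> 1" if "c > 0" for c
    using that by real_asymp
  have "(\<lambda>n. exp (- inverse (real n * (x - a))) * exp (- inverse (real n * (b - x)))) \<longlonglongrightarrow> 1 * 1"
    using True by (intro tendsto_mult *) auto
  then have "(\<lambda>n. plateau a b n x) \<longlonglongrightarrow> 1 * 1"
    by (rule Lim_transform_eventually)
       (use True in \<open>auto simp: plateau_def bump_def eventually_sequentially not_le mult_le_0_iff intro!: exI[of _ 1]\<close>)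
  then show ?thesis using True by simp
next
  case False
  then have "plateau a b n x = 0" for n using plateau_nz by blast
  with False show ?thesis by (auto simp: indicator_def)
qed

lemma test_plateau: "a < a' \<Longrightarrow> b' < b \<Longrightarrow> test_function_on {a<..<b} (plateau a' b' n)"
  by (rule test_function_onI[of _ "{a'..b'}"]) (auto simp: Ck_plateau dest: plateau_nz)

lemma test_fun_plateau: "test_fun (plateau a b n)"
  by (rule test_function_on_mono[OF test_plateau[of "a-1" a b "b+1"]]) auto


section \<open>Square-integrable functions\<close>

definition L2 :: "(real \<Rightarrow> real) \<Rightarrow> bool" where
  "L2 u \<longleftrightarrow> u \<in> borel_measurable borel \<and> integrable lborel (\<lambda>x. (u x)\<^sup>2)"

definition ip :: "(real \<Rightarrow> real) \<Rightarrow> (real \<Rightarrow> real) \<Rightarrow> real" where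
  "ip u v = (\<integral>x. u x * v x \<partial>lborel)"

lemma L2_measurable[measurable_dest]: "L2 u \<Longrightarrow> u \<in> borel_measurable borel"
  by (simp add: L2_def)

lemma L2_on_UNIV_iff: "L2_on UNIV u \<longleftrightarrow> L2 u"
  by (simp add: L2_on_def L2_def set_borel_measurable_def set_integrable_def)

lemma L2_integrable_sq: "L2 u \<Longrightarrow> integrable lborel (\<lambda>x. (u x)\<^sup>2)"
  by (simp add: L2_def)

lemma L2I_dominated:
  assumes "u \<in> borel_measurable borel" "integrable lborel w" "AE x in lborel. (u x)\<^sup>2 \<le> w x"
  shows "L2 u"
proof -
  have "AE x in lborel. norm ((u x)\<^sup>2) \<le> norm (w x)"
    using assms(3) by eventually_elim simp
  then have "integrable lborel (\<lambda>x. (u x)\<^sup>2)"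
    using assms(1) by (intro Bochner_Integration.integrable_bound[OF assms(2)]) auto
  with assms(1) show ?thesis by (simp add: L2_def)
qed

lemma two_mult_le_squares: "2 * \<bar>a * b\<bar> \<le> a\<^sup>2 + (b::real)\<^sup>2"
  using sum_squares_bound[of "\<bar>a\<bar>" "\<bar>b\<bar>"] by (simp add: abs_mult mult.assoc)

lemma square_add_le: "(a + b)\<^sup>2 \<le> 2 * a\<^sup>2 + 2 * (b::real)\<^sup>2"
  using sum_squares_bound[of a b] by (simp add: power2_sum)

lemma square_diff_le: "(a - b)\<^sup>2 \<le> 2 * a\<^sup>2 + 2 * (b::real)\<^sup>2"
  using square_add_le[of a "- b"] by simp

lemma L2_integrable_mult:
  assumes "L2 u" "L2 v"
  shows "integrable lborel (\<lambda>x. u x * v x)"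
proof (rule Bochner_Integration.integrable_bound)
  show "integrable lborel (\<lambda>x. (u x)\<^sup>2 + (v x)\<^sup>2)" using assms by (auto simp: L2_def)
  show "AE x in lborel. norm (u x * v x) \<le> norm ((u x)\<^sup>2 + (v x)\<^sup>2)"
  proof (rule AE_I2)
    fix x show "norm (u x * v x) \<le> norm ((u x)\<^sup>2 + (v x)\<^sup>2)"
      using two_mult_le_squares[of "u x" "v x"] by simp
  qed
qed (use assms in \<open>measurable\<close>)

lemma L2_add: "L2 u \<Longrightarrow> L2 v \<Longrightarrow> L2 (\<lambda>x. u x + v x)"
  by (rule L2I_dominated[of _ "\<lambda>x. 2 * (u x)\<^sup>2 + 2 * (v x)\<^sup>2"])
     (auto simp: L2_def square_add_le)

lemma L2_cmult: "L2 u \<Longrightarrow> L2 (\<lambda>x. c * u x)"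
  by (auto simp: L2_def power_mult_distrib)

lemma L2_diff: "L2 u \<Longrightarrow> L2 v \<Longrightarrow> L2 (\<lambda>x. u x - v x)"
  using L2_add[of u "\<lambda>x. -1 * v x"] L2_cmult[of v "-1"] by simp

lemma L2_bounded_mult:
  assumes "L2 u" "c \<in> borel_measurable borel" "\<And>x. \<bar>c x\<bar> \<le> M"
  shows "L2 (\<lambda>x. c x * u x)"
proof (rule L2I_dominated[of _ "\<lambda>x. M\<^sup>2 * (u x)\<^sup>2"])
  show "AE x in lborel. (c x * u x)\<^sup>2 \<le> M\<^sup>2 * (u x)\<^sup>2"
  proof (rule AE_I2)
    fix x have "(c x)\<^sup>2 \<le> M\<^sup>2" using power_mono[OF assms(3)[of x], of 2] by simp
    then show "(c x * u x)\<^sup>2 \<le> M\<^sup>2 * (u x)\<^sup>2" by (simp add: power_mult_distrib mult_right_mono)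
  qed
qed (use assms in \<open>auto simp: L2_def\<close>)

lemma L2_shift: "L2 u \<Longrightarrow> L2 (\<lambda>x. u (x + h))"
  unfolding L2_def
  using lborel_integrable_real_affine[of "\<lambda>x. (u x)\<^sup>2" 1 h] by (auto simp: add.commute)

lemma integral_shift: "(\<integral>x. f (x + h) \<partial>lborel) = (\<integral>x. f x \<partial>lborel)" for f :: "real \<Rightarrow> real"
  using lborel_integral_real_affine[of 1 f h] by (simp add: add.commute)

lemma ip_shift: "ip (\<lambda>x. u (x + h)) (\<lambda>x. v (x + h)) = ip u v"
  unfolding ip_def by (rule integral_shift[of "\<lambda>x. u x * v x"])

lemma ip_commute: "ip u v = ip v u"
  by (simp add: ip_def mult.commute)

lemma ip_add_left: "L2 u \<Longrightarrow> L2 v \<Longrightarrow> L2 w \<Longrightarrow> ip (\<lambda>x. u x + v x) w = ip u w + ip v w"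
  by (simp add: ip_def distrib_right L2_integrable_mult)

lemma ip_diff_left: "L2 u \<Longrightarrow> L2 v \<Longrightarrow> L2 w \<Longrightarrow> ip (\<lambda>x. u x - v x) w = ip u w - ip v w"
  by (simp add: ip_def left_diff_distrib L2_integrable_mult)

lemma ip_add_right: "L2 u \<Longrightarrow> L2 v \<Longrightarrow> L2 w \<Longrightarrow> ip w (\<lambda>x. u x + v x) = ip w u + ip w v"
  by (simp add: ip_def distrib_left L2_integrable_mult)

lemma ip_diff_right: "L2 u \<Longrightarrow> L2 v \<Longrightarrow> L2 w \<Longrightarrow> ip w (\<lambda>x. u x - v x) = ip w u - ip w v"
  by (simp add: ip_def right_diff_distrib L2_integrable_mult)

lemma ip_cmult_left: "ip (\<lambda>x. c * u x) w = c * ip u w"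
  by (simp add: ip_def mult.assoc)

lemma ip_self_eq: "ip u u = (\<integral>x. (u x)\<^sup>2 \<partial>lborel)"
  by (simp add: ip_def power2_eq_square)

lemma ip_nonneg: "0 \<le> ip u u"
  by (simp add: ip_def)

lemma ip_self_eq_0D:
  assumes "L2 u" "ip u u = 0"
  shows "AE x in lborel. u x = 0"
  using assms integral_nonneg_eq_0_iff_AE[of lborel "\<lambda>x. (u x)\<^sup>2"] by (simp add: ip_self_eq L2_def)

lemma ip_add_le: "L2 u \<Longrightarrow> L2 v \<Longrightarrow> ip (\<lambda>x. u x + v x) (\<lambda>x. u x + v x) \<le> 2 * ip u u + 2 * ip v v"
  unfolding ip_self_eq
  using integral_mono[of lborel "\<lambda>x. (u x + v x)\<^sup>2" "\<lambda>x. 2 * (u x)\<^sup>2 + 2 * (v x)\<^sup>2"] L2_add[of u v]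
  by (simp add: L2_def square_add_le)

lemma ip_diff_le: "L2 u \<Longrightarrow> L2 v \<Longrightarrow> ip (\<lambda>x. u x - v x) (\<lambda>x. u x - v x) \<le> 2 * ip u u + 2 * ip v v"
  unfolding ip_self_eq
  using integral_mono[of lborel "\<lambda>x. (u x - v x)\<^sup>2" "\<lambda>x. 2 * (u x)\<^sup>2 + 2 * (v x)\<^sup>2"] L2_diff[of u v]
  by (simp add: L2_def square_diff_le)

lemma ip_Cauchy_Schwarz:
  assumes "L2 u" "L2 v"
  shows "\<bar>ip u v\<bar> \<le> sqrt (ip u u) * sqrt (ip v v)"
proof -
  have q: "0 \<le> ip u u + 2 * t * ip u v + t\<^sup>2 * ip v v" for t
  proof -
    have "0 \<le> ip (\<lambda>x. u x + t * v x) (\<lambda>x. u x + t * v x)" by (rule ip_nonneg)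
    also have "\<dots> = ip u u + 2 * t * ip u v + t\<^sup>2 * ip v v"
      using assms L2_cmult[OF assms(2), of t]
      by (simp add: ip_add_left ip_add_right L2_add ip_cmult_left ip_commute[of _ "\<lambda>x. t * v x"]
        ip_commute[of v u] power2_eq_square algebra_simps)
    finally show ?thesis .
  qed
  have "(ip u v)\<^sup>2 \<le> ip u u * ip v v"
  proof (cases "ip v v = 0")
    case True
    have "ip u v = 0"
    proof (rule ccontr)
      assume nz: "ip u v \<noteq> 0"
      \<comment> \<open>Without its quadratic term the polynomial is affine in \<open>t\<close> and
        cannot stay nonnegative; this \<open>t\<close> gives it the value -1.\<close>
      have "0 \<le> ip u u + 2 * (- (ip u u + 1) / (2 * ip u v)) * ip u v" using q[of "- (ip u u + 1) / (2 * ip u v)"] True by simp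
      also have "\<dots> = -1" using nz by (simp add: field_simps)
      finally show False by simp
    qed
    with True show ?thesis by simp
  next
    case False
    with ip_nonneg[of v] have v: "ip v v > 0" by linarith
    have "0 \<le> ip u u + 2 * (- ip u v / ip v v) * ip u v + (- ip u v / ip v v)\<^sup>2 * ip v v" by (rule q)
    also have "\<dots> = ip u u - (ip u v)\<^sup>2 / ip v v"
      using v by (simp add: field_simps power2_eq_square)
    finally show ?thesis using v by (simp add: field_simps)
  qed
  then have "sqrt ((ip u v)\<^sup>2) \<le> sqrt (ip u u * ip v v)" by (rule real_sqrt_le_mono)
  then show ?thesis by (simp add: real_sqrt_mult)
qed

lemma ip_tendsto:
  assumes "\<forall>\<^sub>F s in F. L2 (u s)" "\<forall>\<^sub>F s in F. L2 (v s)" "L2 u0" "L2 v0"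
    and "((\<lambda>s. ip (\<lambda>x. u s x - u0 x) (\<lambda>x. u s x - u0 x)) \<longlongrightarrow> 0) F"
    and "((\<lambda>s. ip (\<lambda>x. v s x - v0 x) (\<lambda>x. v s x - v0 x)) \<longlongrightarrow> 0) F"
  shows "((\<lambda>s. ip (u s) (v s)) \<longlongrightarrow> ip u0 v0) F"
proof -
  let ?U = "\<lambda>s. sqrt (ip (\<lambda>x. u s x - u0 x) (\<lambda>x. u s x - u0 x))"
  let ?V = "\<lambda>s. sqrt (ip (\<lambda>x. v s x - v0 x) (\<lambda>x. v s x - v0 x))"
  have "((\<lambda>s. ?U s * ?V s + ?U s * sqrt (ip v0 v0) + sqrt (ip u0 u0) * ?V s) \<longlongrightarrow>
      sqrt 0 * sqrt 0 + sqrt 0 * sqrt (ip v0 v0) + sqrt (ip u0 u0) * sqrt 0) F"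
    by (intro tendsto_intros assms)
  then have lim: "((\<lambda>s. ?U s * ?V s + ?U s * sqrt (ip v0 v0) + sqrt (ip u0 u0) * ?V s) \<longlongrightarrow> 0) F" by simp
  have "((\<lambda>s. ip (u s) (v s) - ip u0 v0) \<longlongrightarrow> 0) F"
  proof (rule Lim_null_comparison[OF _ lim])
    show "\<forall>\<^sub>F s in F. norm (ip (u s) (v s) - ip u0 v0) \<le> ?U s * ?V s + ?U s * sqrt (ip v0 v0) + sqrt (ip u0 u0) * ?V s"
      using assms(1,2)
    proof eventually_elim
      fix s assume us: "L2 (u s)" and vs: "L2 (v s)"
      have "ip (u s) (v s) - ip u0 v0 = ip (\<lambda>x. u s x - u0 x) (\<lambda>x. v s x - v0 x)
          + ip (\<lambda>x. u s x - u0 x) v0 + ip u0 (\<lambda>x. v s x - v0 x)"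
        using us vs assms(3,4) by (simp add: ip_diff_left ip_diff_right L2_diff)
      then show "norm (ip (u s) (v s) - ip u0 v0) \<le> ?U s * ?V s + ?U s * sqrt (ip v0 v0) + sqrt (ip u0 u0) * ?V s"
        using ip_Cauchy_Schwarz[OF L2_diff[OF us assms(3)] L2_diff[OF vs assms(4)]]
          ip_Cauchy_Schwarz[OF L2_diff[OF us assms(3)] assms(4)]
          ip_Cauchy_Schwarz[OF assms(3) L2_diff[OF vs assms(4)]]
        by (simp only: real_norm_def)
    qed
  qed
  then show ?thesis by (simp add: Lim_null[symmetric])
qed

lemma L2_dominated_convergence:
  assumes "\<And>n. s n \<in> borel_measurable borel" "u \<in> borel_measurable borel" "L2 w"
    and "\<And>n. AE x in lborel. \<bar>s n x\<bar> \<le> w x" "AE x in lborel. (\<lambda>n. s n x) \<longlonglongrightarrow> u x"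
  shows "L2 (s n)" "L2 u" "(\<lambda>n. ip (\<lambda>x. s n x - u x) (\<lambda>x. s n x - u x)) \<longlonglongrightarrow> 0"
proof -
  have ub: "AE x in lborel. \<bar>u x\<bar> \<le> w x"
  proof -
    have "AE x in lborel. \<forall>n. \<bar>s n x\<bar> \<le> w x" using assms(4) by (simp add: AE_all_countable)
    with assms(5) show ?thesis
    proof eventually_elim
      case (elim x)
      then show ?case by (intro tendsto_upperbound[OF tendsto_rabs[OF elim(1)]]) auto
    qed
  qed
  have sq: "\<bar>a\<bar> \<le> b \<Longrightarrow> a\<^sup>2 \<le> (b::real)\<^sup>2" for a b
    using power_mono[of "\<bar>a\<bar>" b 2] by simp
  show "L2 (s n)"
    by (rule L2I_dominated[OF _ L2_integrable_sq[OF assms(3)]]) (use assms(1) assms(4)[of n] in \<open>auto elim!: eventually_mono intro: sq\<close>)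
  show "L2 u"
    by (rule L2I_dominated[OF _ L2_integrable_sq[OF assms(3)]]) (use assms(2) ub in \<open>auto elim!: eventually_mono intro: sq\<close>)
  have "(\<lambda>n. \<integral>x. (s n x - u x)\<^sup>2 \<partial>lborel) \<longlonglongrightarrow> (\<integral>x. 0 \<partial>(lborel :: real measure))"
  proof (rule integral_dominated_convergence[where w="\<lambda>x. 4 * (w x)\<^sup>2"])
    show "integrable lborel (\<lambda>x. 4 * (w x)\<^sup>2)" using assms(3) by (simp add: L2_def)
    show "AE x in lborel. (\<lambda>n. (s n x - u x)\<^sup>2) \<longlonglongrightarrow> 0"
      using assms(5)
    proof eventually_elim
      fix x assume "(\<lambda>n. s n x) \<longlonglongrightarrow> u x"
      then have "(\<lambda>n. (s n x - u x)\<^sup>2) \<longlonglongrightarrow> (u x - u x)\<^sup>2" by (intro tendsto_intros)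
      then show "(\<lambda>n. (s n x - u x)\<^sup>2) \<longlonglongrightarrow> 0" by simp
    qed
    show "AE x in lborel. norm ((s n x - u x)\<^sup>2) \<le> 4 * (w x)\<^sup>2" for n
      using assms(4)[of n] ub
    proof eventually_elim
      case (elim x)
      then show ?case using square_diff_le[of "s n x" "u x"] sq[of "s n x"] sq[of "u x"] by fastforce
    qed
  qed (use assms in measurable)
  then show "(\<lambda>n. ip (\<lambda>x. s n x - u x) (\<lambda>x. s n x - u x)) \<longlonglongrightarrow> 0"
    by (simp add: ip_self_eq)
qed

lemma L2_indicator_bounded: "A \<in> sets borel \<Longrightarrow> A \<subseteq> {-K..K} \<Longrightarrow> L2 (indicator A)"
  by (rule L2I_dominated[of _ "indicator {-K..K}"])
     (auto simp: indicator_def emeasure_lborel_Icc_eq intro!: integrable_real_indicator AE_I2)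

section \<open>Density of test functions in \<open>L2\<close>\<close>

lemma test_fun_bounded:
  assumes "test_fun \<phi>"
  obtains K M where "K > 0" "M > 0" "\<And>x. \<bar>\<phi> x\<bar> \<le> M * indicator {-K..K} x"
proof -
  obtain K where K: "K > 0" "\<And>x. \<phi> x \<noteq> 0 \<Longrightarrow> \<bar>x\<bar> < K" using test_fun_obtain[OF assms] by blast
  have "continuous_on {-K..K} \<phi>"
    using Ck_imp_continuous[OF test_function_onD(1)[OF assms]] continuous_on_subset by blast
  then have "bounded (\<phi> ` {-K..K})" by (intro compact_imp_bounded compact_continuous_image) auto
  then obtain M where M: "\<And>x. x \<in> {-K..K} \<Longrightarrow> \<bar>\<phi> x\<bar> \<le> M" unfolding bounded_iff by fastforce
  show ?thesis
  proof (rule that[of K "\<bar>M\<bar> + 1"])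
    fix x show "\<bar>\<phi> x\<bar> \<le> (\<bar>M\<bar> + 1) * indicator {- K..K} x"
      using K(2)[of x] M[of x] by (cases "x \<in> {-K..K}"; cases "\<phi> x = 0") auto
  qed (use K in auto)
qed

lemma test_fun_measurable: "test_fun \<phi> \<Longrightarrow> \<phi> \<in> borel_measurable borel"
  using Ck_imp_continuous[OF test_function_onD(1)] borel_measurable_continuous_onI by blast

lemma test_fun_L2:
  assumes "test_fun \<phi>"
  shows "L2 \<phi>"
proof -
  obtain K M where "M > 0" "\<And>x. \<bar>\<phi> x\<bar> \<le> M * indicator {-K..K} x"
    using test_fun_bounded[OF assms] by blast
  then show ?thesis
    using L2_dominated_convergence(1)[of "\<lambda>n. \<phi>" \<phi> "\<lambda>x. M * indicator {-K..K} x"]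
      L2_cmult[OF L2_indicator_bounded[of "{-K..K}" K], of M] test_fun_measurable[OF assms] by auto
qed

text \<open>Membership in the closure of the test functions, as a predicate stable under sums,
  multiples and limits. Density then follows by climbing from intervals through Borel sets and
  simple functions to all of \<open>L2\<close>.\<close>

definition test_approx :: "(real \<Rightarrow> real) \<Rightarrow> bool" where
  "test_approx u \<longleftrightarrow> L2 u \<and> (\<forall>e>0. \<exists>\<phi>. test_fun \<phi> \<and> ip (\<lambda>x. u x - \<phi> x) (\<lambda>x. u x - \<phi> x) < e)"

lemma test_approx_test: "test_fun \<phi> \<Longrightarrow> test_approx \<phi>"
  by (auto simp: test_approx_def test_fun_L2 ip_def intro!: exI[of _ \<phi>])

lemma test_approx_add:
  assumes "test_approx u" "test_approx v"
  shows "test_approx (\<lambda>x. u x + v x)"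
  unfolding test_approx_def
proof (intro conjI allI impI)
  show "L2 (\<lambda>x. u x + v x)" using assms by (auto simp: test_approx_def intro: L2_add)
  fix e :: real assume "e > 0"
  then obtain \<phi> \<psi> where \<phi>: "test_fun \<phi>" "ip (\<lambda>x. u x - \<phi> x) (\<lambda>x. u x - \<phi> x) < e/4"
    and \<psi>: "test_fun \<psi>" "ip (\<lambda>x. v x - \<psi> x) (\<lambda>x. v x - \<psi> x) < e/4"
    using assms unfolding test_approx_def by (meson divide_pos_pos zero_less_numeral)
  have "ip (\<lambda>x. (u x - \<phi> x) + (v x - \<psi> x)) (\<lambda>x. (u x - \<phi> x) + (v x - \<psi> x)) < e"
    using ip_add_le[of "\<lambda>x. u x - \<phi> x" "\<lambda>x. v x - \<psi> x"] \<phi> \<psi> assms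
    by (auto simp: test_approx_def test_fun_L2 L2_diff)
  then show "\<exists>\<phi>. test_fun \<phi> \<and> ip (\<lambda>x. u x + v x - \<phi> x) (\<lambda>x. u x + v x - \<phi> x) < e"
    using \<phi> \<psi> by (intro exI[of _ "\<lambda>x. \<phi> x + \<psi> x"]) (simp add: test_function_on_add algebra_simps)
qed

lemma test_approx_cmult:
  assumes "test_approx u"
  shows "test_approx (\<lambda>x. c * u x)"
  unfolding test_approx_def
proof (intro conjI allI impI)
  show "L2 (\<lambda>x. c * u x)" using assms by (auto simp: test_approx_def intro: L2_cmult)
  fix e :: real assume "e > 0"
  then have "e / (c\<^sup>2 + 1) > 0" by (simp add: add_nonneg_pos)
  then obtain \<phi> where \<phi>: "test_fun \<phi>" "ip (\<lambda>x. u x - \<phi> x) (\<lambda>x. u x - \<phi> x) < e / (c\<^sup>2 + 1)"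
    using assms unfolding test_approx_def by blast
  have "ip (\<lambda>x. c * (u x - \<phi> x)) (\<lambda>x. c * (u x - \<phi> x)) = c\<^sup>2 * ip (\<lambda>x. u x - \<phi> x) (\<lambda>x. u x - \<phi> x)"
    by (simp add: ip_cmult_left ip_commute[of "\<lambda>x. u x - \<phi> x" "\<lambda>x. c * (u x - \<phi> x)"] power2_eq_square)
  also have "\<dots> \<le> (c\<^sup>2 + 1) * ip (\<lambda>x. u x - \<phi> x) (\<lambda>x. u x - \<phi> x)"
    by (intro mult_right_mono ip_nonneg) auto
  also have "\<dots> < e" using \<phi>(2) by (simp add: field_simps add_pos_nonneg add_nonneg_pos)
  finally show "\<exists>\<phi>. test_fun \<phi> \<and> ip (\<lambda>x. c * u x - \<phi> x) (\<lambda>x. c * u x - \<phi> x) < e"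
    using \<phi> by (intro exI[of _ "\<lambda>x. c * \<phi> x"]) (simp add: test_function_on_cmult right_diff_distrib)
qed

lemma test_approx_lim:
  assumes "\<And>n. test_approx (s n)" "L2 u" "(\<lambda>n. ip (\<lambda>x. s n x - u x) (\<lambda>x. s n x - u x)) \<longlonglongrightarrow> 0"
  shows "test_approx u"
  unfolding test_approx_def
proof (intro conjI allI impI)
  fix e :: real assume "e > 0"
  then have "\<forall>\<^sub>F n in sequentially. ip (\<lambda>x. s n x - u x) (\<lambda>x. s n x - u x) < e/4"
    using order_tendstoD(2)[OF assms(3), of "e/4"] by simp
  then obtain n where n: "ip (\<lambda>x. s n x - u x) (\<lambda>x. s n x - u x) < e/4"
    by (auto simp: eventually_sequentially)
  obtain \<phi> where \<phi>: "test_fun \<phi>" "ip (\<lambda>x. s n x - \<phi> x) (\<lambda>x. s n x - \<phi> x) < e/4"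
    using assms(1)[of n] \<open>e > 0\<close> unfolding test_approx_def by (meson divide_pos_pos zero_less_numeral)
  have "L2 (s n)" using assms(1) by (auto simp: test_approx_def)
  then have "ip (\<lambda>x. (u x - s n x) + (s n x - \<phi> x)) (\<lambda>x. (u x - s n x) + (s n x - \<phi> x)) < e"
    using ip_add_le[of "\<lambda>x. u x - s n x" "\<lambda>x. s n x - \<phi> x"] n \<phi> assms(2)
    by (auto simp: test_fun_L2 L2_diff ip_self_eq power2_commute[of "u _" "s n _"])
  then show "\<exists>\<phi>. test_fun \<phi> \<and> ip (\<lambda>x. u x - \<phi> x) (\<lambda>x. u x - \<phi> x) < e"
    using \<phi> by auto
qed (rule assms)

lemma test_approx_sum:
  assumes "finite I" "\<And>i. i \<in> I \<Longrightarrow> test_approx (g i)"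
  shows "test_approx (\<lambda>x. \<Sum>i\<in>I. g i x)"
  using assms
proof (induction I)
  case empty
  have "test_fun (\<lambda>_. 0)" by (rule test_function_onI[of _ "{}"]) (auto simp: Ck_const)
  then show ?case by (simp add: test_approx_test)
next
  case (insert i I)
  then show ?case using test_approx_add[of "g i" "\<lambda>x. \<Sum>i\<in>I. g i x"] by simp
qed

lemma test_approx_interval: "test_approx (indicator {a<..<b})"
proof -
  have w: "L2 (indicator {- (\<bar>a\<bar> + \<bar>b\<bar>)..\<bar>a\<bar> + \<bar>b\<bar>} :: real \<Rightarrow> real)" by (rule L2_indicator_bounded) auto
  have bd: "AE x in lborel. \<bar>plateau a b n x\<bar> \<le> indicator {- (\<bar>a\<bar> + \<bar>b\<bar>)..\<bar>a\<bar> + \<bar>b\<bar>} x" for n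
  proof (rule AE_I2)
    fix x show "\<bar>plateau a b n x\<bar> \<le> indicator {- (\<bar>a\<bar> + \<bar>b\<bar>)..\<bar>a\<bar> + \<bar>b\<bar>} x"
      using plateau_bounds[of a b n x] plateau_nz[of a b n x]
      by (cases "plateau a b n x = 0") (simp_all add: indicator_def, linarith)
  qed
  have lim: "AE x in lborel. (\<lambda>n. plateau a b n x) \<longlonglongrightarrow> indicator {a<..<b} x"
    by (rule AE_I2) (rule plateau_tendsto)
  have m: "plateau a b n \<in> borel_measurable borel" for n
    by (rule test_fun_measurable[OF test_fun_plateau])
  have i: "(indicator {a<..<b} :: real \<Rightarrow> real) \<in> borel_measurable borel" by simp
  note * = L2_dominated_convergence[OF m i w bd lim]
  show ?thesis
    by (rule test_approx_lim[OF test_approx_test[OF test_fun_plateau] *(2,3)])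
qed

text \<open>Induction over the intersection-stable generator of open intervals. Everything is cut to
  \<open>{-K<..<K}\<close> because a complement would otherwise have infinite measure; countable
  disjoint unions are limits of their finite partial sums by dominated convergence.\<close>

lemma test_approx_indicator:
  assumes "A \<in> sets borel"
  shows "test_approx (indicator (A \<inter> {-K<..<K}))"
proof -
  define G where "G = range (\<lambda>(a, b). {a<..<b::real})"
  have "sets borel = sigma_sets UNIV G"
    unfolding G_def by (subst borel_eq_box) (simp add: box_real image_def split_def)
  then have A: "A \<in> sigma_sets UNIV G" using assms by simp
  have "Int_stable G"
    by (auto simp: G_def Int_stable_def)
  moreover have "G \<subseteq> Pow UNIV" by simp
  ultimately show ?thesis using A
  proof (induction rule: sigma_sets_induct_disjoint)
    case (basic A)
    then obtain a b where "A = {a<..<b}" by (auto simp: G_def)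
    then show ?case by (simp add: test_approx_interval)
  next
    case empty
    then show ?case using test_approx_interval[of 0 0] by (simp add: indicator_def[abs_def])
  next
    case (compl A)
    have "test_approx (\<lambda>x. indicator {-K<..<K} x + -1 * indicator (A \<inter> {-K<..<K}) x)"
      by (intro test_approx_add test_approx_cmult test_approx_interval compl)
    also have "(\<lambda>x. indicator {-K<..<K} x + -1 * indicator (A \<inter> {-K<..<K}) x) = (indicator ((UNIV - A) \<inter> {-K<..<K}) :: real \<Rightarrow> real)"
      by (auto simp: indicator_def)
    finally show ?case .
  next
    case (union A)
    have m: "A i \<in> sets borel" for i using union(2) \<open>sets borel = sigma_sets UNIV G\<close> by blast
    have s: "(\<Sum>i<n. indicator (A i \<inter> {-K<..<K}) x) = (indicator ((\<Union>i<n. A i) \<inter> {-K<..<K}) x :: real)" for n x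
    proof -
      have d: "disjoint_family_on (\<lambda>i. A i \<inter> {-K<..<K}) {..<n}"
        using union(1) by (auto simp: disjoint_family_on_def)
      have eq: "(\<Union>i<n. A i) \<inter> {-K<..<K} = (\<Union>i<n. A i \<inter> {-K<..<K})" by blast
      show ?thesis unfolding eq by (rule indicator_UN_disjoint[OF finite_lessThan d, symmetric])
    qed
    have w: "L2 (indicator {-\<bar>K\<bar>..\<bar>K\<bar>} :: real \<Rightarrow> real)" by (rule L2_indicator_bounded) auto
    have lim: "(\<lambda>n. indicator ((\<Union>i<n. A i) \<inter> {-K<..<K}) x) \<longlonglongrightarrow> (indicator ((\<Union>i. A i) \<inter> {-K<..<K}) x :: real)" for x
    proof (cases "x \<in> (\<Union>i. A i)")
      case True
      then obtain i where "x \<in> A i" by auto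
      then show ?thesis
        by (intro tendsto_eventually) (auto simp: eventually_sequentially indicator_def intro!: exI[of _ "Suc i"])
    qed (auto simp: indicator_def)
    have bd: "AE x in lborel. \<bar>indicator ((\<Union>i<n. A i) \<inter> {-K<..<K}) x :: real\<bar> \<le> indicator {-\<bar>K\<bar>..\<bar>K\<bar>} x" for n
      by (auto simp: indicator_def)
    have "AE x in lborel. (\<lambda>n. indicator ((\<Union>i<n. A i) \<inter> {-K<..<K}) x) \<longlonglongrightarrow> (indicator ((\<Union>i. A i) \<inter> {-K<..<K}) x :: real)"
      by (rule AE_I2) (rule lim)
    note * = L2_dominated_convergence[OF _ _ w bd this]
    show ?case
    proof (rule test_approx_lim[where s = "\<lambda>n. indicator ((\<Union>i<n. A i) \<inter> {-K<..<K})"])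
      show "test_approx (indicator ((\<Union>i<n. A i) \<inter> {-K<..<K}))" for n
        using test_approx_sum[of "{..<n}" "\<lambda>i. indicator (A i \<inter> {-K<..<K})"] union(3) unfolding s by simp
    qed (rule *; use m in simp)+
  qed
qed

theorem L2_test_approx:
  assumes "L2 u"
  shows "test_approx u"
proof -
  obtain s where s: "\<And>i. simple_function borel (s i)" "\<And>x. (\<lambda>i. s i x) \<longlonglongrightarrow> u x"
    "\<And>i x. dist (s i x) 0 \<le> 2 * dist (u x) 0"
    using borel_measurable_implies_sequence_metric[OF L2_measurable[OF assms], of 0] by (auto simp: space_borel)
  \<comment> \<open>The cut-off makes every level set bounded, as
    \<open>test_approx_indicator\<close> demands; the approximants remain dominated by
    \<open>2 * \<bar>u x\<bar>\<close>.\<close>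
  define r where "r i x = s i x * indicator {-real i<..<real i} x" for i x
  have sm: "s i \<in> borel_measurable borel" for i using s(1) by (rule borel_measurable_simple_function)
  have lim: "(\<lambda>i. r i x) \<longlonglongrightarrow> u x" for x
  proof -
    obtain n :: nat where n: "\<bar>x\<bar> < real n" using reals_Archimedean2 by blast
    have "\<forall>\<^sub>F i in sequentially. s i x = r i x"
      unfolding eventually_sequentially r_def using n by (intro exI[of _ n]) (auto simp: indicator_def)
    with s(2) show ?thesis by (rule Lim_transform_eventually)
  qed
  have bd: "AE x in lborel. \<bar>r i x\<bar> \<le> 2 * \<bar>u x\<bar>" for i
    using s(3)[of i] by (auto simp: r_def indicator_def)
  have w: "L2 (\<lambda>x. 2 * \<bar>u x\<bar>)" using assms by (auto simp: L2_def power_mult_distrib)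
  have rm: "r i \<in> borel_measurable borel" for i unfolding r_def using sm[of i] by simp
  have *: "(\<lambda>i. ip (\<lambda>x. r i x - u x) (\<lambda>x. r i x - u x)) \<longlonglongrightarrow> 0"
    by (rule L2_dominated_convergence(3)[OF rm L2_measurable[OF assms] w bd]) (simp add: lim)
  show ?thesis
  proof (rule test_approx_lim)
    fix i
    have fin: "finite (range (s i))" using s(1)[of i] by (simp add: simple_function_def space_borel)
    have "r i = (\<lambda>x. \<Sum>y\<in>range (s i). y * indicator ((s i -` {y}) \<inter> {-real i<..<real i}) x)"
    proof
      fix x
      have "(\<Sum>y\<in>range (s i). y * indicator ((s i -` {y}) \<inter> {-real i<..<real i}) x)
          = (\<Sum>y\<in>range (s i). if y = s i x then r i x else 0)"
        by (intro sum.cong) (auto simp: r_def indicator_def)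
      also have "\<dots> = r i x" using fin by (simp add: sum.delta)
      finally show "r i x = (\<Sum>y\<in>range (s i). y * indicator ((s i -` {y}) \<inter> {-real i<..<real i}) x)" by simp
    qed
    moreover have "test_approx (\<lambda>x. \<Sum>y\<in>range (s i). y * indicator ((s i -` {y}) \<inter> {-real i<..<real i}) x)"
    proof (intro test_approx_sum fin test_approx_cmult test_approx_indicator)
      fix y show "s i -` {y} \<in> sets borel"
        using measurable_sets[OF sm, of "{y}" i] by (simp add: space_borel)
    qed
    ultimately show "test_approx (r i)" by simp
  qed (use * lim assms in auto)
qed

lemma L2_test_approx_obtain:
  assumes "L2 u" "e > 0"
  obtains \<phi> where "test_fun \<phi>" "ip (\<lambda>x. u x - \<phi> x) (\<lambda>x. u x - \<phi> x) < e"
proof -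
  have "\<exists>\<phi>. test_fun \<phi> \<and> ip (\<lambda>x. u x - \<phi> x) (\<lambda>x. u x - \<phi> x) < e"
    by (rule L2_test_approx[OF assms(1), unfolded test_approx_def, THEN conjunct2, rule_format, OF assms(2)])
  then obtain \<phi> where "test_fun \<phi> \<and> ip (\<lambda>x. u x - \<phi> x) (\<lambda>x. u x - \<phi> x) < e" ..
  then show ?thesis by (intro that[of \<phi>]) simp_all
qed

lemma L2_approx_sequence:
  assumes "L2 u"
  obtains \<phi> where "\<And>n. test_fun (\<phi> n)" "(\<lambda>n. ip (\<lambda>x. \<phi> n x - u x) (\<lambda>x. \<phi> n x - u x)) \<longlonglongrightarrow> 0"
proof -
  have "\<exists>\<phi>. test_fun \<phi> \<and> ip (\<lambda>x. u x - \<phi> x) (\<lambda>x. u x - \<phi> x) < 1 / real (Suc n)" for n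
    by (rule L2_test_approx[OF assms, unfolded test_approx_def, THEN conjunct2, rule_format]) simp
  then have "\<exists>\<phi>. \<forall>n. test_fun (\<phi> n) \<and> ip (\<lambda>x. u x - \<phi> n x) (\<lambda>x. u x - \<phi> n x) < 1 / real (Suc n)"
    by (intro choice allI)
  then obtain \<phi> where *: "\<forall>n. test_fun (\<phi> n) \<and> ip (\<lambda>x. u x - \<phi> n x) (\<lambda>x. u x - \<phi> n x) < 1 / real (Suc n)" ..
  then have \<phi>: "\<And>n. test_fun (\<phi> n)"
    "\<And>n. ip (\<lambda>x. u x - \<phi> n x) (\<lambda>x. u x - \<phi> n x) < 1 / real (Suc n)"
    by simp_all
  have "(\<lambda>n. ip (\<lambda>x. \<phi> n x - u x) (\<lambda>x. \<phi> n x - u x)) \<longlonglongrightarrow> 0"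
  proof (rule real_tendsto_sandwich[of "\<lambda>_. 0" _ _ "\<lambda>n. 1 / real (Suc n)"])
    show "\<forall>\<^sub>F n in sequentially. ip (\<lambda>x. \<phi> n x - u x) (\<lambda>x. \<phi> n x - u x) \<le> 1 / real (Suc n)"
    proof (intro always_eventually allI)
      fix n show "ip (\<lambda>x. \<phi> n x - u x) (\<lambda>x. \<phi> n x - u x) \<le> 1 / real (Suc n)"
        using \<phi>(2)[of n] by (simp add: ip_self_eq power2_commute[of "\<phi> n _"])
    qed
    show "(\<lambda>n. 1 / real (Suc n)) \<longlonglongrightarrow> 0" by real_asymp
    show "\<forall>\<^sub>F n in sequentially. 0 \<le> ip (\<lambda>x. \<phi> n x - u x) (\<lambda>x. \<phi> n x - u x)"
      by (simp add: ip_nonneg)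
  qed simp
  with \<phi>(1) show ?thesis by (rule that)
qed

text \<open>Test functions converging to \<open>u\<close> itself turn the hypothesis into
  \<open>ip u u = 0\<close>.\<close>

lemma L2_zero_if_test_zero:
  assumes "L2 u" "\<And>\<phi>. test_fun \<phi> \<Longrightarrow> ip u \<phi> = 0"
  shows "AE x in lborel. u x = 0"
proof -
  obtain \<phi> where \<phi>: "\<And>n. test_fun (\<phi> n)" "(\<lambda>n. ip (\<lambda>x. \<phi> n x - u x) (\<lambda>x. \<phi> n x - u x)) \<longlonglongrightarrow> 0"
    by (rule L2_approx_sequence[OF assms(1)]) (rule that)
  have "(\<lambda>n. ip u (\<phi> n)) \<longlonglongrightarrow> ip u u"
    by (rule ip_tendsto[OF _ _ assms(1) assms(1) _ \<phi>(2)]) (simp_all add: assms(1) test_fun_L2[OF \<phi>(1)] ip_def)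
  then have "ip u u = 0" using assms(2) \<phi>(1) by (simp add: LIMSEQ_const_iff)
  then show ?thesis by (rule ip_self_eq_0D[OF assms(1)])
qed

text \<open>Translation is an isometry of \<open>L2\<close>, so by density it suffices to treat a
  test function, for which dominated convergence applies once the shifts stay bounded.\<close>

lemma L2_shift_continuous:
  assumes "L2 u"
  shows "((\<lambda>h. ip (\<lambda>x. u (x + h) - u x) (\<lambda>x. u (x + h) - u x)) \<longlongrightarrow> 0) (at 0)"
proof (rule tendstoI)
  fix e :: real assume e: "e > 0"
  then have "e/16 > 0" by simp
  \<comment> \<open>The squared error of \<open>\<phi>\<close> enters with total factor 2 * (2 + 2)
    = 8, giving at most e/2; the shifted test function adds 2 * e/8.\<close>
  then obtain \<phi> where \<phi>: "test_fun \<phi>" "ip (\<lambda>x. u x - \<phi> x) (\<lambda>x. u x - \<phi> x) < e/16"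
    by (rule L2_test_approx_obtain[OF assms]) (rule that)
  obtain K M where KM: "K > 0" "M > 0" "\<And>x. \<bar>\<phi> x\<bar> \<le> M * indicator {-K..K} x"
    by (rule test_fun_bounded[OF \<phi>(1)]) (rule that)
  have test: "((\<lambda>h. ip (\<lambda>x. \<phi> (x + h) - \<phi> x) (\<lambda>x. \<phi> (x + h) - \<phi> x)) \<longlongrightarrow> 0) (at 0)"
    unfolding tendsto_at_iff_sequentially comp_def
  proof (intro allI impI)
    fix h :: "nat \<Rightarrow> real" assume "\<forall>i. h i \<in> UNIV - {0}" and h: "h \<longlonglongrightarrow> 0"
    then obtain B where B: "B > 0" "\<And>n. \<bar>h n\<bar> \<le> B" using convergent_imp_Bseq[OF convergentI[OF h]]
      by (auto elim!: BseqE)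
    have w: "L2 (\<lambda>x. M * indicator {-(K+B)..K+B} x)"
      by (intro L2_cmult L2_indicator_bounded) auto
    have bd: "AE x in lborel. \<bar>\<phi> (x + h n)\<bar> \<le> M * indicator {-(K+B)..K+B} x" for n
    proof (rule AE_I2)
      fix x show "\<bar>\<phi> (x + h n)\<bar> \<le> M * indicator {-(K+B)..K+B} x"
        using KM(2) KM(3)[of "x + h n"] B(2)[of n]
          by (cases "x + h n \<in> {-K..K}") (auto simp: indicator_def)
    qed
    have lim: "AE x in lborel. (\<lambda>n. \<phi> (x + h n)) \<longlonglongrightarrow> \<phi> x"
    proof (rule AE_I2)
      fix x
      have c: "isCont \<phi> x" using Ck_imp_continuous[OF test_function_onD(1)[OF \<phi>(1)]] by (simp add: continuous_on_eq_continuous_at)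
      have "(\<lambda>n. x + h n) \<longlonglongrightarrow> x + 0" by (intro tendsto_intros h)
      then show "(\<lambda>n. \<phi> (x + h n)) \<longlonglongrightarrow> \<phi> x" using isCont_tendsto_compose[OF c] by simp
    qed
    show "(\<lambda>n. ip (\<lambda>x. \<phi> (x + h n) - \<phi> x) (\<lambda>x. \<phi> (x + h n) - \<phi> x)) \<longlonglongrightarrow> 0"
      by (rule L2_dominated_convergence(3)[OF _ _ w bd lim])
         (use test_fun_measurable[OF \<phi>(1)] in measurable)
  qed
  then have "\<forall>\<^sub>F h in at 0. ip (\<lambda>x. \<phi> (x + h) - \<phi> x) (\<lambda>x. \<phi> (x + h) - \<phi> x) < e/8"
    using e by (intro order_tendstoD(2)) auto
  then show "\<forall>\<^sub>F h in at 0. dist (ip (\<lambda>x. u (x + h) - u x) (\<lambda>x. u (x + h) - u x)) 0 < e"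
  proof eventually_elim
    case (elim h)
    let ?d = "\<lambda>x. u x - \<phi> x"
    have L: "L2 ?d" "L2 (\<lambda>x. ?d (x+h))" "L2 (\<lambda>x. \<phi> (x+h) - \<phi> x)"
      using \<phi>(1) assms L2_shift[of ?d h] L2_shift[of \<phi> h] by (auto simp: L2_diff test_fun_L2)
    have eq: "(\<lambda>x. u (x+h) - u x) = (\<lambda>x. (?d (x+h) - ?d x) + (\<phi> (x+h) - \<phi> x))" by auto
    have "ip (\<lambda>x. u (x+h) - u x) (\<lambda>x. u (x+h) - u x) \<le>
       2 * ip (\<lambda>x. ?d (x+h) - ?d x) (\<lambda>x. ?d (x+h) - ?d x) + 2 * ip (\<lambda>x. \<phi> (x+h) - \<phi> x) (\<lambda>x. \<phi> (x+h) - \<phi> x)"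
      unfolding eq by (intro ip_add_le L2_diff L)
    moreover have "ip (\<lambda>x. ?d (x+h) - ?d x) (\<lambda>x. ?d (x+h) - ?d x) \<le> 2 * ip (\<lambda>x. ?d (x+h)) (\<lambda>x. ?d (x+h)) + 2 * ip ?d ?d"
      by (rule ip_diff_le[OF L(2) L(1)])
    moreover have "ip (\<lambda>x. ?d (x+h)) (\<lambda>x. ?d (x+h)) = ip ?d ?d" by (rule ip_shift[of ?d h ?d])
    ultimately have "ip (\<lambda>x. u (x+h) - u x) (\<lambda>x. u (x+h) - u x) < e"
      using elim \<phi>(2) e by linarith
    then show ?case using ip_nonneg[of "\<lambda>x. u (x+h) - u x"] by simp
  qed
qed


section \<open>Weak derivatives\<close>

text \<open>These are the inner integrals left by Fubini when a primitive is paired with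
  \<open>deriv \<phi>\<close>: the first serves points \<open>y > 0\<close>, the second points
  \<open>y < 0\<close>.\<close>

lemma test_integral_tail:
  assumes "test_fun \<phi>"
  shows "(\<integral>x. deriv \<phi> x * indicator {y..} x \<partial>lborel) = - \<phi> y"
    and "(\<integral>x. deriv \<phi> x * indicator {..y} x \<partial>lborel) = \<phi> y"
proof -
  obtain K where K: "K > 0" "\<And>x. \<phi> x \<noteq> 0 \<Longrightarrow> \<bar>x\<bar> < K" using test_fun_obtain[OF assms] by blast
  obtain L where L: "L > 0" "\<And>x. deriv \<phi> x \<noteq> 0 \<Longrightarrow> \<bar>x\<bar> < L" using test_fun_obtain[OF test_function_on_deriv[OF assms]] by blast
  have c: "isCont (deriv \<phi>) x" for x
    using Ck_imp_continuous[OF test_function_onD(1)[OF test_function_on_deriv[OF assms]]]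
    by (simp add: continuous_on_eq_continuous_at)
  define B where "B = \<bar>y\<bar> + K + L"
  have 1: "(\<integral>x. deriv \<phi> x * indicator {y..B} x \<partial>lborel) = \<phi> B - \<phi> y"
    by (rule integral_FTC_Icc_real) (use test_function_has_deriv[OF assms] c K L in \<open>auto simp: B_def\<close>)
  have 2: "(\<integral>x. deriv \<phi> x * indicator {-B..y} x \<partial>lborel) = \<phi> y - \<phi> (-B)"
    by (rule integral_FTC_Icc_real) (use test_function_has_deriv[OF assms] c K L in \<open>auto simp: B_def\<close>)
  have "K < B" using L(1) K(1) by (simp add: B_def)
  then have "\<not> \<bar>B\<bar> < K" "\<not> \<bar>- B\<bar> < K" by linarith+
  then have z: "\<phi> B = 0" "\<phi> (-B) = 0" using K(2)[of B] K(2)[of "-B"] by blast+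
  have dz: "deriv \<phi> x = 0" if "\<bar>x\<bar> > B" for x 
    using L(2)[of x] that K(1) unfolding B_def by linarith
  have e1: "deriv \<phi> x * indicator {y..} x = deriv \<phi> x * indicator {y..B} x" for x
    using dz[of x] by (cases "x \<le> B") (auto simp: indicator_def)
  have e2: "deriv \<phi> x * indicator {..y} x = deriv \<phi> x * indicator {-B..y} x" for x
    using dz[of x] by (cases "-B \<le> x") (auto simp: indicator_def)
  show "(\<integral>x. deriv \<phi> x * indicator {y..} x \<partial>lborel) = - \<phi> y" unfolding e1 1 z by simp
  show "(\<integral>x. deriv \<phi> x * indicator {..y} x \<partial>lborel) = \<phi> y" unfolding e2 2 z by simp
qed

text \<open>The antiderivative that vanishes to the left of the support is constant to the right of
  it, and that constant is the integral of \<open>\<zeta>\<close>. Mean zero is therefore exactly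
  what keeps the support compact.\<close>

lemma test_antiderivative:
  assumes "test_function_on {a<..<b} \<zeta>" "a < b" "(\<integral>x. \<zeta> x \<partial>lborel) = 0"
  obtains \<phi> where "test_function_on {a<..<b} \<phi>" "deriv \<phi> = \<zeta>"
proof -
  obtain a' b' where ab: "a < a'" "a' < b'" "b' < b" "\<And>x. \<zeta> x \<noteq> 0 \<Longrightarrow> a' < x \<and> x < b'"
    using test_function_on_obtain[OF assms(1,2)] by blast
  have c: "isCont \<zeta> x" for x
    using Ck_imp_continuous[OF test_function_onD(1)[OF assms(1)]] by (simp add: continuous_on_eq_continuous_at)
  obtain F where F: "\<And>x. (F has_vector_derivative \<zeta> x) (at x)"
    using einterval_antiderivative[of "-\<infinity>" \<infinity> \<zeta>] c by auto
  define \<phi> where "\<phi> x = F x - F a'" for x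
  have d: "(\<phi> has_real_derivative \<zeta> x) (at x)" for x
    using F[of x] unfolding \<phi>_def has_real_derivative_iff_has_vector_derivative
    by (auto intro!: derivative_eq_intros)
  have left: "\<phi> x = 0" if "x \<le> a'" for x
  proof (cases "x = a'")
    case False
    with that have "x < a'" by simp
    then obtain z where "x < z" "z < a'" "\<phi> a' - \<phi> x = (a' - x) * \<zeta> z"
      using MVT2[OF _ d, of x a'] by blast
    moreover have "\<phi> a' = 0" by (simp add: \<phi>_def)
    ultimately show ?thesis using ab(4)[of z] by (cases "\<zeta> z = 0") auto
  qed (simp add: \<phi>_def)
  have "(\<integral>x. \<zeta> x * indicator {a'..b'} x \<partial>lborel) = \<phi> b' - \<phi> a'"
    by (rule integral_FTC_Icc_real) (use d c ab in auto)
  moreover have "\<zeta> x * indicator {a'..b'} x = \<zeta> x" for x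
    using ab(4)[of x] by (cases "\<zeta> x = 0") auto
  ultimately have b0: "\<phi> b' = 0" using assms(3) left[of a'] by simp
  have right: "\<phi> x = 0" if "b' \<le> x" for x
  proof (cases "x = b'")
    case False
    with that have "b' < x" by simp
    then obtain z where "b' < z" "z < x" "\<phi> x - \<phi> b' = (x - b') * \<zeta> z"
      using MVT2[OF _ d, of b' x] by blast
    then show ?thesis using ab(4)[of z] b0 by (cases "\<zeta> z = 0") auto
  qed (simp add: b0)
  have "Ck k \<phi>" for k
    by (rule Ck_SucD, rule Ck_SucI_real[OF d]) (rule test_function_onD(1)[OF assms(1)])
  then have "test_function_on {a<..<b} \<phi>"
  proof (rule test_function_onI[of _ "{a'..b'}"])
    fix x assume "\<phi> x \<noteq> 0"
    then show "x \<in> {a'..b'}" using left[of x] right[of x] by (cases "x \<le> a'"; cases "b' \<le> x") auto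
  qed (use ab in auto)
  moreover have "deriv \<phi> = \<zeta>" using d DERIV_imp_deriv by blast
  ultimately show ?thesis by (rule that)
qed

text \<open>Multiplying an arbitrary test function by a plateau makes it admissible in the
  hypothesis; letting the plateau grow to the indicator reduces the claim to the whole line.\<close>

lemma L2_zero_on_subinterval:
  assumes "L2 W" "\<And>\<eta>. test_function_on {a<..<b} \<eta> \<Longrightarrow> ip W \<eta> = 0" "a < a1" "b1 < b"
  shows "AE x in lborel. indicator {a1<..<b1} x * W x = 0"
proof (rule L2_zero_if_test_zero)
  let ?z = "\<lambda>x. indicator {a1<..<b1} x * W x"
  let ?s = "\<lambda>n x. plateau a1 b1 n x * W x"
  have w: "L2 (\<lambda>x. \<bar>W x\<bar>)" using assms(1) by (auto simp: L2_def)
  have m: "?s n \<in> borel_measurable borel" "?z \<in> borel_measurable borel" for n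
    using assms(1) test_fun_measurable[OF test_fun_plateau, of a1 b1 n] by (auto simp: L2_def)
  have bd: "AE x in lborel. \<bar>?s n x\<bar> \<le> \<bar>W x\<bar>" for n
    using plateau_bounds[of a1 b1 n] by (intro AE_I2) (simp add: abs_mult mult_left_le_one_le)
  have lim: "AE x in lborel. (\<lambda>n. ?s n x) \<longlonglongrightarrow> ?z x"
    by (intro AE_I2 tendsto_intros plateau_tendsto)
  note * = L2_dominated_convergence[OF m w bd lim]
  show "L2 ?z" by (rule *(2))
  fix \<phi> assume \<phi>: "test_fun \<phi>"
  have "(\<lambda>n. ip (?s n) \<phi>) \<longlonglongrightarrow> ip ?z \<phi>"
    by (rule ip_tendsto[OF _ _ *(2) test_fun_L2[OF \<phi>] *(3)]) (simp_all add: *(1) test_fun_L2[OF \<phi>] ip_def)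
  moreover have "ip (?s n) \<phi> = 0" for n
  proof -
    have "ip W (\<lambda>x. plateau a1 b1 n x * \<phi> x) = 0"
      using assms(2)[OF test_function_on_mult[OF test_plateau[OF assms(3,4)] test_function_onD(1)[OF \<phi>]]] .
    then show ?thesis by (simp add: ip_def mult_ac)
  qed
  ultimately show "ip ?z \<phi> = 0" by (simp add: LIMSEQ_const_iff)
qed

lemma L2_zero_on_interval:
  assumes "L2 W" "\<And>\<eta>. test_function_on {a<..<b} \<eta> \<Longrightarrow> ip W \<eta> = 0"
  shows "AE x in lborel. a < x \<and> x < b \<longrightarrow> W x = 0"
proof -
  have "AE x in lborel. \<forall>n. indicator {a + 1 / real (Suc n)<..<b - 1 / real (Suc n)} x * W x = 0"
    unfolding AE_all_countable by (intro allI L2_zero_on_subinterval[OF assms]) auto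
  then show ?thesis
  proof eventually_elim
    case (elim x)
    show ?case
    proof
      assume x: "a < x \<and> x < b"
      then obtain n where "1 / real (Suc n) < min (x - a) (b - x)"
        using reals_Archimedean[of "min (x - a) (b - x)"] by (auto simp: inverse_eq_divide)
      with elim[rule_format, of n] x show "W x = 0" by (auto simp: indicator_def)
    qed
  qed
qed

text \<open>The lemma of du Bois-Reymond. A test function is a derivative once its mean is removed,
  so \<open>w\<close> is orthogonal to all test functions up to a multiple of one fixed
  \<open>\<rho>\<close> of mean one.\<close>

lemma weak_deriv_zero_const:
  assumes "a < b" "L2 w" "\<And>\<phi>. test_function_on {a<..<b} \<phi> \<Longrightarrow> ip w (deriv \<phi>) = 0"
  shows "\<exists>c. AE x in lborel. a < x \<and> x < b \<longrightarrow> w x = c"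
proof -
  define a1 b1 where "a1 = (2*a+b)/3" and "b1 = (a+2*b)/3"
  have ab: "a < a1" "a1 < b1" "b1 < b" using assms(1) by (auto simp: a1_def b1_def)
  let ?p = "plateau a1 b1 1"
  have tint: "integrable lborel \<eta>" if t: "test_function_on {a<..<b} \<eta>" for \<eta>
  proof -
    have "integrable lborel (\<lambda>x. indicator {a..b} x * \<eta> x)"
      by (rule L2_integrable_mult[OF L2_indicator_bounded[where K="\<bar>a\<bar>+\<bar>b\<bar>"] test_fun_L2[OF test_function_on_mono[OF t]]]) auto
    moreover have "indicator {a..b} x * \<eta> x = \<eta> x" for x
      using test_function_onD(3)[OF t] closure_subset[of "{x. \<eta> x \<noteq> 0}"] by (auto simp: indicator_def)
    ultimately show ?thesis by simp
  qed
  have pt: "test_function_on {a<..<b} ?p" by (rule test_plateau[OF ab(1,3)])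
  define I where "I = (\<integral>x. ?p x \<partial>lborel)"
  have "I \<noteq> 0"
  proof
    assume "I = 0"
    then have "AE x in lborel. ?p x = 0"
      using integral_nonneg_eq_0_iff_AE[OF tint[OF pt]] plateau_bounds(1) by (simp add: I_def)
    then have "AE x in lborel. \<not> (a1 < x \<and> x < b1)"
      by eventually_elim (auto simp: plateau_def bump_def split: if_splits)
    from emeasure_eq_0_AE[OF this] have "emeasure lborel {a1<..<b1} = 0"
      by (simp add: greaterThanLessThan_def greaterThan_def lessThan_def Collect_conj_eq[symmetric])
    then show False using ab by simp
  qed
  define \<rho> where "\<rho> x = 1 / I * ?p x" for x
  have \<rho>: "test_function_on {a<..<b} \<rho>" unfolding \<rho>_def by (rule test_function_on_cmult[OF pt])
  have \<rho>1: "(\<integral>x. \<rho> x \<partial>lborel) = 1" using \<open>I \<noteq> 0\<close> by (simp add: \<rho>_def I_def)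
  \<comment> \<open>Pairing with a function of mean one reads off the only possible
    constant.\<close>
  define c where "c = ip w \<rho>"
  define W where "W x = indicator {a<..<b} x * (w x - c)" for x
  have ind: "L2 (indicator {a<..<b} :: real \<Rightarrow> real)" by (rule L2_indicator_bounded[where K="\<bar>a\<bar>+\<bar>b\<bar>"]) auto
  have W: "L2 W"
  proof -
    have "L2 (\<lambda>x. indicator {a<..<b} x * w x - c * indicator {a<..<b} x)"
      by (intro L2_diff L2_cmult ind L2_bounded_mult[where M=1] assms) (auto simp: indicator_def)
    then show ?thesis unfolding W_def by (simp add: algebra_simps)
  qed
  have "ip W \<eta> = 0" if \<eta>: "test_function_on {a<..<b} \<eta>" for \<eta>
  proof -
    define J where "J = (\<integral>x. \<eta> x \<partial>lborel)"
    \<comment> \<open>Subtracting \<open>J\<close> copies of \<open>\<rho>\<close> removes the mean,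
      so the result has a compactly supported antiderivative.\<close>
    have t: "test_function_on {a<..<b} (\<lambda>x. \<eta> x + (- J) * \<rho> x)"
      by (intro test_function_on_add test_function_on_cmult \<eta> \<rho>)
    have "(\<integral>x. \<eta> x + (- J) * \<rho> x \<partial>lborel) = 0"
      using tint[OF \<eta>] tint[OF \<rho>] \<rho>1 by (simp add: J_def)
    then obtain \<phi> where "test_function_on {a<..<b} \<phi>" "deriv \<phi> = (\<lambda>x. \<eta> x + (- J) * \<rho> x)"
      using test_antiderivative[OF t assms(1)] by metis
    then have 0: "ip w (\<lambda>x. \<eta> x + (- J) * \<rho> x) = 0" using assms(3) by metis
    have L: "L2 \<eta>" "L2 (\<lambda>x. (-J) * \<rho> x)" "L2 \<rho>"
      using \<eta> \<rho> by (auto intro!: test_fun_L2 test_function_on_mono[of "{a<..<b}"] L2_cmult[of \<rho> "-J", simplified])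
    have "ip w \<eta> - J * c = 0"
      using 0 ip_add_right[OF L(1,2) assms(2)] ip_cmult_left[of "-J" \<rho> w] by (simp add: c_def ip_commute)
    moreover have "ip W \<eta> = ip w \<eta> - c * J"
    proof -
      have "W x * \<eta> x = w x * \<eta> x - c * \<eta> x" for x
        using test_function_onD(3)[OF \<eta>] closure_subset[of "{x. \<eta> x \<noteq> 0}"]
        by (auto simp: W_def indicator_def algebra_simps)
      then show ?thesis using L2_integrable_mult[OF assms(2) L(1)] tint[OF \<eta>] by (simp add: ip_def J_def)
    qed
    ultimately show ?thesis by (simp add: mult.commute)
  qed
  from L2_zero_on_interval[OF W this] have "AE x in lborel. a < x \<and> x < b \<longrightarrow> W x = 0" .
  then have "AE x in lborel. a < x \<and> x < b \<longrightarrow> w x = c"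
    by eventually_elim (auto simp: W_def)
  then show ?thesis ..
qed

text \<open>
  The difference of indicators is the oriented interval from \<open>0\<close> to \<open>x\<close>.
\<close>

definition prim :: "(real \<Rightarrow> real) \<Rightarrow> real \<Rightarrow> real" where
  "prim v x = ip (\<lambda>y. indicator {0..x} y - indicator {x..0} y) v"

lemma L2_indicator_Icc: "L2 (indicator {x..y::real})"
  by (rule L2_indicator_bounded[where K="\<bar>x\<bar>+\<bar>y\<bar>"]) auto

lemma prim_0[simp]: "prim v 0 = 0"
  by (simp add: prim_def ip_def)

lemma prim_diff:
  assumes "L2 v" "x \<le> y"
  shows "prim v y - prim v x = ip (indicator {x..y}) v"
proof -
  have "prim v y - prim v x = ip (\<lambda>z. (indicator {0..y} z - indicator {y..0} z) - (indicator {0..x} z - indicator {x..0} z)) v"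
    unfolding prim_def by (subst ip_diff_left) (intro L2_diff L2_indicator_Icc assms refl)+
  also have "\<dots> = ip (indicator {x..y}) v"
    unfolding ip_def
  proof (rule integral_cong_AE)
    \<comment> \<open>Closed intervals are not additive at their common endpoints; these three
      points are the only possible discrepancies.\<close>
    have "AE z in lborel. z \<noteq> 0 \<and> z \<noteq> x \<and> z \<noteq> y"
      using AE_lborel_singleton[of "0::real"] AE_lborel_singleton[of x] AE_lborel_singleton[of y] by eventually_elim auto
    then show "AE z in lborel. (indicator {0..y} z - indicator {y..0} z - (indicator {0..x} z - indicator {x..0} z)) * v z = indicator {x..y} z * v z"
      by eventually_elim (use assms(2) in \<open>auto simp: indicator_def\<close>)
  qed (use L2_measurable[OF assms(1)] in measurable)
  finally show ?thesis .
qed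

lemma ip_indicator_Icc_self: "x \<le> y \<Longrightarrow> ip (indicator {x..y}) (indicator {x..y}) = y - x"
proof -
  assume "x \<le> y"
  have eq: "indicator {x..y} z * indicator {x..y} z = (indicator {x..y} z :: real)" for z
    by (cases "z \<in> {x..y}") simp_all
  show ?thesis unfolding ip_def eq using \<open>x \<le> y\<close> by simp
qed

text \<open>Cauchy-Schwarz against the indicator of the interval, whose norm is the square root of
  the length. It yields continuity of primitives and bounds that are uniform over bounded sets of
  \<open>L2\<close>.\<close>

lemma prim_Hoelder:
  assumes "L2 v"
  shows "\<bar>prim v y - prim v x\<bar> \<le> sqrt \<bar>y - x\<bar> * sqrt (ip v v)"
proof (cases "x \<le> y")
  case True
  then show ?thesis using ip_Cauchy_Schwarz[OF L2_indicator_Icc assms, of x y]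
    by (simp add: prim_diff[OF assms] ip_indicator_Icc_self)
next
  case False
  then show ?thesis using ip_Cauchy_Schwarz[OF L2_indicator_Icc assms, of y x] prim_diff[OF assms, of y x]
    by (simp add: ip_indicator_Icc_self)
qed

lemma prim_continuous:
  assumes "L2 v"
  shows "continuous_on UNIV (prim v)"
  unfolding continuous_on_eq_continuous_at[OF open_UNIV] isCont_def
proof
  fix x
  have "((\<lambda>y. sqrt \<bar>y - x\<bar> * sqrt (ip v v)) \<longlongrightarrow> sqrt \<bar>x - x\<bar> * sqrt (ip v v)) (at x)" by (intro tendsto_intros)
  then have "((\<lambda>y. prim v y - prim v x) \<longlongrightarrow> 0) (at x)"
    by (rule Lim_null_comparison[rotated, OF tendsto_eq_rhs]) (simp_all add: prim_Hoelder[OF assms])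
  then show "(prim v \<longlongrightarrow> prim v x) (at x)" by (simp add: Lim_null[symmetric])
qed

text \<open>Fubini for the kernel of the primitive: for fixed \<open>y\<close> the points
  \<open>x\<close> lying beyond \<open>y\<close>, seen from the origin, form a half-line, and
  \<open>deriv \<phi>\<close> integrates over it to a single value of \<open>\<phi>\<close>.\<close>

lemma prim_weak_deriv:
  assumes v: "L2 v" and \<phi>: "test_fun \<phi>"
  shows "(\<integral>x. prim v x * deriv \<phi> x \<partial>lborel) = - ip v \<phi>"
proof -
  define k where "k x y = (if 0 \<le> y \<and> y \<le> x then 1 else 0) - (if x \<le> y \<and> y \<le> 0 then 1 else (0::real))" for x y :: real
  have k: "k x y = indicator {0..x} y - indicator {x..0} y" for x y by (auto simp: k_def indicator_def)
  have d\<phi>: "test_fun (deriv \<phi>)" by (rule test_function_on_deriv[OF \<phi>])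
  obtain K M where KM: "K > 0" "M > 0" "\<And>x. \<bar>deriv \<phi> x\<bar> \<le> M * indicator {-K..K} x"
    by (rule test_fun_bounded[OF d\<phi>]) (rule that)
  have [measurable]: "v \<in> borel_measurable borel" "deriv \<phi> \<in> borel_measurable borel"
    using v test_fun_measurable[OF d\<phi>] by (auto simp: L2_def)
  have vi: "integrable lborel (\<lambda>y. indicator {-K..K} y * \<bar>v y\<bar>)"
    using v by (intro L2_integrable_mult L2_indicator_Icc) (simp add: L2_def)
  define f where "f x y = deriv \<phi> x * (k x y * v y)" for x y
  \<comment> \<open>The kernel is nonzero only for \<open>y\<close> between \<open>0\<close> and
    \<open>x\<close>, so the support of \<open>deriv \<phi>\<close> in \<open>x\<close> also
    confines \<open>y\<close> to \<open>{-K..K}\<close>, which makes the double integral absolutely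
    convergent.\<close>
  have f_bd: "\<bar>f x y\<bar> \<le> (M * indicator {-K..K} x) * (indicator {-K..K} y * \<bar>v y\<bar>)" for x y
  proof (cases "x \<in> {-K..K}")
    case True
    then have "\<bar>k x y * v y\<bar> \<le> indicator {-K..K} y * \<bar>v y\<bar>" by (auto simp: k_def indicator_def)
    then show ?thesis unfolding f_def abs_mult[of "deriv \<phi> x"] by (intro mult_mono KM) (use KM in auto)
  next
    case False
    then show ?thesis using KM(3)[of x] by (simp add: f_def)
  qed
  have f_m[measurable]: "(\<lambda>(x, y). f x y) \<in> borel_measurable (lborel \<Otimes>\<^sub>M lborel)"
    unfolding f_def k_def by measurable
  have fi: "integrable lborel (\<lambda>y. f x y)" for x
  proof (rule Bochner_Integration.integrable_bound[OF integrable_mult_right[OF vi]])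
    show "AE y in lborel. norm (f x y) \<le> norm ((M * indicator {-K..K} x) * (indicator {-K..K} y * \<bar>v y\<bar>))"
    proof (rule AE_I2)
      fix y show "norm (f x y) \<le> norm ((M * indicator {-K..K} x) * (indicator {-K..K} y * \<bar>v y\<bar>))"
        using f_bd[of x y] unfolding real_norm_def by linarith
    qed
  qed (use measurable_compose[OF measurable_Pair1' f_m, of x] in auto)
  have int: "integrable (lborel \<Otimes>\<^sub>M lborel) (\<lambda>(x, y). f x y)"
  proof (rule lborel_pair.Fubini_integrable[OF f_m])
    show "AE x in lborel. integrable lborel (\<lambda>y. case (x, y) of (x, y) \<Rightarrow> f x y)" using fi by simp
    have "integrable lborel (\<lambda>x. (\<integral>y. indicator {-K..K} y * \<bar>v y\<bar> \<partial>lborel) * (M * indicator {-K..K} x))"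
      by (rule integrable_mult_right, rule integrable_mult_right, rule integrable_real_indicator)
        (simp_all add: emeasure_lborel_Icc_eq)
    then show "integrable lborel (\<lambda>x. \<integral>y. norm (case (x, y) of (x, y) \<Rightarrow> f x y) \<partial>lborel)"
    proof (rule Bochner_Integration.integrable_bound)
      show "AE x in lborel. norm (\<integral>y. norm (case (x, y) of (x, y) \<Rightarrow> f x y) \<partial>lborel)
         \<le> norm ((\<integral>y. indicator {-K..K} y * \<bar>v y\<bar> \<partial>lborel) * (M * indicator {-K..K} x))"
      proof (rule AE_I2)
        fix x
        have "(\<integral>y. \<bar>f x y\<bar> \<partial>lborel) \<le> (\<integral>y. (M * indicator {-K..K} x) * (indicator {-K..K} y * \<bar>v y\<bar>) \<partial>lborel)"
          by (rule integral_mono) (use fi[of x] vi f_bd in auto)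
        then have le: "(\<integral>y. \<bar>f x y\<bar> \<partial>lborel) \<le> (M * indicator {-K..K} x) * (\<integral>y. indicator {-K..K} y * \<bar>v y\<bar> \<partial>lborel)" by simp
        have "0 \<le> (\<integral>y. \<bar>f x y\<bar> \<partial>lborel)" by simp
        with le show "norm (\<integral>y. norm (case (x, y) of (x, y) \<Rightarrow> f x y) \<partial>lborel)
         \<le> norm ((\<integral>y. indicator {-K..K} y * \<bar>v y\<bar> \<partial>lborel) * (M * indicator {-K..K} x))"
          unfolding prod.case real_norm_def by (simp add: mult.commute)
      qed
    qed measurable
  qed
  have "(\<integral>x. prim v x * deriv \<phi> x \<partial>lborel) = (\<integral>x. (\<integral>y. f x y \<partial>lborel) \<partial>lborel)"
    by (simp add: prim_def ip_def f_def k mult.commute)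
  also have "\<dots> = (\<integral>y. (\<integral>x. f x y \<partial>lborel) \<partial>lborel)"
    by (rule lborel_pair.Fubini_integral[OF int, symmetric])
  also have "\<dots> = (\<integral>y. - (v y * \<phi> y) \<partial>lborel)"
  proof (rule integral_cong_AE)
    show "AE y in lborel. (\<integral>x. f x y \<partial>lborel) = - (v y * \<phi> y)"
      using AE_lborel_singleton[of "0::real"]
    proof eventually_elim
      case (elim y)
      show ?case
      proof (cases "y > 0")
        case True
        then have "f x y = v y * (deriv \<phi> x * indicator {y..} x)" for x by (auto simp: f_def k_def indicator_def)
        then show ?thesis using test_integral_tail(1)[OF \<phi>, of y] by simp
      next
        case False
        with elim have "f x y = - (v y * (deriv \<phi> x * indicator {..y} x))" for x by (auto simp: f_def k_def indicator_def)
        then show ?thesis using test_integral_tail(2)[OF \<phi>, of y] by simp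
      qed
    qed
  qed (use test_fun_measurable[OF \<phi>] in measurable)
  finally show ?thesis by (simp add: ip_def)
qed

text \<open>The difference of \<open>u\<close> and the primitive of \<open>v\<close> has weak
  derivative zero on the interval and is constant there.\<close>

theorem weak_deriv_interval:
  assumes "a < b" "L2 u" "L2 v"
    and "\<And>\<phi>. test_function_on {a<..<b} \<phi> \<Longrightarrow> ip u (deriv \<phi>) = - ip v \<phi>"
  shows "\<exists>c. AE x in lborel. a < x \<and> x < b \<longrightarrow> u x = c + prim v x"
proof -
  \<comment> \<open>A primitive need not be square integrable on the line. The truncation is, and
    test functions supported in the interval do not see it.\<close>
  define p where "p x = indicator {a..b} x * prim v x" for x
  have pm: "prim v \<in> borel_measurable borel"
    using prim_continuous[OF assms(3)] by (rule borel_measurable_continuous_onI)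
  have "bounded (prim v ` {a..b})"
    by (intro compact_imp_bounded compact_continuous_image continuous_on_subset[OF prim_continuous[OF assms(3)]]) auto
  then obtain M where M: "\<And>x. x \<in> {a..b} \<Longrightarrow> \<bar>prim v x\<bar> \<le> M" unfolding bounded_iff by fastforce
  have p: "L2 p"
  proof (rule L2I_dominated)
    show "p \<in> borel_measurable borel" unfolding p_def using pm by simp
    show "integrable lborel (\<lambda>x. (M * indicator {a..b} x)\<^sup>2)"
      by (rule L2_integrable_sq[OF L2_cmult[OF L2_indicator_Icc]])
    show "AE x in lborel. (p x)\<^sup>2 \<le> (M * indicator {a..b} x)\<^sup>2"
    proof (rule AE_I2)
      fix x show "(p x)\<^sup>2 \<le> (M * indicator {a..b} x)\<^sup>2"
        using power_mono[OF M[of x], of 2] by (auto simp: p_def indicator_def)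
    qed
  qed
  have "\<exists>c. AE x in lborel. a < x \<and> x < b \<longrightarrow> u x - p x = c"
  proof (rule weak_deriv_zero_const[OF assms(1) L2_diff[OF assms(2) p]])
    fix \<phi> assume \<phi>: "test_function_on {a<..<b} \<phi>"
    have t: "test_fun \<phi>" "L2 (deriv \<phi>)"
      using \<phi> by (auto intro!: test_fun_L2 test_function_on_deriv test_function_on_mono[of "{a<..<b}"])
    have pe: "p x * deriv \<phi> x = prim v x * deriv \<phi> x" for x
      using test_function_onD(3)[OF test_function_on_deriv[OF \<phi>]] closure_subset[of "{x. deriv \<phi> x \<noteq> 0}"]
      by (auto simp: p_def indicator_def)
    have "ip p (deriv \<phi>) = - ip v \<phi>"
      unfolding ip_def[of p] pe by (rule prim_weak_deriv[OF assms(3) t(1)])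
    then show "ip (\<lambda>x. u x - p x) (deriv \<phi>) = 0"
      using assms(4)[OF \<phi>] by (simp add: ip_diff_left[OF assms(2) p t(2)])
  qed
  then obtain c where "AE x in lborel. a < x \<and> x < b \<longrightarrow> u x - p x = c" ..
  then have "AE x in lborel. a < x \<and> x < b \<longrightarrow> u x = c + prim v x"
    by eventually_elim (auto simp: p_def)
  then show ?thesis ..
qed

theorem weak_deriv_UNIV:
  assumes "L2 u" "L2 v" and "\<And>\<phi>. test_fun \<phi> \<Longrightarrow> ip u (deriv \<phi>) = - ip v \<phi>"
  shows "\<exists>c. AE x in lborel. u x = c + prim v x"
proof -
  have "\<exists>c. AE x in lborel. - real (Suc n) < x \<and> x < real (Suc n) \<longrightarrow> u x = c + prim v x" for n
    by (rule weak_deriv_interval[OF _ assms(1,2) assms(3)]) (auto intro: test_function_on_mono)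
  then obtain c where c: "\<And>n. AE x in lborel. - real (Suc n) < x \<and> x < real (Suc n) \<longrightarrow> u x = c n + prim v x"
    by metis
  \<comment> \<open>The intervals are nested and all contain \<open>{-1<..<1}\<close>, on which two
    different constants would contradict each other.\<close>
  have c0: "c n = c 0" for n
  proof (rule ccontr)
    assume ne: "c n \<noteq> c 0"
    have "AE x in lborel. \<not> (-1 < x \<and> x < (1::real))"
      using c[of n] c[of 0] by eventually_elim (use ne in auto)
    from emeasure_eq_0_AE[OF this] have "emeasure lborel {-1<..<1::real} = 0"
      by (simp add: greaterThanLessThan_def greaterThan_def lessThan_def Collect_conj_eq[symmetric])
    then show False by simp
  qed
  have "AE x in lborel. \<forall>n. - real (Suc n) < x \<and> x < real (Suc n) \<longrightarrow> u x = c 0 + prim v x"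
    unfolding AE_all_countable
  proof
    fix n show "AE x in lborel. - real (Suc n) < x \<and> x < real (Suc n) \<longrightarrow> u x = c 0 + prim v x"
      using c[of n] by (simp only: c0[of n])
  qed
  then have "AE x in lborel. u x = c 0 + prim v x"
  proof eventually_elim
    case (elim x)
    obtain n where "\<bar>x\<bar> < real n" using reals_Archimedean2 by blast
    then have "- real (Suc n) < x \<and> x < real (Suc n)" unfolding of_nat_Suc by linarith
    then show ?case using elim by blast
  qed
  then show ?thesis ..
qed


section \<open>Chain rule for primitives of square-integrable functions\<close>

lemma prim_has_derivative:
  assumes "L2 v" "isCont v x"
  shows "(prim v has_real_derivative v x) (at x)"
  unfolding has_field_derivative_iff
proof (rule LIM_I)
  fix e :: real assume "e > 0"
  then obtain d where d: "d > 0" "\<And>y. \<bar>y - x\<bar> < d \<Longrightarrow> \<bar>v y - v x\<bar> < e/2"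
    using assms(2)[unfolded isCont_def, THEN LIM_D, of "e/2"] by (metis half_gt_zero real_norm_def cancel_comm_monoid_add_class.diff_cancel abs_zero)
  have key: "\<bar>prim v b - prim v a - (b - a) * v x\<bar> \<le> (b - a) * (e/2)" if ab: "a \<le> b" "\<And>y. y \<in> {a..b} \<Longrightarrow> \<bar>y - x\<bar> < d" for a b
  proof -
    have i: "integrable lborel (\<lambda>y. indicator {a..b} y * v y)" by (rule L2_integrable_mult[OF L2_indicator_Icc assms(1)])
    have j: "integrable lborel (\<lambda>y. indicator {a..b} y * c)" for c :: real
      by (rule integrable_mult_left, rule integrable_real_indicator) (simp_all add: emeasure_lborel_Icc_eq)
    have c: "(\<integral>y. indicator {a..b} y * c \<partial>lborel) = (b - a) * c" for c using ab(1) by simp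
    have "prim v b - prim v a - (b - a) * v x = (\<integral>y. indicator {a..b} y * v y - indicator {a..b} y * v x \<partial>lborel)"
      unfolding prim_diff[OF assms(1) ab(1)] ip_def c[symmetric] by (rule Bochner_Integration.integral_diff[OF i j, symmetric])
    also have "\<bar>\<dots>\<bar> \<le> (\<integral>y. \<bar>indicator {a..b} y * v y - indicator {a..b} y * v x\<bar> \<partial>lborel)"
      by (rule integral_abs_bound)
    also have "\<dots> \<le> (\<integral>y. indicator {a..b} y * (e/2) \<partial>lborel)"
    proof (rule integral_mono)
      fix y show "\<bar>indicator {a..b} y * v y - indicator {a..b} y * v x\<bar> \<le> indicator {a..b} y * (e/2)"
        using d(2)[OF ab(2)[of y]] by (cases "y \<in> {a..b}") auto
    qed (use i j in auto)
    finally show ?thesis unfolding c .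
  qed
  show "\<exists>s>0. \<forall>y. y \<noteq> x \<and> norm (y - x) < s \<longrightarrow> norm ((prim v y - prim v x) / (y - x) - v x) < e"
  proof (intro exI[of _ d] conjI allI impI d(1))
    fix y assume y: "y \<noteq> x \<and> norm (y - x) < d"
    have "\<bar>prim v y - prim v x - (y - x) * v x\<bar> \<le> \<bar>y - x\<bar> * (e/2)"
    proof (cases "x \<le> y")
      case True then show ?thesis using key[of x y] y by simp
    next
      case False
      then have "\<bar>prim v x - prim v y - (x - y) * v x\<bar> \<le> (x - y) * (e/2)" using key[of y x] y by simp
      moreover have "prim v y - prim v x - (y - x) * v x = - (prim v x - prim v y - (x - y) * v x)"
        by (simp add: algebra_simps)
      ultimately show ?thesis using False by (simp only: abs_minus_cancel) simp
    qed
    then have "\<bar>(prim v y - prim v x - (y - x) * v x) / (y - x)\<bar> \<le> e/2"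
      using y by (simp add: abs_divide divide_le_eq mult.commute)
    moreover have "(prim v y - prim v x - (y - x) * v x) / (y - x) = (prim v y - prim v x) / (y - x) - v x"
      using y by (simp add: field_simps)
    ultimately show "norm ((prim v y - prim v x) / (y - x) - v x) < e" using \<open>e > 0\<close> by simp
  qed
qed

lemma L2_continuous_on_Icc:
  assumes "continuous_on {a..b} g"
  shows "L2 (\<lambda>x. indicator {a..b} x * g x)"
proof -
  have "bounded (g ` {a..b})"
    by (intro compact_imp_bounded compact_continuous_image assms) auto
  then obtain M where M: "\<And>x. x \<in> {a..b} \<Longrightarrow> \<bar>g x\<bar> \<le> M" unfolding bounded_iff by fastforce
  show ?thesis
  proof (rule L2I_dominated)
    show "(\<lambda>x. indicator {a..b} x * g x) \<in> borel_measurable borel"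
      using borel_measurable_continuous_on_indicator[OF _ assms] by simp
    show "integrable lborel (\<lambda>x. (M * indicator {a..b} x)\<^sup>2)"
      by (rule L2_integrable_sq[OF L2_cmult[OF L2_indicator_Icc]])
    show "AE x in lborel. (indicator {a..b} x * g x)\<^sup>2 \<le> (M * indicator {a..b} x)\<^sup>2"
    proof (rule AE_I2)
      fix x show "(indicator {a..b} x * g x)\<^sup>2 \<le> (M * indicator {a..b} x)\<^sup>2"
        using power_mono[OF M[of x], of 2] by (cases "x \<in> {a..b}") auto
    qed
  qed
qed

lemma prim_tendsto:
  assumes "\<And>n. L2 (q n)" "L2 p" "(\<lambda>n. ip (\<lambda>x. q n x - p x) (\<lambda>x. q n x - p x)) \<longlonglongrightarrow> 0"
  shows "(\<lambda>n. prim (q n) x) \<longlonglongrightarrow> prim p x"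
  unfolding prim_def
  by (rule ip_tendsto) (auto simp: assms ip_def[of "\<lambda>x. 0"] intro!: L2_diff L2_indicator_Icc)

text \<open>Convergence in \<open>L2\<close> gives pointwise convergence of the primitives and,
  since the norms stay bounded, a common bound for them on \<open>{a..b}\<close>. The continuous
  \<open>h\<close> is bounded on the corresponding range, which supplies the dominating
  function.\<close>

lemma L2_compose_prim_tendsto:
  assumes q: "\<And>n. L2 (q n)" "L2 p" "(\<lambda>n. ip (\<lambda>x. q n x - p x) (\<lambda>x. q n x - p x)) \<longlonglongrightarrow> 0"
    and h: "continuous_on UNIV h" and k: "continuous_on UNIV k"
  shows "(\<lambda>n. ip (\<lambda>x. indicator {a..b} x * (k x * h (c + prim (q n) x)) - indicator {a..b} x * (k x * h (c + prim p x)))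
      (\<lambda>x. indicator {a..b} x * (k x * h (c + prim (q n) x)) - indicator {a..b} x * (k x * h (c + prim p x)))) \<longlonglongrightarrow> 0"
proof -
  have "(\<lambda>n. ip (q n) (q n)) \<longlonglongrightarrow> ip p p"
    by (rule ip_tendsto) (auto simp: assms)
  then have "Bseq (\<lambda>n. ip (q n) (q n))" by (intro convergent_imp_Bseq convergentI)
  then obtain B where B: "B > 0" "\<And>n. norm (ip (q n) (q n)) \<le> B" by (auto elim!: BseqE)
  define D where "D = \<bar>c\<bar> + sqrt (\<bar>a\<bar> + \<bar>b\<bar>) * sqrt B"
  have bd: "\<bar>c + prim (q n) x\<bar> \<le> D" if "x \<in> {a..b}" for n x
  proof -
    have "\<bar>prim (q n) x\<bar> \<le> sqrt \<bar>x\<bar> * sqrt (ip (q n) (q n))"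
      using prim_Hoelder[OF q(1)[of n], of x 0] by simp
    also have "\<dots> \<le> sqrt (\<bar>a\<bar> + \<bar>b\<bar>) * sqrt B"
      using that B(2)[of n] by (intro mult_mono real_sqrt_le_mono) (auto simp: ip_nonneg)
    finally show ?thesis unfolding D_def by linarith
  qed
  have "bounded (h ` {-D..D})"
    by (intro compact_imp_bounded compact_continuous_image continuous_on_subset[OF h]) auto
  then obtain M where M: "\<And>x. x \<in> {-D..D} \<Longrightarrow> \<bar>h x\<bar> \<le> M" unfolding bounded_iff by fastforce
  have w: "L2 (\<lambda>x. M * (indicator {a..b} x * \<bar>k x\<bar>))"
    by (intro L2_cmult L2_continuous_on_Icc continuous_intros continuous_on_subset[OF k]) auto
  show ?thesis
  proof (rule L2_dominated_convergence(3)[OF _ _ w])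
    have m: "prim v \<in> borel_measurable borel" if "L2 v" for v
      by (rule borel_measurable_continuous_onI[OF prim_continuous[OF that]])
    show "(\<lambda>x. indicator {a..b} x * (k x * h (c + prim (q n) x))) \<in> borel_measurable borel" for n
      using m[OF q(1)[of n]] borel_measurable_continuous_onI[OF h] borel_measurable_continuous_onI[OF k] by measurable
    show "(\<lambda>x. indicator {a..b} x * (k x * h (c + prim p x))) \<in> borel_measurable borel"
      using m[OF q(2)] borel_measurable_continuous_onI[OF h] borel_measurable_continuous_onI[OF k] by measurable
    show "AE x in lborel. \<bar>indicator {a..b} x * (k x * h (c + prim (q n) x))\<bar> \<le> M * (indicator {a..b} x * \<bar>k x\<bar>)" for n
    proof (rule AE_I2)
      fix x show "\<bar>indicator {a..b} x * (k x * h (c + prim (q n) x))\<bar> \<le> M * (indicator {a..b} x * \<bar>k x\<bar>)"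
      proof (cases "x \<in> {a..b}")
        case True
        have "\<bar>h (c + prim (q n) x)\<bar> \<le> M" using M[of "c + prim (q n) x"] bd[OF True, of n] by (simp add: abs_le_iff)
        then show ?thesis using True mult_right_mono[of "\<bar>h (c + prim (q n) x)\<bar>" M "\<bar>k x\<bar>"] by (simp add: abs_mult mult.commute)
      qed simp
    qed
    show "AE x in lborel. (\<lambda>n. indicator {a..b} x * (k x * h (c + prim (q n) x))) \<longlonglongrightarrow> indicator {a..b} x * (k x * h (c + prim p x))"
    proof (rule AE_I2)
      fix x
      have "isCont h (c + prim p x)" using h by (simp add: continuous_on_eq_continuous_at)
      moreover have "(\<lambda>n. c + prim (q n) x) \<longlonglongrightarrow> c + prim p x" by (intro tendsto_intros prim_tendsto q)
      ultimately have "(\<lambda>n. h (c + prim (q n) x)) \<longlonglongrightarrow> h (c + prim p x)" by (rule isCont_tendsto_compose)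
      then show "(\<lambda>n. indicator {a..b} x * (k x * h (c + prim (q n) x))) \<longlonglongrightarrow> indicator {a..b} x * (k x * h (c + prim p x))"
        by (intro tendsto_intros)
    qed
  qed
qed

lemma L2_compose_prim:
  assumes "L2 p" "continuous_on UNIV h" "continuous_on UNIV k"
  shows "L2 (\<lambda>x. indicator {a..b} x * (k x * h (c + prim p x)))"
proof -
  have "continuous_on UNIV (\<lambda>x. k x * h (c + prim p x))"
    by (intro continuous_intros assms prim_continuous continuous_on_compose2[OF assms(2)]) auto
  then show ?thesis by (intro L2_continuous_on_Icc) (rule continuous_on_subset, auto)
qed

text \<open>
  Test functions approximating \<open>p\<close> in \<open>L\<^sup>2\<close> have smooth primitives converging uniformly on
  \<open>{a..b}\<close>, for which this is the fundamental theorem of calculus.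
\<close>

theorem chain_rule_interval:
  assumes p: "L2 p" and ab: "a \<le> b"
    and k: "\<And>x. (k has_real_derivative k' x) (at x)" "continuous_on UNIV k'"
    and h: "\<And>x. (h has_real_derivative h' x) (at x)" "continuous_on UNIV h'"
  shows "(\<integral>x. indicator {a..b} x * (k' x * h (c + prim p x) + k x * h' (c + prim p x) * p x) \<partial>lborel)
      = k b * h (c + prim p b) - k a * h (c + prim p a)"
proof -
  have kc: "continuous_on UNIV k" and hc: "continuous_on UNIV h"
    using k(1) h(1) by (auto simp: continuous_on_eq_continuous_at intro: DERIV_isCont)
  \<comment> \<open>The integral is rewritten as a sum of two pairings in which \<open>v\<close>
    itself occurs only as one factor; each factor converges in \<open>L2\<close> along the
    approximating sequence.\<close>
  define S where "S v = ip (indicator {a..b}) (\<lambda>x. indicator {a..b} x * (k' x * h (c + prim v x)))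
      + ip (\<lambda>x. indicator {a..b} x * (k x * h' (c + prim v x))) v" for v
  have S: "S v = (\<integral>x. indicator {a..b} x * (k' x * h (c + prim v x) + k x * h' (c + prim v x) * v x) \<partial>lborel)" if "L2 v" for v
  proof -
    have "indicator {a..b} x * (k' x * h (c + prim v x) + k x * h' (c + prim v x) * v x)
      = indicator {a..b} x * (indicator {a..b} x * (k' x * h (c + prim v x))) + indicator {a..b} x * (k x * h' (c + prim v x)) * v x" for x
      by (cases "x \<in> {a..b}") (simp_all add: algebra_simps)
    then show ?thesis unfolding S_def ip_def
      using L2_integrable_mult[OF L2_indicator_Icc L2_compose_prim[OF that hc k(2)]]
        L2_integrable_mult[OF L2_compose_prim[OF that h(2) kc] that] by simp
  qed
  obtain q where q: "\<And>n. test_fun (q n)" "(\<lambda>n. ip (\<lambda>x. q n x - p x) (\<lambda>x. q n x - p x)) \<longlonglongrightarrow> 0"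
    by (rule L2_approx_sequence[OF p]) (rule that)
  have qL: "L2 (q n)" for n by (rule test_fun_L2[OF q(1)])
  have eq: "S (q n) = k b * h (c + prim (q n) b) - k a * h (c + prim (q n) a)" for n
  proof -
    have qc: "isCont (q n) x" for x
      using Ck_imp_continuous[OF test_function_onD(1)[OF q(1)]] by (simp add: continuous_on_eq_continuous_at)
    have d: "((\<lambda>x. k x * h (c + prim (q n) x)) has_real_derivative k' x * h (c + prim (q n) x) + k x * h' (c + prim (q n) x) * q n x) (at x)" for x
    proof -
      have "((\<lambda>x. c + prim (q n) x) has_real_derivative q n x) (at x)"
        by (auto intro!: derivative_eq_intros prim_has_derivative[OF qL qc])
      from DERIV_chain2[OF h(1) this]
      have "((\<lambda>x. h (c + prim (q n) x)) has_real_derivative h' (c + prim (q n) x) * q n x) (at x)" .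
      from DERIV_mult[OF k(1) this] show ?thesis by (simp add: algebra_simps)
    qed
    have c: "isCont (\<lambda>x. k' x * h (c + prim (q n) x) + k x * h' (c + prim (q n) x) * q n x) x" for x
    proof -
      have "continuous_on UNIV (\<lambda>x. k' x * h (c + prim (q n) x) + k x * h' (c + prim (q n) x) * q n x)"
        by (intro continuous_intros k kc prim_continuous qL continuous_on_compose2[OF hc] continuous_on_compose2[OF h(2)]
           Ck_imp_continuous[OF test_function_onD(1)[OF q(1)]]) auto
      then show ?thesis by (simp add: continuous_on_eq_continuous_at)
    qed
    show ?thesis unfolding S[OF qL]
      using integral_FTC_Icc_real[OF ab d c] by (simp add: mult.commute)
  qed
  have "(\<lambda>n. S (q n)) \<longlonglongrightarrow> S p"
    unfolding S_def
  proof (intro tendsto_add ip_tendsto[OF _ _ _ _ _ L2_compose_prim_tendsto[OF qL p q(2) hc k(2)]]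
     ip_tendsto[OF _ _ _ _ L2_compose_prim_tendsto[OF qL p q(2) h(2) kc] q(2)])
  qed (auto simp: ip_def[of "\<lambda>x. 0"] p qL intro!: always_eventually L2_indicator_Icc L2_compose_prim hc h kc k)
  moreover have "(\<lambda>n. S (q n)) \<longlonglongrightarrow> k b * h (c + prim p b) - k a * h (c + prim p a)"
  proof -
    have "isCont h y" for y using hc by (simp add: continuous_on_eq_continuous_at)
    then have "(\<lambda>n. h (c + prim (q n) x)) \<longlonglongrightarrow> h (c + prim p x)" for x
      by (rule isCont_tendsto_compose) (intro tendsto_intros prim_tendsto[OF qL p q(2)])
    then show ?thesis unfolding eq by (intro tendsto_diff tendsto_mult tendsto_const)
  qed
  ultimately have "S p = k b * h (c + prim p b) - k a * h (c + prim p a)" by (rule LIMSEQ_unique)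
  then show ?thesis using S[OF p] by simp
qed

text \<open>As \<open>prim p\<close> vanishes at \<open>0\<close>, its square at \<open>x\<close> is
  the integral of \<open>2 * prim p * p\<close> between \<open>0\<close> and \<open>x\<close>. The
  Sobolev embedding thus has constant 1, and smallness of the \<open>H^1\<close> norm bounds the
  function pointwise by the same number.\<close>

lemma prim_square_bound:
  assumes "L2 p" "L2 (prim p)"
  shows "(prim p x)\<^sup>2 \<le> ip (prim p) (prim p) + ip p p"
proof -
  have kk: "((\<lambda>_. 1) has_real_derivative 0) (at x)" for x :: real by simp
  have hh: "((\<lambda>y. y\<^sup>2) has_real_derivative 2 * y) (at y)" for y :: real by (auto intro!: derivative_eq_intros)
  note ch = chain_rule_interval[OF assms(1) _ kk continuous_on_const hh, of _ _ 0]
  have i: "integrable lborel (\<lambda>x. (prim p x)\<^sup>2 + (p x)\<^sup>2)" using assms by (simp add: L2_def)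
  have bd: "\<bar>\<integral>x. indicator {a..b} x * (0 * (0 + prim p x)\<^sup>2 + 1 * (2 * (0 + prim p x)) * p x) \<partial>lborel\<bar> \<le> ip (prim p) (prim p) + ip p p" for a b
  proof -
    have "\<bar>\<integral>x. indicator {a..b} x * (0 * (0 + prim p x)\<^sup>2 + 1 * (2 * (0 + prim p x)) * p x) \<partial>lborel\<bar> \<le>
       (\<integral>x. \<bar>indicator {a..b} x * (0 * (0 + prim p x)\<^sup>2 + 1 * (2 * (0 + prim p x)) * p x)\<bar> \<partial>lborel)"
      by (rule integral_abs_bound)
    also have "\<dots> \<le> (\<integral>x. (prim p x)\<^sup>2 + (p x)\<^sup>2 \<partial>lborel)"
    proof (rule integral_mono_AE)
      have "integrable lborel (\<lambda>x. 2 * (indicator {a..b} x * prim p x * p x))"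
        by (intro integrable_mult_right L2_integrable_mult L2_bounded_mult[where M=1] assms) (auto simp: indicator_def)
      then show "integrable lborel (\<lambda>x. \<bar>indicator {a..b} x * (0 * (0 + prim p x)\<^sup>2 + 1 * (2 * (0 + prim p x)) * p x)\<bar>)"
        by (intro integrable_abs) (simp add: mult_ac)
      show "AE x in lborel. \<bar>indicator {a..b} x * (0 * (0 + prim p x)\<^sup>2 + 1 * (2 * (0 + prim p x)) * p x)\<bar> \<le> (prim p x)\<^sup>2 + (p x)\<^sup>2"
      proof (rule AE_I2)
        fix x show "\<bar>indicator {a..b} x * (0 * (0 + prim p x)\<^sup>2 + 1 * (2 * (0 + prim p x)) * p x)\<bar> \<le> (prim p x)\<^sup>2 + (p x)\<^sup>2"
          using two_mult_le_squares[of "prim p x" "p x"] by (cases "x \<in> {a..b}") (auto simp: abs_mult)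
      qed
    qed (use i in auto)
    also have "\<dots> = ip (prim p) (prim p) + ip p p" using assms by (simp add: ip_self_eq L2_def)
    finally show ?thesis .
  qed
  show ?thesis
  proof (cases "0 \<le> x")
    case True
    have "(prim p x)\<^sup>2 = (\<integral>y. indicator {0..x} y * (0 * (0 + prim p y)\<^sup>2 + 1 * (2 * (0 + prim p y)) * p y) \<partial>lborel)"
      using ch[OF True] by (simp add: continuous_intros)
    then show ?thesis using bd[of 0 x] by linarith
  next
    case False
    then have "- (prim p x)\<^sup>2 = (\<integral>y. indicator {x..0} y * (0 * (0 + prim p y)\<^sup>2 + 1 * (2 * (0 + prim p y)) * p y) \<partial>lborel)"
      using ch[of x 0] by (simp add: continuous_intros)
    then show ?thesis using bd[of x 0] by linarith
  qed
qed

lemma integrable_limit_zero: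
  fixes y :: "real \<Rightarrow> real"
  assumes "integrable lborel y" "(y \<longlongrightarrow> L) at_top"
  shows "L = 0"
proof (rule ccontr)
  assume "L \<noteq> 0"
  then have "\<forall>\<^sub>F x in at_top. \<bar>L\<bar>/2 < \<bar>y x\<bar>"
    by (intro order_tendstoD(1)[OF tendsto_rabs[OF assms(2)]]) auto
  then obtain X where X: "\<And>x. x \<ge> X \<Longrightarrow> \<bar>L\<bar>/2 < \<bar>y x\<bar>" by (auto simp: eventually_at_top_linorder)
  have "real n * (\<bar>L\<bar>/2) \<le> (\<integral>x. \<bar>y x\<bar> \<partial>lborel)" for n :: nat
  proof -
    have "(\<integral>x. indicator {X..X + real n} x * (\<bar>L\<bar>/2) \<partial>lborel) \<le> (\<integral>x. \<bar>y x\<bar> \<partial>lborel)"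
    proof (rule integral_mono)
      show "integrable lborel (\<lambda>x. indicator {X..X + real n} x * (\<bar>L\<bar>/2))"
        by (rule integrable_mult_left, rule integrable_real_indicator) (simp_all add: emeasure_lborel_Icc_eq)
      fix x show "indicator {X..X + real n} x * (\<bar>L\<bar>/2) \<le> \<bar>y x\<bar>"
        using X[of x] by (cases "x \<in> {X..X + real n}") auto
    qed (use assms(1) in auto)
    then show ?thesis by simp
  qed
  moreover obtain n :: nat where "(\<integral>x. \<bar>y x\<bar> \<partial>lborel) / (\<bar>L\<bar>/2) < real n" using reals_Archimedean2 by blast
  ultimately show False using \<open>L \<noteq> 0\<close> by (simp add: field_simps not_less[symmetric])
qed

text \<open>
  The weight \<open>k\<close> is extended to an odd function, whose jump at \<open>0\<close> is compensated by \<open>h 0 = 0\<close>.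
  The boundary terms at infinity converge, and \<open>int2\<close> forces their limit to be zero.
\<close>

theorem chain_rule_line:
  assumes p: "L2 p"
    and k: "\<And>x. (k has_real_derivative k' x) (at x)" "continuous_on UNIV k'"
    and h: "\<And>x. (h has_real_derivative h' x) (at x)" "continuous_on UNIV h'" "h 0 = 0"
    and int1: "integrable lborel (\<lambda>x. k' \<bar>x\<bar> * h (prim p x) + sgn x * k \<bar>x\<bar> * h' (prim p x) * p x)"
    and int2: "integrable lborel (\<lambda>x. k \<bar>x\<bar> * h (prim p x))"
  shows "(\<integral>x. k' \<bar>x\<bar> * h (prim p x) + sgn x * k \<bar>x\<bar> * h' (prim p x) * p x \<partial>lborel) = 0"
proof -
  define g where "g x = k' \<bar>x\<bar> * h (prim p x) + sgn x * k \<bar>x\<bar> * h' (prim p x) * p x" for x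
  have gi: "integrable lborel g" using int1 by (simp add: g_def[abs_def])
  \<comment> \<open>Both boundary terms carry a plus sign, because the extended weight takes the
    value \<open>- k R\<close> at \<open>- R\<close>.\<close>
  define Y where "Y R = k R * h (prim p R) + k R * h (prim p (- R))" for R
  have fin: "(\<integral>x. indicator {-R..R} x * g x \<partial>lborel) = Y R" if R: "R \<ge> 0" for R
  proof -
    have right: "(\<integral>x. indicator {0..R} x * (k' x * h (0 + prim p x) + k x * h' (0 + prim p x) * p x) \<partial>lborel) = k R * h (prim p R)"
      using chain_rule_interval[OF p R k h(1,2), of 0] h(3) by simp
    have k2: "((\<lambda>x. - k (- x)) has_real_derivative k' (- x)) (at x)" for x
      by (auto intro!: derivative_eq_intros DERIV_chain2[OF k(1), of "uminus"])
    have k3: "continuous_on UNIV (\<lambda>x. k' (- x))"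
      by (intro continuous_on_compose2[OF k(2)] continuous_intros) auto
    have left: "(\<integral>x. indicator {-R..0} x * (k' (- x) * h (0 + prim p x) + - k (- x) * h' (0 + prim p x) * p x) \<partial>lborel) = k R * h (prim p (- R))"
      using chain_rule_interval[OF p _ k2 k3 h(1,2), of "-R" 0 0] R h(3) by simp
    have i: "integrable lborel (\<lambda>x. indicator A x * g x)" if "A \<in> sets borel" for A
      using integrable_mult_indicator[OF _ gi, of A] that by simp
    have split: "(\<integral>x. indicator {-R..R} x * g x \<partial>lborel) = (\<integral>x. indicator {0..R} x * g x + indicator {-R..0} x * g x \<partial>lborel)"
    proof (rule integral_cong_AE)
      show "AE x in lborel. indicator {-R..R} x * g x = indicator {0..R} x * g x + indicator {-R..0} x * g x"
        using AE_lborel_singleton[of "0::real"] by eventually_elim (use R in \<open>auto simp: indicator_def\<close>)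
    qed (use i in \<open>auto intro!: borel_measurable_integrable\<close>)
    have 1: "(\<integral>x. indicator {0..R} x * g x \<partial>lborel) = (\<integral>x. indicator {0..R} x * (k' x * h (0 + prim p x) + k x * h' (0 + prim p x) * p x) \<partial>lborel)"
    proof (rule integral_cong_AE)
      show "AE x in lborel. indicator {0..R} x * g x = indicator {0..R} x * (k' x * h (0 + prim p x) + k x * h' (0 + prim p x) * p x)"
        using AE_lborel_singleton[of "0::real"] by eventually_elim (auto simp: indicator_def g_def)
    qed (use i[of "{0..R}"] borel_measurable_continuous_onI[OF prim_continuous[OF p]] borel_measurable_continuous_onI[OF k(2)]
       borel_measurable_continuous_onI[OF h(2)] L2_measurable[OF p]
       borel_measurable_continuous_onI[of k] borel_measurable_continuous_onI[of h] DERIV_isCont[OF k(1)] DERIV_isCont[OF h(1)]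
       in \<open>auto simp: continuous_on_eq_continuous_at intro!: borel_measurable_integrable\<close>)
    have 2: "(\<integral>x. indicator {-R..0} x * g x \<partial>lborel) = (\<integral>x. indicator {-R..0} x * (k' (- x) * h (0 + prim p x) + - k (- x) * h' (0 + prim p x) * p x) \<partial>lborel)"
    proof (rule integral_cong_AE)
      show "AE x in lborel. indicator {-R..0} x * g x = indicator {-R..0} x * (k' (- x) * h (0 + prim p x) + - k (- x) * h' (0 + prim p x) * p x)"
        using AE_lborel_singleton[of "0::real"] by eventually_elim (auto simp: indicator_def g_def)
    qed (use i[of "{-R..0}"] borel_measurable_continuous_onI[OF prim_continuous[OF p]] borel_measurable_continuous_onI[OF k(2)]
       borel_measurable_continuous_onI[OF h(2)] L2_measurable[OF p]
       borel_measurable_continuous_onI[of k] borel_measurable_continuous_onI[of h] DERIV_isCont[OF k(1)] DERIV_isCont[OF h(1)]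
       in \<open>auto simp: continuous_on_eq_continuous_at intro!: borel_measurable_integrable\<close>)
    have "(\<integral>x. indicator {0..R} x * g x + indicator {-R..0} x * g x \<partial>lborel)
        = (\<integral>x. indicator {0..R} x * g x \<partial>lborel) + (\<integral>x. indicator {-R..0} x * g x \<partial>lborel)"
      by (rule Bochner_Integration.integral_add) (rule i, simp)+
    then show ?thesis unfolding split 1 2 left right Y_def .
  qed
  have "((\<lambda>R. \<integral>x. indicator {-R..R} x * g x \<partial>lborel) \<longlongrightarrow> (\<integral>x. g x \<partial>lborel)) at_top"
  proof (rule integral_dominated_convergence_at_top[where w="\<lambda>x. \<bar>g x\<bar>"])
    show "\<forall>\<^sub>F R in at_top. AE x in lborel. norm (indicator {-R..R} x * g x) \<le> \<bar>g x\<bar>"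
      by (intro always_eventually allI AE_I2) (simp add: indicator_def)
    show "AE x in lborel. ((\<lambda>R. indicator {-R..R} x * g x) \<longlongrightarrow> g x) at_top"
    proof (rule AE_I2, rule tendsto_eventually)
      fix x :: real show "\<forall>\<^sub>F R in at_top. indicator {-R..R} x * g x = g x"
        using eventually_ge_at_top[of "\<bar>x\<bar>"] by eventually_elim (auto simp: indicator_def)
    qed
  qed (use gi borel_measurable_integrable[OF gi] in auto)
  then have limY: "(Y \<longlongrightarrow> (\<integral>x. g x \<partial>lborel)) at_top"
    by (rule Lim_transform_eventually) (use eventually_ge_at_top[of "0::real"] in \<open>eventually_elim, auto simp: fin\<close>)
  have "integrable lborel (\<lambda>R. indicator {0..} R * (k \<bar>R\<bar> * h (prim p R) + k \<bar>- R\<bar> * h (prim p (- R))))"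
  proof -
    have "integrable lborel (\<lambda>x. k \<bar>- x\<bar> * h (prim p (- x)))"
      using lborel_integrable_real_affine[OF int2, of "-1" 0] by simp
    from integrable_mult_indicator[OF _ Bochner_Integration.integrable_add[OF int2 this], of "{0..}"]
    show ?thesis by simp
  qed
  moreover have "((\<lambda>R. indicator {0..} R * (k \<bar>R\<bar> * h (prim p R) + k \<bar>- R\<bar> * h (prim p (- R)))) \<longlongrightarrow> (\<integral>x. g x \<partial>lborel)) at_top"
    using limY
    by (rule Lim_transform_eventually) (use eventually_ge_at_top[of "0::real"] in \<open>eventually_elim, auto simp: Y_def\<close>)
  ultimately have "(\<integral>x. g x \<partial>lborel) = 0" by (rule integrable_limit_zero)
  then show ?thesis by (simp add: g_def)
qed


section \<open>Transport equations\<close>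

definition sqd :: "(real \<Rightarrow> real) \<Rightarrow> (real \<Rightarrow> real) \<Rightarrow> real" where
  "sqd u v = ip (\<lambda>x. u x - v x) (\<lambda>x. u x - v x)"

text \<open>The filter is left general so that approximating sequences and limits in time are
  treated together. Membership in \<open>L2\<close> is only eventual, since curves are controlled at
  positive times only.\<close>

definition L2lim :: "('a \<Rightarrow> real \<Rightarrow> real) \<Rightarrow> (real \<Rightarrow> real) \<Rightarrow> 'a filter \<Rightarrow> bool" where
  "L2lim u u0 F \<longleftrightarrow> (\<forall>\<^sub>F s in F. L2 (u s)) \<and> L2 u0 \<and> ((\<lambda>s. sqd (u s) u0) \<longlongrightarrow> 0) F"

definition L2curve :: "(real \<Rightarrow> real \<Rightarrow> real) \<Rightarrow> bool" where
  "L2curve A \<longleftrightarrow> (\<forall>t>0. L2lim A (A t) (at t))"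

lemma sqd_nonneg: "0 \<le> sqd u v"
  by (simp add: sqd_def ip_nonneg)

lemma sqd_eq: "sqd u v = (\<integral>x. (u x - v x)\<^sup>2 \<partial>lborel)"
  by (simp add: sqd_def ip_self_eq)

lemma sqd_same[simp]: "sqd u u = 0"
  by (simp add: sqd_eq)

lemma sqd_shift: "sqd (\<lambda>x. u (x + h)) (\<lambda>x. v (x + h)) = sqd u v"
  unfolding sqd_eq by (rule integral_shift[of "\<lambda>x. (u x - v x)\<^sup>2"])

lemma sqd_triangle:
  assumes "L2 u" "L2 v" "L2 w"
  shows "sqd u w \<le> 2 * sqd u v + 2 * sqd v w"
proof -
  have "(\<lambda>x. u x - w x) = (\<lambda>x. (u x - v x) + (v x - w x))" by auto
  then show ?thesis
    using ip_add_le[OF L2_diff[OF assms(1,2)] L2_diff[OF assms(2,3)]] by (simp add: sqd_def)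
qed

lemma L2limD: "L2lim u u0 F \<Longrightarrow> \<forall>\<^sub>F s in F. L2 (u s)" "L2lim u u0 F \<Longrightarrow> L2 u0"
  "L2lim u u0 F \<Longrightarrow> ((\<lambda>s. sqd (u s) u0) \<longlongrightarrow> 0) F"
  by (simp_all add: L2lim_def)

lemma L2limI_bound:
  assumes "\<forall>\<^sub>F s in F. L2 (u s)" "L2 u0" "\<forall>\<^sub>F s in F. sqd (u s) u0 \<le> g s" "(g \<longlongrightarrow> 0) F"
  shows "L2lim u u0 F"
  unfolding L2lim_def
proof (intro conjI assms)
  show "((\<lambda>s. sqd (u s) u0) \<longlongrightarrow> 0) F"
    by (rule real_tendsto_sandwich[OF _ assms(3) tendsto_const assms(4)]) (simp add: sqd_nonneg)
qed

lemma L2lim_ip: "L2lim u u0 F \<Longrightarrow> L2lim v v0 F \<Longrightarrow> ((\<lambda>s. ip (u s) (v s)) \<longlongrightarrow> ip u0 v0) F"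
  by (rule ip_tendsto) (simp_all add: L2lim_def sqd_def)

lemma L2lim_const: "L2 u \<Longrightarrow> L2lim (\<lambda>_. u) u F"
  by (simp add: L2lim_def)

lemma L2lim_add:
  assumes "L2lim u u0 F" "L2lim v v0 F"
  shows "L2lim (\<lambda>s x. u s x + v s x) (\<lambda>x. u0 x + v0 x) F"
proof (rule L2limI_bound[where g="\<lambda>s. 2 * sqd (u s) u0 + 2 * sqd (v s) v0"])
  show "((\<lambda>s. 2 * sqd (u s) u0 + 2 * sqd (v s) v0) \<longlongrightarrow> 0) F"
    using tendsto_add[OF tendsto_mult[OF tendsto_const[of 2] L2limD(3)[OF assms(1)]] tendsto_mult[OF tendsto_const[of 2] L2limD(3)[OF assms(2)]]]
    by simp
  show "\<forall>\<^sub>F s in F. L2 (\<lambda>x. u s x + v s x)"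
    using L2limD(1)[OF assms(1)] L2limD(1)[OF assms(2)] by eventually_elim (rule L2_add)
  show "\<forall>\<^sub>F s in F. sqd (\<lambda>x. u s x + v s x) (\<lambda>x. u0 x + v0 x) \<le> 2 * sqd (u s) u0 + 2 * sqd (v s) v0"
    using L2limD(1)[OF assms(1)] L2limD(1)[OF assms(2)]
  proof eventually_elim
    case (elim s)
    have "(\<lambda>x. u s x + v s x - (u0 x + v0 x)) = (\<lambda>x. (u s x - u0 x) + (v s x - v0 x))" by auto
    then show ?case unfolding sqd_def
      using ip_add_le[OF L2_diff[OF elim(1) L2limD(2)[OF assms(1)]] L2_diff[OF elim(2) L2limD(2)[OF assms(2)]]] by simp
  qed
qed (intro L2_add L2limD(2)[OF assms(1)] L2limD(2)[OF assms(2)])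

lemma L2lim_bounded_mult:
  assumes "L2lim u u0 F" "c \<in> borel_measurable borel" "\<And>x. \<bar>c x\<bar> \<le> M"
  shows "L2lim (\<lambda>s x. c x * u s x) (\<lambda>x. c x * u0 x) F"
proof (rule L2limI_bound[where g="\<lambda>s. M\<^sup>2 * sqd (u s) u0"])
  show "\<forall>\<^sub>F s in F. L2 (\<lambda>x. c x * u s x)"
    using L2limD(1)[OF assms(1)] by eventually_elim (rule L2_bounded_mult[OF _ assms(2,3)])
  show "((\<lambda>s. M\<^sup>2 * sqd (u s) u0) \<longlongrightarrow> 0) F"
    using tendsto_mult[OF tendsto_const L2limD(3)[OF assms(1)], of "M\<^sup>2"] by simp
  show "\<forall>\<^sub>F s in F. sqd (\<lambda>x. c x * u s x) (\<lambda>x. c x * u0 x) \<le> M\<^sup>2 * sqd (u s) u0"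
    using L2limD(1)[OF assms(1)]
  proof eventually_elim
    case (elim s)
    have d: "L2 (\<lambda>x. u s x - u0 x)" by (rule L2_diff[OF elim L2limD(2)[OF assms(1)]])
    have e: "(c x * u s x - c x * u0 x)\<^sup>2 = (c x * (u s x - u0 x))\<^sup>2" for x by (simp add: right_diff_distrib)
    have "sqd (\<lambda>x. c x * u s x) (\<lambda>x. c x * u0 x) \<le> (\<integral>x. M\<^sup>2 * (u s x - u0 x)\<^sup>2 \<partial>lborel)"
      unfolding sqd_eq e
    proof (rule integral_mono)
      show "integrable lborel (\<lambda>x. (c x * (u s x - u0 x))\<^sup>2)"
        by (rule L2_integrable_sq[OF L2_bounded_mult[OF d assms(2,3)]])
      show "(c x * (u s x - u0 x))\<^sup>2 \<le> M\<^sup>2 * (u s x - u0 x)\<^sup>2" for x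
        using power_mono[OF assms(3)[of x], of 2] by (simp add: power_mult_distrib mult_right_mono)
    qed (use L2_integrable_sq[OF d] in simp)
    then show ?case by (simp add: sqd_eq)
  qed
qed (rule L2_bounded_mult[OF L2limD(2)[OF assms(1)] assms(2,3)])

lemma L2lim_cmult: "L2lim u u0 F \<Longrightarrow> L2lim (\<lambda>s x. c * u s x) (\<lambda>x. c * u0 x) F"
  by (rule L2lim_bounded_mult[where M="\<bar>c\<bar>"]) auto

text \<open>Admits arbitrary intermediate times \<open>\<xi> s\<close>. They will come from the mean
  value theorem, with nothing known about them beyond convergence to \<open>t\<close>.\<close>

lemma L2lim_curve:
  assumes "L2curve A" "t > 0" "(\<xi> \<longlongrightarrow> t) F"
  shows "L2lim (\<lambda>s. A (\<xi> s)) (A t) F"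
proof -
  have A: "L2lim A (A t) (at t)" using assms by (simp add: L2curve_def)
  have "\<forall>\<^sub>F s in nhds t. L2 (A s)"
    using L2limD(1)[OF A] L2limD(2)[OF A] by (auto simp: eventually_at_filter elim: eventually_mono)
  then have "\<forall>\<^sub>F s in F. L2 (A (\<xi> s))" using assms(3) by (auto simp: filterlim_iff)
  moreover have "isCont (\<lambda>s. sqd (A s) (A t)) t" using L2limD(3)[OF A] by (simp add: isCont_def)
  from isCont_tendsto_compose[OF this assms(3)] have "((\<lambda>s. sqd (A (\<xi> s)) (A t)) \<longlongrightarrow> 0) F" by simp
  ultimately show ?thesis using L2limD(2)[OF A] by (simp add: L2lim_def)
qed

lemma L2lim_shift_const:
  assumes "L2 u" "(\<eta> \<longlongrightarrow> 0) F"
  shows "L2lim (\<lambda>s x. u (x + \<eta> s)) u F"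
proof -
  have "isCont (\<lambda>h. sqd (\<lambda>x. u (x + h)) u) 0" using L2_shift_continuous[OF assms(1)] by (simp add: isCont_def sqd_def ip_def)
  from isCont_tendsto_compose[OF this assms(2)] have "((\<lambda>s. sqd (\<lambda>x. u (x + \<eta> s)) u) \<longlongrightarrow> 0) F" by simp
  then show ?thesis using assms(1) by (simp add: L2lim_def L2_shift)
qed

text \<open>Shifts preserve the distance in \<open>L2\<close>, so the moving function can be
  replaced by its limit before the shift is sent to zero.\<close>

lemma L2lim_shift:
  assumes "L2lim u u0 F" "(\<eta> \<longlongrightarrow> 0) F"
  shows "L2lim (\<lambda>s x. u s (x + \<eta> s)) u0 F"
proof (rule L2limI_bound[where g="\<lambda>s. 2 * sqd (u s) u0 + 2 * sqd (\<lambda>x. u0 (x + \<eta> s)) u0"])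
  note u0 = L2limD(2)[OF assms(1)]
  show "\<forall>\<^sub>F s in F. L2 (\<lambda>x. u s (x + \<eta> s))"
    using L2limD(1)[OF assms(1)] by eventually_elim (rule L2_shift)
  show "((\<lambda>s. 2 * sqd (u s) u0 + 2 * sqd (\<lambda>x. u0 (x + \<eta> s)) u0) \<longlongrightarrow> 0) F"
    using tendsto_add[OF tendsto_mult[OF tendsto_const[of 2] L2limD(3)[OF assms(1)]] tendsto_mult[OF tendsto_const[of 2] L2limD(3)[OF L2lim_shift_const[OF u0 assms(2)]]]]
    by simp
  show "\<forall>\<^sub>F s in F. sqd (\<lambda>x. u s (x + \<eta> s)) u0 \<le> 2 * sqd (u s) u0 + 2 * sqd (\<lambda>x. u0 (x + \<eta> s)) u0"
    using L2limD(1)[OF assms(1)]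
  proof eventually_elim
    case (elim s)
    show ?case using sqd_triangle[OF L2_shift[OF elim, of "\<eta> s"] L2_shift[OF u0, of "\<eta> s"] u0] by (simp add: sqd_shift)
  qed
qed (rule L2limD(2)[OF assms(1)])

text \<open>Shifting a Lipschitz weight changes it uniformly by at most
  \<open>M * \<bar>\<eta> s\<bar>\<close>, so a bounded factor in \<open>L2\<close> absorbs the
  difference.\<close>

lemma L2lim_shift_mult:
  assumes "L2lim u u0 F" "(\<eta> \<longlongrightarrow> 0) F" "\<And>x. \<bar>c x\<bar> \<le> M" "\<And>x y. \<bar>c x - c y\<bar> \<le> M * \<bar>x - y\<bar>" "c \<in> borel_measurable borel"
  shows "L2lim (\<lambda>s x. c (x + \<eta> s) * u s x) (\<lambda>x. c x * u0 x) F"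
proof -
  note u0 = L2limD(2)[OF assms(1)]
  have 1: "L2lim (\<lambda>s x. (c (x + \<eta> s) - c x) * u s x) (\<lambda>x. 0) F"
  proof (rule L2limI_bound[where g="\<lambda>s. (M * \<eta> s)\<^sup>2 * ip (u s) (u s)"])
    have bd: "\<bar>c (x + \<eta> s) - c x\<bar> \<le> \<bar>M * \<eta> s\<bar>" for x s using assms(4)[of "x + \<eta> s" x] assms(3)[of 0] by (simp add: abs_mult)
    have L: "L2 (\<lambda>x. (c (x + \<eta> s) - c x) * u s x)" if "L2 (u s)" for s
      by (rule L2_bounded_mult[OF that _ bd]) (use assms(5) in measurable)
    show "\<forall>\<^sub>F s in F. L2 (\<lambda>x. (c (x + \<eta> s) - c x) * u s x)"
      using L2limD(1)[OF assms(1)] by eventually_elim (rule L)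
    show "L2 (\<lambda>x. 0)" by (simp add: L2_def)
    have "((\<lambda>s. (M * \<eta> s)\<^sup>2 * ip (u s) (u s)) \<longlongrightarrow> (M * 0)\<^sup>2 * ip u0 u0) F"
      by (intro tendsto_intros L2lim_ip assms)
    then show "((\<lambda>s. (M * \<eta> s)\<^sup>2 * ip (u s) (u s)) \<longlongrightarrow> 0) F" by simp
    show "\<forall>\<^sub>F s in F. sqd (\<lambda>x. (c (x + \<eta> s) - c x) * u s x) (\<lambda>x. 0) \<le> (M * \<eta> s)\<^sup>2 * ip (u s) (u s)"
      using L2limD(1)[OF assms(1)]
    proof eventually_elim
      case (elim s)
      have "sqd (\<lambda>x. (c (x + \<eta> s) - c x) * u s x) (\<lambda>x. 0) \<le> (\<integral>x. (M * \<eta> s)\<^sup>2 * (u s x)\<^sup>2 \<partial>lborel)"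
        unfolding sqd_eq
      proof (rule integral_mono)
        show "integrable lborel (\<lambda>x. ((c (x + \<eta> s) - c x) * u s x - 0)\<^sup>2)"
          using L2_integrable_sq[OF L[OF elim]] by simp
        show "((c (x + \<eta> s) - c x) * u s x - 0)\<^sup>2 \<le> (M * \<eta> s)\<^sup>2 * (u s x)\<^sup>2" for x
          using power_mono[OF bd[of x s], of 2] by (simp add: power_mult_distrib[of _ "u s x"] mult_right_mono)
      qed (use L2_integrable_sq[OF elim] in simp)
      then show ?case by (simp add: ip_self_eq)
    qed
  qed
  have "L2lim (\<lambda>s x. (c (x + \<eta> s) - c x) * u s x + c x * u s x) (\<lambda>x. 0 + c x * u0 x) F"
    by (rule L2lim_add[OF 1 L2lim_bounded_mult[OF assms(1,5,3)]])
  then show ?thesis by (simp add: algebra_simps)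
qed

lemma ip_shift_curve_isCont:
  assumes "L2curve A" "L2 \<phi>" "t > 0"
  shows "isCont (\<lambda>t. ip (A t) (\<lambda>x. \<phi> (x + \<sigma> * t))) t"
  unfolding isCont_def
proof (rule L2lim_ip)
  show "L2lim A (A t) (at t)" using assms by (simp add: L2curve_def)
  have "((\<lambda>s. \<sigma> * s - \<sigma> * t) \<longlongrightarrow> \<sigma> * t - \<sigma> * t) (at t)" by (intro tendsto_intros)
  then have "L2lim (\<lambda>s x. (\<lambda>x. \<phi> (x + \<sigma> * t)) (x + (\<sigma> * s - \<sigma> * t))) (\<lambda>x. \<phi> (x + \<sigma> * t)) (at t)"
    by (intro L2lim_shift_const L2_shift assms) simp
  then show "L2lim (\<lambda>t x. \<phi> (x + \<sigma> * t)) (\<lambda>x. \<phi> (x + \<sigma> * t)) (at t)" by (simp add: algebra_simps)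
qed

lemma AE_zero_continuous:
  fixes a b x :: real
  assumes "continuous_on {a<..<b} d" "AE x in lborel. a < x \<and> x < b \<longrightarrow> d x = (0::real)" "a < x" "x < b"
  shows "d x = 0"
proof (rule ccontr)
  assume "d x \<noteq> 0"
  have "isCont d x"
    using continuous_on_interior[OF assms(1), of x] assms(3,4) by simp
  then obtain e where e: "e > 0" "\<And>y. \<bar>y - x\<bar> < e \<Longrightarrow> d y \<noteq> 0"
    using continuous_at_avoid[of x d 0] \<open>d x \<noteq> 0\<close> by (auto simp: dist_real_def abs_minus_commute)
  define e' where "e' = min e (min (x - a) (b - x))"
  have e': "e' > 0" "e' \<le> e" "e' \<le> x - a" "e' \<le> b - x" using e assms by (auto simp: e'_def)
  have "AE y in lborel. \<not> (x < y \<and> y < x + e')"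
    using assms(2)
  proof eventually_elim
    case (elim y)
    show ?case using elim e(2)[of y] e' assms(3) by auto
  qed
  from emeasure_eq_0_AE[OF this] have "emeasure lborel {x<..<x + e'} = 0"
    by (simp add: greaterThanLessThan_def greaterThan_def lessThan_def Collect_conj_eq[symmetric])
  then show False using e' by simp
qed

text \<open>Near \<open>t\<close> the function \<open>\<alpha>\<close> equals a constant plus the
  primitive of \<open>\<beta>\<close>, first almost everywhere and then everywhere by continuity; a
  primitive is differentiable wherever its integrand is continuous.\<close>

lemma weak_deriv_continuous:
  assumes cont: "\<And>t. t > 0 \<Longrightarrow> isCont \<alpha> t" "\<And>t. t > 0 \<Longrightarrow> isCont \<beta> t"
    and weak: "\<And>\<theta>. test_function_on {0<..} \<theta> \<Longrightarrow> (LBINT t:{0<..}. \<alpha> t * deriv \<theta> t) = - (LBINT t:{0<..}. \<beta> t * \<theta> t)"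
    and "t > 0"
  shows "(\<alpha> has_real_derivative \<beta> t) (at t)"
proof -
  \<comment> \<open>A compact window of positive times around \<open>t\<close>: both functions are
    square integrable on it after truncation.\<close>
  define a b where "a = t / 2" and "b = t + 1"
  have ab: "0 < a" "a < t" "t < b" using \<open>t > 0\<close> by (auto simp: a_def b_def)
  have c: "continuous_on {a..b} \<alpha>" "continuous_on {a..b} \<beta>"
    using cont ab by (auto intro!: continuous_at_imp_continuous_on)
  let ?u = "\<lambda>s. indicator {a..b} s * \<alpha> s" and ?v = "\<lambda>s. indicator {a..b} s * \<beta> s"
  have L: "L2 ?u" "L2 ?v" by (intro L2_continuous_on_Icc c)+
  have "\<exists>c. AE s in lborel. a < s \<and> s < b \<longrightarrow> ?u s = c + prim ?v s"
  proof (rule weak_deriv_interval[OF _ L])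
    fix \<theta> assume \<theta>: "test_function_on {a<..<b} \<theta>"
    have z: "s \<notin> {a..b} \<Longrightarrow> \<theta> s = 0" "s \<notin> {a..b} \<Longrightarrow> deriv \<theta> s = 0" for s
      using test_function_onD(3)[OF \<theta>] closure_subset[of "{x. \<theta> x \<noteq> 0}"]
        test_function_onD(3)[OF test_function_on_deriv[OF \<theta>]] closure_subset[of "{x. deriv \<theta> x \<noteq> 0}"] by auto
    have 1: "indicator {0<..} s *\<^sub>R (\<alpha> s * deriv \<theta> s) = indicator {a..b} s * \<alpha> s * deriv \<theta> s" for s
      using ab z[of s] by (cases "s \<in> {a..b}") auto
    have 2: "indicator {0<..} s *\<^sub>R (\<beta> s * \<theta> s) = indicator {a..b} s * \<beta> s * \<theta> s" for s
      using ab z[of s] by (cases "s \<in> {a..b}") auto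
    have "test_function_on {0<..} \<theta>" using \<theta> ab by (rule_tac test_function_on_mono) auto
    from weak[OF this] show "ip ?u (deriv \<theta>) = - ip ?v \<theta>"
      unfolding set_lebesgue_integral_def 1 2 ip_def .
  qed (use ab in auto)
  then obtain k where k: "AE s in lborel. a < s \<and> s < b \<longrightarrow> ?u s = k + prim ?v s" ..
  have eq: "\<alpha> s = k + prim ?v s" if "a < s" "s < b" for s
  proof -
    have "continuous_on {a<..<b} (\<lambda>s. \<alpha> s - (k + prim ?v s))"
      by (intro continuous_intros continuous_on_subset[OF c(1)] continuous_on_subset[OF prim_continuous[OF L(2)]]) auto
    moreover have "AE s in lborel. a < s \<and> s < b \<longrightarrow> \<alpha> s - (k + prim ?v s) = 0"
      using k by eventually_elim auto
    ultimately show ?thesis using AE_zero_continuous[of a b "\<lambda>s. \<alpha> s - (k + prim ?v s)" s] that by simp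
  qed
  have ev: "\<forall>\<^sub>F s in nhds t. s \<in> {a<..<b}"
    using ab by (intro eventually_nhds_in_open) auto
  have "isCont ?v t"
    by (rule isCont_cong[THEN iffD2, OF _ cont(2)[OF \<open>t > 0\<close>]]) (use ev in \<open>eventually_elim, auto\<close>)
  from prim_has_derivative[OF L(2) this] have "((\<lambda>s. k + prim ?v s) has_real_derivative ?v t) (at t)"
    by (auto intro!: derivative_eq_intros)
  moreover have "?v t = \<beta> t" using ab by simp
  ultimately have "((\<lambda>s. k + prim ?v s) has_real_derivative \<beta> t) (at t)" by simp
  then show ?thesis
    by (rule DERIV_cong_ev[THEN iffD2, OF refl _ refl, rotated]) (use ev in \<open>eventually_elim, use eq in auto\<close>)
qed

text \<open>
  The equation \<open>\<partial>\<^sub>t A - \<sigma> \<partial>\<^sub>x A = a\<close>, tested against functions travelling along its characteristics.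
\<close>

definition transported :: "real \<Rightarrow> (real \<Rightarrow> real \<Rightarrow> real) \<Rightarrow> (real \<Rightarrow> real \<Rightarrow> real) \<Rightarrow> bool" where
  "transported \<sigma> A a \<longleftrightarrow> L2curve A \<and> L2curve a \<and> (\<forall>\<phi>. L2 \<phi> \<longrightarrow> (\<forall>t>0.
     ((\<lambda>t. ip (A t) (\<lambda>x. \<phi> (x + \<sigma> * t))) has_real_derivative ip (a t) (\<lambda>x. \<phi> (x + \<sigma> * t))) (at t)))"

lemma L2curve_bounded:
  assumes "L2curve a" "0 < r" 
  obtains B where "B > 0" "\<And>t. t \<in> {r..s} \<Longrightarrow> ip (a t) (a t) \<le> B"
proof -
  have "continuous_on {r..s} (\<lambda>t. ip (a t) (a t))"
  proof (rule continuous_at_imp_continuous_on, rule ballI)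
    fix t assume "t \<in> {r..s}"
    then have "L2lim a (a t) (at t)" using assms by (simp add: L2curve_def)
    from L2lim_ip[OF this this] show "isCont (\<lambda>t. ip (a t) (a t)) t" by (simp add: isCont_def)
  qed
  then have "bounded ((\<lambda>t. ip (a t) (a t)) ` {r..s})"
    by (intro compact_imp_bounded compact_continuous_image) auto
  then obtain B where "\<And>t. t \<in> {r..s} \<Longrightarrow> \<bar>ip (a t) (a t)\<bar> \<le> B" unfolding bounded_iff by fastforce
  then have "ip (a t) (a t) \<le> \<bar>B\<bar> + 1" if "t \<in> {r..s}" for t using that by fastforce
  then show ?thesis by (intro that[of "\<bar>B\<bar> + 1"]) auto
qed

text \<open>For a test function the weak equation gives a classical time derivative. For general
  \<open>\<phi>\<close> in \<open>L2\<close> one passes to the limit: on a compact window of times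
  the norm of \<open>a\<close> is bounded and travelling does not change the norm of the error, so
  the derivatives converge uniformly.\<close>

lemma transportedI:
  assumes A: "L2curve A" and a: "L2curve a"
    and weak: "\<And>\<phi> \<theta>. test_fun \<phi> \<Longrightarrow> test_function_on {0<..} \<theta> \<Longrightarrow>
      (LBINT t:{0<..}. ip (A t) (\<lambda>x. \<phi> (x + \<sigma> * t)) * deriv \<theta> t) = - (LBINT t:{0<..}. ip (a t) (\<lambda>x. \<phi> (x + \<sigma> * t)) * \<theta> t)"
  shows "transported \<sigma> A a"
  unfolding transported_def
proof (intro conjI allI impI A a)
  fix \<phi> and t :: real assume \<phi>: "L2 \<phi>" and t: "t > 0"
  define r s where "r = t / 2" and "s = t + 1"
  have rs: "0 < r" "r < t" "t < s" using t by (auto simp: r_def s_def)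
  obtain q where q: "\<And>n. test_fun (q n)" "(\<lambda>n. ip (\<lambda>x. q n x - \<phi> x) (\<lambda>x. q n x - \<phi> x)) \<longlonglongrightarrow> 0"
    by (rule L2_approx_sequence[OF \<phi>]) (rule that)
  have qL: "L2 (q n)" for n by (rule test_fun_L2[OF q(1)])
  have qlim: "L2lim q \<phi> sequentially" using q(2) qL \<phi> by (simp add: L2lim_def sqd_def)
  have qshift: "L2lim (\<lambda>n x. q n (x + h)) (\<lambda>x. \<phi> (x + h)) sequentially" for h
    using qlim by (simp add: L2lim_def L2_shift sqd_shift qL)
  have d: "((\<lambda>t. ip (A t) (\<lambda>x. q n (x + \<sigma> * t))) has_real_derivative ip (a t) (\<lambda>x. q n (x + \<sigma> * t))) (at t)" if "t > 0" for n t
    by (rule weak_deriv_continuous[OF ip_shift_curve_isCont[OF A qL] ip_shift_curve_isCont[OF a qL] weak[OF q(1)] that])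
  obtain B where B: "B > 0" "\<And>t. t \<in> {r..s} \<Longrightarrow> ip (a t) (a t) \<le> B"
    by (rule L2curve_bounded[OF a rs(1)]) (rule that)
  have "\<exists>g. \<forall>x\<in>{r<..<s}. (\<lambda>n. ip (A x) (\<lambda>y. q n (y + \<sigma> * x))) \<longlonglongrightarrow> g x \<and>
      (g has_derivative (*) (ip (a x) (\<lambda>y. \<phi> (y + \<sigma> * x)))) (at x within {r<..<s})"
  proof (rule has_derivative_sequence)
    show "convex {r<..<s}" by simp
    show "((\<lambda>t. ip (A t) (\<lambda>x. q n (x + \<sigma> * t))) has_derivative (*) (ip (a x) (\<lambda>y. q n (y + \<sigma> * x)))) (at x within {r<..<s})"
      if "x \<in> {r<..<s}" for n x
      using d[of x n] that rs by (auto simp: has_field_derivative_def intro: has_derivative_at_withinI)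
    show "t \<in> {r<..<s}" using rs by simp
    show "(\<lambda>n. ip (A t) (\<lambda>y. q n (y + \<sigma> * t))) \<longlonglongrightarrow> ip (A t) (\<lambda>y. \<phi> (y + \<sigma> * t))"
      using A t by (intro L2lim_ip L2lim_const qshift) (simp add: L2curve_def L2lim_def)
    fix e :: real assume e: "e > 0"
    have "(\<lambda>n. sqrt B * sqrt (sqd (q n) \<phi>)) \<longlonglongrightarrow> sqrt B * sqrt 0"
      by (intro tendsto_intros L2limD(3)[OF qlim])
    then have "\<forall>\<^sub>F n in sequentially. sqrt B * sqrt (sqd (q n) \<phi>) < e"
      using e by (intro order_tendstoD(2)) auto
    then show "\<forall>\<^sub>F n in sequentially. \<forall>x\<in>{r<..<s}. \<forall>h. norm (ip (a x) (\<lambda>y. q n (y + \<sigma> * x)) * h - ip (a x) (\<lambda>y. \<phi> (y + \<sigma> * x)) * h) \<le> e * norm h"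
    proof eventually_elim
      case (elim n)
      show ?case
      proof (intro ballI allI)
        fix x h assume x: "x \<in> {r<..<s}"
        then have ax: "L2 (a x)" using a rs by (simp add: L2curve_def L2lim_def)
        have 1: "ip (a x) (\<lambda>y. q n (y + \<sigma> * x)) - ip (a x) (\<lambda>y. \<phi> (y + \<sigma> * x)) = ip (a x) (\<lambda>y. q n (y + \<sigma> * x) - \<phi> (y + \<sigma> * x))"
          by (simp add: ip_diff_right L2_shift qL \<phi> ax)
        have 2: "\<bar>ip (a x) (\<lambda>y. q n (y + \<sigma> * x) - \<phi> (y + \<sigma> * x))\<bar> \<le> sqrt (ip (a x) (a x)) * sqrt (sqd (\<lambda>y. q n (y + \<sigma> * x)) (\<lambda>y. \<phi> (y + \<sigma> * x)))"
          unfolding sqd_def by (intro ip_Cauchy_Schwarz ax L2_diff L2_shift qL \<phi>)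
        have 3: "sqrt (ip (a x) (a x)) * sqrt (sqd (q n) \<phi>) \<le> sqrt B * sqrt (sqd (q n) \<phi>)"
        proof (rule mult_right_mono)
          show "sqrt (ip (a x) (a x)) \<le> sqrt B" using B(2)[of x] x by simp
        qed (simp add: sqd_nonneg)
        have "\<bar>ip (a x) (\<lambda>y. q n (y + \<sigma> * x)) - ip (a x) (\<lambda>y. \<phi> (y + \<sigma> * x))\<bar> \<le> e"
          using 2 3 elim unfolding 1 sqd_shift[of "q n" "\<sigma> * x" \<phi>] by linarith
        from mult_right_mono[OF this abs_ge_zero[of h]]
        have "\<bar>ip (a x) (\<lambda>y. q n (y + \<sigma> * x)) - ip (a x) (\<lambda>y. \<phi> (y + \<sigma> * x))\<bar> * \<bar>h\<bar> \<le> e * \<bar>h\<bar>" .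
        then show "norm (ip (a x) (\<lambda>y. q n (y + \<sigma> * x)) * h - ip (a x) (\<lambda>y. \<phi> (y + \<sigma> * x)) * h) \<le> e * norm h"
          by (simp add: left_diff_distrib[symmetric] abs_mult)
      qed
    qed
  qed
  then obtain g where "\<forall>x\<in>{r<..<s}. (\<lambda>n. ip (A x) (\<lambda>y. q n (y + \<sigma> * x))) \<longlonglongrightarrow> g x \<and>
      (g has_derivative (*) (ip (a x) (\<lambda>y. \<phi> (y + \<sigma> * x)))) (at x within {r<..<s})" ..
  then have g: "\<And>x. x \<in> {r<..<s} \<Longrightarrow> (\<lambda>n. ip (A x) (\<lambda>y. q n (y + \<sigma> * x))) \<longlonglongrightarrow> g x"
      "\<And>x. x \<in> {r<..<s} \<Longrightarrow> (g has_derivative (*) (ip (a x) (\<lambda>y. \<phi> (y + \<sigma> * x)))) (at x within {r<..<s})"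
    by simp_all
  have gt: "(g has_real_derivative ip (a t) (\<lambda>x. \<phi> (x + \<sigma> * t))) (at t)"
    using g(2)[of t] rs by (simp add: has_field_derivative_def at_within_open[of t "{r<..<s}"])
  have geq: "g x = ip (A x) (\<lambda>y. \<phi> (y + \<sigma> * x))" if "x \<in> {r<..<s}" for x
  proof (rule LIMSEQ_unique[OF g(1)[OF that]])
    show "(\<lambda>n. ip (A x) (\<lambda>y. q n (y + \<sigma> * x))) \<longlonglongrightarrow> ip (A x) (\<lambda>y. \<phi> (y + \<sigma> * x))"
      using A that rs by (intro L2lim_ip L2lim_const qshift) (simp add: L2curve_def L2lim_def)
  qed
  have ev: "\<forall>\<^sub>F x in nhds t. x \<in> {r<..<s}"
    using rs by (intro eventually_nhds_in_open) auto
  show "((\<lambda>t. ip (A t) (\<lambda>x. \<phi> (x + \<sigma> * t))) has_real_derivative ip (a t) (\<lambda>x. \<phi> (x + \<sigma> * t))) (at t)"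
    using gt by (rule DERIV_cong_ev[THEN iffD2, OF refl _ refl, rotated]) (use ev in \<open>eventually_elim, use geq in auto\<close>)
qed

text \<open>One formulation for both signs of \<open>h\<close>, as two-sided difference quotients
  require.\<close>

lemma mean_value_symmetric:
  fixes \<alpha> \<beta> :: "real \<Rightarrow> real"
  assumes "h \<noteq> 0" "\<And>t. \<bar>t - t0\<bar> \<le> \<bar>h\<bar> \<Longrightarrow> (\<alpha> has_real_derivative \<beta> t) (at t)"
  shows "\<exists>\<xi>. \<bar>\<xi> - t0\<bar> \<le> \<bar>h\<bar> \<and> \<alpha> (t0 + h) - \<alpha> t0 = h * \<beta> \<xi>"
proof (cases "h > 0")
  case True
  then obtain z where "t0 < z" "z < t0 + h" "\<alpha> (t0 + h) - \<alpha> t0 = (t0 + h - t0) * \<beta> z"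
    using MVT2[of t0 "t0 + h" \<alpha> \<beta>] assms(2) by auto
  then show ?thesis by (intro exI[of _ z]) auto
next
  case False
  then have "t0 + h < t0" using assms(1) by simp
  then obtain z where z: "t0 + h < z" "z < t0" "\<alpha> t0 - \<alpha> (t0 + h) = (t0 - (t0 + h)) * \<beta> z"
    using MVT2[of "t0 + h" t0 \<alpha> \<beta>] assms(2) by auto
  then show ?thesis by (intro exI[of _ z]) (auto simp: algebra_simps)
qed

text \<open>
  The increment of the bilinear form is split by moving first \<open>A\<close> and then \<open>B\<close> along the
  characteristics. Each of these two increments pairs one curve with a fixed function, so the mean
  value theorem evaluates it at intermediate times \<open>\<xi> h\<close> and \<open>\<zeta> h\<close>; what remains is the
  difference quotient of the weight.
\<close>

theorem transported_bilinear_derivative: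
  assumes A: "transported \<sigma> A a" and B: "transported \<sigma> B b" and t: "t > 0"
    and c: "c \<in> borel_measurable borel" "\<And>x. \<bar>c x\<bar> \<le> M" "\<And>x y. \<bar>c x - c y\<bar> \<le> M * \<bar>x - y\<bar>"
    and c': "\<And>x. x \<noteq> 0 \<Longrightarrow> (c has_real_derivative c' x) (at x)" "c' \<in> borel_measurable borel"
  shows "((\<lambda>t. ip (\<lambda>x. c x * A t x) (B t)) has_real_derivative
     - \<sigma> * ip (\<lambda>x. c' x * A t x) (B t) + ip (\<lambda>x. c x * a t x) (B t) + ip (\<lambda>x. c x * A t x) (b t)) (at t)"
proof -
  have curves: "L2curve A" "L2curve a" "L2curve B" "L2curve b" using A B by (auto simp: transported_def)
  have L: "L2 (A s)" "L2 (a s)" "L2 (B s)" "L2 (b s)" if "s > 0" for s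
    using curves that by (auto simp: L2curve_def L2lim_def)
  have cm: "L2 (\<lambda>x. c x * u x)" if "L2 u" for u by (rule L2_bounded_mult[OF that c(1,2)])
  have csm: "L2 (\<lambda>x. c (x + h) * u x)" if "L2 u" for u h
    by (rule L2_bounded_mult[OF that _ c(2)]) (use c(1) in measurable)
  \<comment> \<open>Each function is pulled back along the characteristics: at time
    \<open>t + h\<close>, \<open>\<phi> h\<close> has become the weight times
    \<open>B (t + h)\<close>, whereas \<open>\<psi> h\<close> at that time pairs with
    \<open>B (t + h)\<close> exactly as \<open>\<phi> h\<close> at time \<open>t\<close> pairs with
    \<open>A t\<close>.\<close>
  define \<phi> where "\<phi> h x = c (x - \<sigma> * (t + h)) * B (t + h) (x - \<sigma> * (t + h))" for h x
  define \<psi> where "\<psi> h x = A t (x - \<sigma> * t) * c (x - \<sigma> * (t + h))" for h x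
  have \<phi>L: "L2 (\<phi> h)" if "\<bar>h\<bar> < t" for h
    using L2_shift[OF cm[OF L(3)[of "t + h"]], of "- \<sigma> * (t + h)"] that by (simp add: \<phi>_def[abs_def] abs_less_iff)
  have \<psi>L: "L2 (\<psi> h)" for h
  proof -
    have "L2 (\<lambda>x. c (x + - \<sigma> * (t + h)) * A t (x + - \<sigma> * t))" by (intro csm L2_shift L t)
    then show ?thesis by (simp add: \<psi>_def[abs_def] mult.commute)
  qed
  \<comment> \<open>An arbitrary choice for each \<open>h\<close> is enough: only the distance of
    \<open>\<xi> h\<close> from \<open>t\<close> enters the limits.\<close>
  define \<xi> where "\<xi> h = (SOME \<xi>. \<bar>\<xi> - t\<bar> \<le> \<bar>h\<bar> \<and>
     ip (A (t + h)) (\<lambda>x. \<phi> h (x + \<sigma> * (t + h))) - ip (A t) (\<lambda>x. \<phi> h (x + \<sigma> * t)) = h * ip (a \<xi>) (\<lambda>x. \<phi> h (x + \<sigma> * \<xi>)))" for h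
  define \<zeta> where "\<zeta> h = (SOME \<xi>. \<bar>\<xi> - t\<bar> \<le> \<bar>h\<bar> \<and>
     ip (B (t + h)) (\<lambda>x. \<psi> h (x + \<sigma> * (t + h))) - ip (B t) (\<lambda>x. \<psi> h (x + \<sigma> * t)) = h * ip (b \<xi>) (\<lambda>x. \<psi> h (x + \<sigma> * \<xi>)))" for h
  have \<xi>: "\<bar>\<xi> h - t\<bar> \<le> \<bar>h\<bar> \<and>
     ip (A (t + h)) (\<lambda>x. \<phi> h (x + \<sigma> * (t + h))) - ip (A t) (\<lambda>x. \<phi> h (x + \<sigma> * t)) = h * ip (a (\<xi> h)) (\<lambda>x. \<phi> h (x + \<sigma> * \<xi> h))"
    if h: "h \<noteq> 0" "\<bar>h\<bar> < t" for h
    unfolding \<xi>_def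
  proof (rule someI_ex, rule mean_value_symmetric[OF h(1)])
    fix s assume "\<bar>s - t\<bar> \<le> \<bar>h\<bar>"
    with h have "s > 0" by linarith
    then show "((\<lambda>t. ip (A t) (\<lambda>x. \<phi> h (x + \<sigma> * t))) has_real_derivative ip (a s) (\<lambda>x. \<phi> h (x + \<sigma> * s))) (at s)"
      using A \<phi>L[OF h(2)] by (simp add: transported_def)
  qed
  have \<zeta>: "\<bar>\<zeta> h - t\<bar> \<le> \<bar>h\<bar> \<and>
     ip (B (t + h)) (\<lambda>x. \<psi> h (x + \<sigma> * (t + h))) - ip (B t) (\<lambda>x. \<psi> h (x + \<sigma> * t)) = h * ip (b (\<zeta> h)) (\<lambda>x. \<psi> h (x + \<sigma> * \<zeta> h))"
    if h: "h \<noteq> 0" "\<bar>h\<bar> < t" for h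
    unfolding \<zeta>_def
  proof (rule someI_ex, rule mean_value_symmetric[OF h(1)])
    fix s assume "\<bar>s - t\<bar> \<le> \<bar>h\<bar>"
    with h have "s > 0" by linarith
    then show "((\<lambda>t. ip (B t) (\<lambda>x. \<psi> h (x + \<sigma> * t))) has_real_derivative ip (b s) (\<lambda>x. \<psi> h (x + \<sigma> * s))) (at s)"
      using B \<psi>L by (simp add: transported_def)
  qed
  have ev: "\<forall>\<^sub>F h in at 0. h \<noteq> 0 \<and> \<bar>h\<bar> < t"
    using t by (auto simp: eventually_at dist_real_def intro!: exI[of _ t])
  have h0: "((\<lambda>h. \<bar>h\<bar>) \<longlongrightarrow> 0) (at (0::real))" using tendsto_rabs[OF tendsto_ident_at[of "0::real" UNIV]] by simp
  have "((\<lambda>h. \<xi> h - t) \<longlongrightarrow> 0) (at 0)"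
    by (rule Lim_null_comparison[OF _ h0]) (use ev in \<open>eventually_elim, use \<xi> in auto\<close>)
  then have \<xi>lim: "(\<xi> \<longlongrightarrow> t) (at 0)" by (simp add: Lim_null[symmetric])
  have "((\<lambda>h. \<zeta> h - t) \<longlongrightarrow> 0) (at 0)"
    by (rule Lim_null_comparison[OF _ h0]) (use ev in \<open>eventually_elim, use \<zeta> in auto\<close>)
  then have \<zeta>lim: "(\<zeta> \<longlongrightarrow> t) (at 0)" by (simp add: Lim_null[symmetric])
  have thlim: "((\<lambda>h. t + h) \<longlongrightarrow> t) (at 0)" using tendsto_add[OF tendsto_const tendsto_ident_at[of "0::real" UNIV], of t] by simp
  have lim1: "((\<lambda>h. ip (a (\<xi> h)) (\<lambda>x. \<phi> h (x + \<sigma> * \<xi> h))) \<longlongrightarrow> ip (a t) (\<lambda>x. c x * B t x)) (at 0)"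
  proof (rule L2lim_ip[OF L2lim_curve[OF curves(2) t \<xi>lim]])
    have "((\<lambda>h. \<sigma> * (\<xi> h - (t + h))) \<longlongrightarrow> \<sigma> * (t - t)) (at 0)" by (intro tendsto_intros \<xi>lim thlim)
    then have "L2lim (\<lambda>h x. (\<lambda>x. c x * B (t + h) x) (x + \<sigma> * (\<xi> h - (t + h)))) (\<lambda>x. c x * B t x) (at 0)"
      by (intro L2lim_shift L2lim_bounded_mult[OF _ c(1,2)] L2lim_curve[OF curves(3) t thlim]) simp
    moreover have "(\<lambda>x. \<phi> h (x + \<sigma> * \<xi> h)) = (\<lambda>x. (\<lambda>x. c x * B (t + h) x) (x + \<sigma> * (\<xi> h - (t + h))))" for h
      by (simp add: \<phi>_def algebra_simps)
    ultimately show "L2lim (\<lambda>h x. \<phi> h (x + \<sigma> * \<xi> h)) (\<lambda>x. c x * B t x) (at 0)" by simp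
  qed
  have lim2: "((\<lambda>h. ip (b (\<zeta> h)) (\<lambda>x. \<psi> h (x + \<sigma> * \<zeta> h))) \<longlongrightarrow> ip (b t) (\<lambda>x. c x * A t x)) (at 0)"
  proof (rule L2lim_ip[OF L2lim_curve[OF curves(4) t \<zeta>lim]])
    have "((\<lambda>h. \<sigma> * (\<zeta> h - (t + h))) \<longlongrightarrow> \<sigma> * (t - t)) (at 0)" by (intro tendsto_intros \<zeta>lim thlim)
    then have 1: "((\<lambda>h. \<sigma> * (\<zeta> h - (t + h))) \<longlongrightarrow> 0) (at 0)" by simp
    have "((\<lambda>h. \<sigma> * (\<zeta> h - t)) \<longlongrightarrow> \<sigma> * (t - t)) (at 0)" by (intro tendsto_intros \<zeta>lim)
    then have 2: "((\<lambda>h. \<sigma> * (\<zeta> h - t)) \<longlongrightarrow> 0) (at 0)" by simp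
    have "L2lim (\<lambda>h x. c (x + \<sigma> * (\<zeta> h - (t + h))) * A t (x + \<sigma> * (\<zeta> h - t))) (\<lambda>x. c x * A t x) (at 0)"
      by (rule L2lim_shift_mult[OF L2lim_shift_const[OF L(1)[OF t] 2] 1 c(2,3,1)])
    then show "L2lim (\<lambda>h x. \<psi> h (x + \<sigma> * \<zeta> h)) (\<lambda>x. c x * A t x) (at 0)"
      by (simp add: \<psi>_def algebra_simps)
  qed
  \<comment> \<open>The Lipschitz bound dominates the quotient of the weight by
    \<open>M * \<bar>\<sigma>\<bar>\<close>, and it converges for \<open>x \<noteq> 0\<close>; a
    kink of \<open>c\<close> at the origin is a null set.\<close>
  have lim3: "((\<lambda>h. \<integral>x. (c (x - \<sigma> * h) - c x) / h * (A t x * B t x) \<partial>lborel) \<longlongrightarrow> (\<integral>x. (- \<sigma> * c' x) * (A t x * B t x) \<partial>lborel)) (at 0)"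
    unfolding tendsto_at_iff_sequentially comp_def
  proof (intro allI impI)
    fix h :: "nat \<Rightarrow> real" assume hn: "\<forall>i. h i \<in> UNIV - {0}" and hl: "h \<longlonglongrightarrow> 0"
    have M0: "M \<ge> 0" using c(2)[of 0] by linarith
    have AB: "integrable lborel (\<lambda>x. A t x * B t x)" by (intro L2_integrable_mult L t)
    show "(\<lambda>n. \<integral>x. (c (x - \<sigma> * h n) - c x) / h n * (A t x * B t x) \<partial>lborel) \<longlonglongrightarrow> (\<integral>x. (- \<sigma> * c' x) * (A t x * B t x) \<partial>lborel)"
    proof (rule integral_dominated_convergence[where w="\<lambda>x. M * \<bar>\<sigma>\<bar> * \<bar>A t x * B t x\<bar>"])
      show "AE x in lborel. norm ((c (x - \<sigma> * h n) - c x) / h n * (A t x * B t x)) \<le> M * \<bar>\<sigma>\<bar> * \<bar>A t x * B t x\<bar>" for n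
      proof (rule AE_I2)
        fix x
        have "\<bar>c (x - \<sigma> * h n) - c x\<bar> \<le> M * \<bar>\<sigma>\<bar> * \<bar>h n\<bar>" using c(3)[of "x - \<sigma> * h n" x] by (simp add: abs_mult)
        then have "\<bar>(c (x - \<sigma> * h n) - c x) / h n\<bar> \<le> M * \<bar>\<sigma>\<bar>" using hn by (simp add: abs_divide divide_le_eq)
        then show "norm ((c (x - \<sigma> * h n) - c x) / h n * (A t x * B t x)) \<le> M * \<bar>\<sigma>\<bar> * \<bar>A t x * B t x\<bar>"
          unfolding real_norm_def abs_mult[of "_ / _"] by (rule mult_right_mono) simp
      qed
      show "AE x in lborel. (\<lambda>n. (c (x - \<sigma> * h n) - c x) / h n * (A t x * B t x)) \<longlonglongrightarrow> - \<sigma> * c' x * (A t x * B t x)"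
        using AE_lborel_singleton[of "0::real"]
      proof eventually_elim
        case (elim x)
        have "((\<lambda>h. c (x - \<sigma> * h)) has_real_derivative c' x * (- \<sigma>)) (at 0)"
          by (rule DERIV_chain2[where g="\<lambda>h. x - \<sigma> * h"]) (use c'(1)[OF elim] in \<open>auto intro!: derivative_eq_intros\<close>)
        then have "((\<lambda>h. (c (x - \<sigma> * h) - c x) / h) \<longlongrightarrow> c' x * (- \<sigma>)) (at 0)"
          by (simp add: DERIV_def)
        then have "(\<lambda>n. (c (x - \<sigma> * h n) - c x) / h n) \<longlonglongrightarrow> c' x * (- \<sigma>)"
          using hn hl unfolding tendsto_at_iff_sequentially comp_def by blast
        from tendsto_mult[OF this tendsto_const[of "A t x * B t x"]] show ?case by (simp add: mult_ac)
      qed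
    qed (use AB c(1) c'(2) L2_measurable[OF L(1)[OF t]] L2_measurable[OF L(3)[OF t]] in \<open>simp_all, measurable?\<close>)
  qed
  have Q: "(ip (\<lambda>x. c x * A (t + h) x) (B (t + h)) - ip (\<lambda>x. c x * A t x) (B t)) / h =
     ip (a (\<xi> h)) (\<lambda>x. \<phi> h (x + \<sigma> * \<xi> h)) + ip (b (\<zeta> h)) (\<lambda>x. \<psi> h (x + \<sigma> * \<zeta> h))
      + (\<integral>x. (c (x - \<sigma> * h) - c x) / h * (A t x * B t x) \<partial>lborel)" if h: "h \<noteq> 0" "\<bar>h\<bar> < t" for h
  proof -
    have 1: "ip (A (t + h)) (\<lambda>x. \<phi> h (x + \<sigma> * (t + h))) = ip (\<lambda>x. c x * A (t + h) x) (B (t + h))"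
      by (simp add: \<phi>_def ip_def mult_ac)
    \<comment> \<open>Translation by \<open>\<sigma> * h\<close> makes the end of one increment the
      beginning of the other, so the sum telescopes.\<close>
    have 2: "ip (A t) (\<lambda>x. \<phi> h (x + \<sigma> * t)) = ip (B (t + h)) (\<lambda>x. \<psi> h (x + \<sigma> * (t + h)))"
    proof -
      have "ip (B (t + h)) (\<lambda>x. \<psi> h (x + \<sigma> * (t + h))) = (\<integral>x. A t (x + \<sigma> * h) * (c x * B (t + h) x) \<partial>lborel)"
        unfolding ip_def \<psi>_def by (simp add: algebra_simps)
      also have "\<dots> = (\<integral>x. A t (x + - \<sigma> * h + \<sigma> * h) * (c (x + - \<sigma> * h) * B (t + h) (x + - \<sigma> * h)) \<partial>lborel)"
        by (rule integral_shift[symmetric])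
      also have "\<dots> = ip (A t) (\<lambda>x. \<phi> h (x + \<sigma> * t))"
        unfolding ip_def \<phi>_def by (simp add: algebra_simps)
      finally show ?thesis by simp
    qed
    have 3: "ip (B t) (\<lambda>x. \<psi> h (x + \<sigma> * t)) = (\<integral>x. c (x - \<sigma> * h) * A t x * B t x \<partial>lborel)"
      unfolding ip_def \<psi>_def by (simp add: algebra_simps)
    have i: "integrable lborel (\<lambda>x. c (x - \<sigma> * h) * A t x * B t x)" "integrable lborel (\<lambda>x. c x * A t x * B t x)"
      using L2_integrable_mult[OF csm[OF L(1)[OF t], of "- \<sigma> * h"] L(3)[OF t]] L2_integrable_mult[OF cm[OF L(1)[OF t]] L(3)[OF t]] by simp_all
    have 4: "(\<integral>x. c (x - \<sigma> * h) * A t x * B t x \<partial>lborel) - ip (\<lambda>x. c x * A t x) (B t) = h * (\<integral>x. (c (x - \<sigma> * h) - c x) / h * (A t x * B t x) \<partial>lborel)"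
      unfolding ip_def Bochner_Integration.integral_diff[OF i, symmetric] integral_mult_right_zero[symmetric]
      using h by (intro Bochner_Integration.integral_cong) (simp_all add: field_simps)
    show ?thesis using \<xi>[OF h] \<zeta>[OF h] 1 2 3 4 h by (simp add: field_simps)
  qed
  have "((\<lambda>h. (ip (\<lambda>x. c x * A (t + h) x) (B (t + h)) - ip (\<lambda>x. c x * A t x) (B t)) / h) \<longlongrightarrow>
     ip (a t) (\<lambda>x. c x * B t x) + ip (b t) (\<lambda>x. c x * A t x) + (\<integral>x. (- \<sigma> * c' x) * (A t x * B t x) \<partial>lborel)) (at 0)"
    using tendsto_add[OF tendsto_add[OF lim1 lim2] lim3]
    by (rule Lim_transform_eventually) (use ev in \<open>eventually_elim, simp add: Q\<close>)
  moreover have "(\<integral>x. (- \<sigma> * c' x) * (A t x * B t x) \<partial>lborel) = - \<sigma> * ip (\<lambda>x. c' x * A t x) (B t)"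
    unfolding ip_def integral_mult_right_zero[symmetric] by (simp add: mult_ac)
  moreover have "ip (a t) (\<lambda>x. c x * B t x) = ip (\<lambda>x. c x * a t x) (B t)"
    by (simp add: ip_def mult_ac)
  moreover have "ip (b t) (\<lambda>x. c x * A t x) = ip (\<lambda>x. c x * A t x) (b t)"
    by (rule ip_commute)
  ultimately show ?thesis unfolding DERIV_def by (simp only: ac_simps)
qed


section \<open>The system as a pair of transport equations\<close>

lemma L2_norm_on_UNIV: "L2_norm_on UNIV u = sqrt (ip u u)"
  by (simp add: L2_norm_on_def ip_self_eq set_lebesgue_integral_def)

lemma weak_derivative_on_UNIV: "weak_derivative_on UNIV u v \<longleftrightarrow> (\<forall>\<phi>. test_fun \<phi> \<longrightarrow> ip u (deriv \<phi>) = - ip v \<phi>)"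
  by (simp add: weak_derivative_on_def ip_def set_lebesgue_integral_def)

lemma weak_deriv_UNIV_props:
  assumes "H1_on UNIV u"
  shows "L2 u" "L2 (weak_deriv UNIV u)" "weak_derivative_on UNIV u (weak_deriv UNIV u)"
proof -
  have "\<exists>v. L2_on UNIV v \<and> weak_derivative_on UNIV u v" using assms by (simp add: H1_on_def)
  then have "L2_on UNIV (weak_deriv UNIV u) \<and> weak_derivative_on UNIV u (weak_deriv UNIV u)"
    unfolding weak_deriv_def by (rule someI_ex)
  then show "L2 (weak_deriv UNIV u)" "weak_derivative_on UNIV u (weak_deriv UNIV u)" by (simp_all add: L2_on_UNIV_iff)
  show "L2 u" using assms by (simp add: H1_on_def L2_on_UNIV_iff)
qed

text \<open>Needed because \<open>weak_deriv\<close> is a choice made separately for each function,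
  so that linear relations between such choices hold only almost everywhere.\<close>

lemma weak_derivative_on_UNIV_unique:
  assumes "L2 v" "L2 w" "weak_derivative_on UNIV u v" "weak_derivative_on UNIV u w"
  shows "AE x in lborel. v x = w x"
proof -
  have "AE x in lborel. v x - w x = 0"
    by (rule L2_zero_if_test_zero[OF L2_diff[OF assms(1,2)]])
      (use assms in \<open>simp add: weak_derivative_on_UNIV ip_diff_left test_fun_L2\<close>)
  then show ?thesis by eventually_elim simp
qed

lemma H1L2_norm_on_UNIV_square:
  "(H1L2_norm_on UNIV u v)\<^sup>2 = ip u u + ip (weak_deriv UNIV u) (weak_deriv UNIV u) + ip v v"
  by (simp add: H1L2_norm_on_def H1_norm_on_def L2_norm_on_UNIV ip_nonneg add_nonneg_nonneg)

lemma weak_derivative_on_UNIV_diff: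
  assumes "weak_derivative_on UNIV u v" "weak_derivative_on UNIV u' v'" "L2 u" "L2 u'" "L2 v" "L2 v'"
  shows "weak_derivative_on UNIV (\<lambda>x. u x - u' x) (\<lambda>x. v x - v' x)"
  unfolding weak_derivative_on_UNIV
proof (intro allI impI)
  fix \<phi> assume \<phi>: "test_fun \<phi>"
  note L = test_fun_L2[OF \<phi>] test_fun_L2[OF test_function_on_deriv[OF \<phi>]]
  show "ip (\<lambda>x. u x - u' x) (deriv \<phi>) = - ip (\<lambda>x. v x - v' x) \<phi>"
    using assms(1,2) \<phi>
    by (simp add: weak_derivative_on_UNIV ip_diff_left[OF assms(3,4) L(2)] ip_diff_left[OF assms(5,6) L(1)])
qed

lemma ip_cong_AE:
  assumes "AE x in lborel. u x = u' x" "L2 u" "L2 u'" "L2 v"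
  shows "ip u v = ip u' v"
  unfolding ip_def
proof (rule integral_cong_AE)
  show "AE x in lborel. u x * v x = u' x * v x" using assms(1) by eventually_elim simp
qed (use L2_measurable[OF assms(2)] L2_measurable[OF assms(3)] L2_measurable[OF assms(4)] in measurable)

lemma AE_lborel_uminus:
  assumes "AE x in lborel. P (x::real)"
  shows "AE x in lborel. P (- x)"
proof -
  obtain N where N: "N \<in> null_sets lborel" "{x. \<not> P x} \<subseteq> N"
    using assms by (auto simp: eventually_ae_filter)
  have "AE x in lborel. x \<notin> N" using N(1) by (rule AE_not_in)
  then have "AE x in distr lborel borel uminus. x \<notin> N" by (simp only: lborel_distr_uminus)
  then have "AE x in lborel. - x \<notin> N"
    using N(1) by (subst (asm) AE_distr_iff) (auto simp: null_sets_def)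
  then show ?thesis by eventually_elim (use N(2) in blast)
qed

lemma test_Ioi_obtain:
  fixes \<theta> :: "real \<Rightarrow> real"
  assumes "test_function_on {0<..} \<theta>"
  obtains a b where "0 < a" "a \<le> b" "\<And>t. \<theta> t \<noteq> 0 \<Longrightarrow> t \<in> {a..b}"
proof (cases "closure {x. \<theta> x \<noteq> 0} = {}")
  case True
  then have "\<theta> t = 0" for t by auto
  then show ?thesis by (intro that[of 1 1]) auto
next
  case False
  note K = test_function_onD[OF assms]
  obtain l where l: "l \<in> closure {x. \<theta> x \<noteq> 0}" "\<And>x. x \<in> closure {x. \<theta> x \<noteq> 0} \<Longrightarrow> l \<le> x"
    using compact_attains_inf[OF K(2) False] by blast
  obtain r where r: "r \<in> closure {x. \<theta> x \<noteq> 0}" "\<And>x. x \<in> closure {x. \<theta> x \<noteq> 0} \<Longrightarrow> x \<le> r"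
    using compact_attains_sup[OF K(2) False] by blast
  show ?thesis
  proof (rule that[of l r])
    show "0 < l" "l \<le> r" using K(3) l r by auto
    fix t assume "\<theta> t \<noteq> 0"
    then have "t \<in> closure {x. \<theta> x \<noteq> 0}" using closure_subset[of "{x. \<theta> x \<noteq> 0}"] by auto
    then show "t \<in> {l..r}" using l r by auto
  qed
qed

lemma set_integrable_times_test:
  fixes \<alpha> \<theta> :: "real \<Rightarrow> real"
  assumes "\<And>t. t > 0 \<Longrightarrow> isCont \<alpha> t" "test_function_on {0<..} \<theta>"
  shows "set_integrable lborel {0<..} (\<lambda>t. \<alpha> t * \<theta> t)"
proof -
  obtain a b where ab: "0 < a" "a \<le> b" "\<And>t. \<theta> t \<noteq> 0 \<Longrightarrow> t \<in> {a..b}"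
    using test_Ioi_obtain[OF assms(2)] by blast
  have "continuous_on {a..b} \<alpha>"
    using assms(1) ab(1) by (intro continuous_at_imp_continuous_on) auto
  then have "integrable lborel (\<lambda>t. indicator {a..b} t * \<alpha> t * \<theta> t)"
    by (rule L2_integrable_mult[OF L2_continuous_on_Icc test_fun_L2[OF test_function_on_mono[OF assms(2)]]]) simp
  moreover have "indicator {a..b} t * \<alpha> t * \<theta> t = indicator {0<..} t *\<^sub>R (\<alpha> t * \<theta> t)" for t
    using ab(1) ab(3)[of t] by (cases "\<theta> t = 0") (auto simp: indicator_def)
  ultimately show ?thesis by (simp add: set_integrable_def)
qed

lemma test_fun_shift:
  assumes "test_fun \<phi>"
  shows "test_fun (\<lambda>x. \<phi> (x + h))" "deriv (\<lambda>x. \<phi> (x + h)) = (\<lambda>x. deriv \<phi> (x + h))"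
proof -
  obtain K where K: "K > 0" "\<And>x. \<phi> x \<noteq> 0 \<Longrightarrow> \<bar>x\<bar> < K" using test_fun_obtain[OF assms] by blast
  show "test_fun (\<lambda>x. \<phi> (x + h))"
  proof (rule test_function_onI[of _ "{-K-\<bar>h\<bar>..K+\<bar>h\<bar>}"])
    show "Ck k (\<lambda>x. \<phi> (x + h))" for k
      using Ck_affine[OF bounded_linear_ident test_function_onD(1)[OF assms]] .
    fix x assume "\<phi> (x + h) \<noteq> 0"
    from K(2)[OF this] show "x \<in> {-K-\<bar>h\<bar>..K+\<bar>h\<bar>}" by auto
  qed auto
  show "deriv (\<lambda>x. \<phi> (x + h)) = (\<lambda>x. deriv \<phi> (x + h))"
  proof
    fix x
    have "((\<lambda>x. \<phi> (x + h)) has_real_derivative deriv \<phi> (x + h) * 1) (at x)"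
      by (rule DERIV_chain2[OF test_function_has_deriv[OF assms]]) (auto intro!: derivative_eq_intros)
    then show "deriv (\<lambda>x. \<phi> (x + h)) x = deriv \<phi> (x + h)" by (simp add: DERIV_imp_deriv)
  qed
qed

text \<open>A profile carried along the characteristics and cut off in time. Its support lies in the
  sheared image of a rectangle at positive times, hence is compact and admissible in the
  distributional equation.\<close>

lemma test_function_travelling:
  assumes \<phi>: "test_fun \<phi>" and \<theta>: "test_function_on {0<..} \<theta>"
  shows "test_function_on ({0<..} \<times> UNIV) (\<lambda>z. \<theta> (fst z) * \<phi> (snd z + \<sigma> * fst z))"
    and "deriv (\<lambda>s. \<theta> s * \<phi> (x + \<sigma> * s)) t = deriv \<theta> t * \<phi> (x + \<sigma> * t) + \<sigma> * (\<theta> t * deriv \<phi> (x + \<sigma> * t))"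
    and "(deriv ^^ 2) (\<lambda>y. \<theta> t * \<phi> (y + \<sigma> * t)) x = \<theta> t * deriv (deriv \<phi>) (x + \<sigma> * t)"
proof -
  obtain K where K: "K > 0" "\<And>x. \<phi> x \<noteq> 0 \<Longrightarrow> \<bar>x\<bar> < K" using test_fun_obtain[OF \<phi>] by blast
  obtain a b where ab: "0 < a" "a \<le> b" "\<And>t. \<theta> t \<noteq> 0 \<Longrightarrow> t \<in> {a..b}"
    using test_Ioi_obtain[OF \<theta>] by blast
  show "test_function_on ({0<..} \<times> UNIV) (\<lambda>z. \<theta> (fst z) * \<phi> (snd z + \<sigma> * fst z))"
  proof (rule test_function_onI[of _ "(\<lambda>z. (fst z, snd z - \<sigma> * fst z)) ` ({a..b} \<times> {-K..K})"])
    have "Ck k (\<lambda>z. \<theta> (fst z + 0) * \<phi> ((snd z + \<sigma> * fst z) + 0))" for k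
    proof (intro Ck_mult)
      show "Ck k (\<lambda>z. \<theta> (fst z + 0))"
        by (rule Ck_affine[OF bounded_linear_fst test_function_onD(1)[OF \<theta>]])
      have "bounded_linear (\<lambda>z. snd z + \<sigma> * fst z :: real)"
        by (intro bounded_linear_add bounded_linear_snd bounded_linear_const_mult bounded_linear_fst)
      then show "Ck k (\<lambda>z. \<phi> ((snd z + \<sigma> * fst z) + 0))"
        by (rule Ck_affine[OF _ test_function_onD(1)[OF \<phi>]])
    qed
    then show "Ck k (\<lambda>z. \<theta> (fst z) * \<phi> (snd z + \<sigma> * fst z))" for k by simp
    show "compact ((\<lambda>z. (fst z, snd z - \<sigma> * fst z)) ` ({a..b} \<times> {-K..K}))"
      by (intro compact_continuous_image compact_Times continuous_intros) auto
    show "(\<lambda>z. (fst z, snd z - \<sigma> * fst z)) ` ({a..b} \<times> {-K..K}) \<subseteq> {0<..} \<times> UNIV" using ab by auto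
    fix z assume nz: "\<theta> (fst z) * \<phi> (snd z + \<sigma> * fst z) \<noteq> 0"
    then have "fst z \<in> {a..b}" "\<bar>snd z + \<sigma> * fst z\<bar> < K" using ab(3)[of "fst z"] K(2)[of "snd z + \<sigma> * fst z"] by auto
    then show "z \<in> (\<lambda>z. (fst z, snd z - \<sigma> * fst z)) ` ({a..b} \<times> {-K..K})"
      by (intro image_eqI[of _ _ "(fst z, snd z + \<sigma> * fst z)"]) (auto simp: prod_eq_iff)
  qed
  have "((\<lambda>s. \<phi> (x + \<sigma> * s)) has_real_derivative deriv \<phi> (x + \<sigma> * t) * \<sigma>) (at t)"
    by (rule DERIV_chain2[OF test_function_has_deriv[OF \<phi>]]) (auto intro!: derivative_eq_intros)
  from DERIV_mult[OF test_function_has_deriv[OF \<theta>] this]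
  show "deriv (\<lambda>s. \<theta> s * \<phi> (x + \<sigma> * s)) t = deriv \<theta> t * \<phi> (x + \<sigma> * t) + \<sigma> * (\<theta> t * deriv \<phi> (x + \<sigma> * t))"
    by (intro DERIV_imp_deriv) (simp add: mult_ac)
  have 1: "deriv (\<lambda>y. \<theta> t * \<phi> (y + \<sigma> * t)) = (\<lambda>y. \<theta> t * deriv \<phi> (y + \<sigma> * t))" if "test_fun \<phi>" for \<phi>
  proof
    fix y
    have "((\<lambda>y. \<phi> (y + \<sigma> * t)) has_real_derivative deriv \<phi> (y + \<sigma> * t)) (at y)"
      using test_function_has_deriv[OF test_fun_shift(1)[OF that], of "\<sigma> * t" y] by (simp add: test_fun_shift(2)[OF that])
    then show "deriv (\<lambda>y. \<theta> t * \<phi> (y + \<sigma> * t)) y = \<theta> t * deriv \<phi> (y + \<sigma> * t)"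
      by (intro DERIV_imp_deriv DERIV_cmult)
  qed
  show "(deriv ^^ 2) (\<lambda>y. \<theta> t * \<phi> (y + \<sigma> * t)) x = \<theta> t * deriv (deriv \<phi>) (x + \<sigma> * t)"
    by (simp add: numeral_2_eq_2 1[OF \<phi>] 1[OF test_function_on_deriv[OF \<phi>]])
qed

text \<open>With \<open>\<delta> < 1\<close> the Sobolev bound keeps all values of the solution in
  the interval where \<open>f\<close> is Lipschitz, so that \<open>f\<close> acts as a Lipschitz map
  on \<open>L2\<close>.\<close>

locale small_odd_solution =
  fixes m C \<delta> :: real and f :: "real \<Rightarrow> real" and u1 u2 :: "real \<Rightarrow> real \<Rightarrow> real"
  assumes f_cont: "continuous_on UNIV f" and f_0: "f 0 = 0"
    and f_lip: "\<And>a b. \<bar>a\<bar> < 1 \<Longrightarrow> \<bar>b\<bar> < 1 \<Longrightarrow> \<bar>f a - f b\<bar> \<le> C * \<bar>a - b\<bar>" and C: "C > 0"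
    and sol: "global_solution m f u1 u2" and odd: "odd_in_space u1"
    and \<delta>: "\<delta> < 1" and small: "\<And>t. t \<ge> 0 \<Longrightarrow> H1L2_norm_on UNIV (u1 t) (u2 t) < \<delta>"
begin

definition p :: "real \<Rightarrow> real \<Rightarrow> real" where
  "p t = weak_deriv UNIV (u1 t)"

text \<open>The continuous representative of \<open>u1 t\<close>. That a primitive vanishing at the
  origin represents it without an additive constant is a consequence of oddness.\<close>

definition u :: "real \<Rightarrow> real \<Rightarrow> real" where
  "u t = prim (p t)"

definition g :: "real \<Rightarrow> real \<Rightarrow> real" where
  "g t x = m * u t x + f (u t x)"

lemma regularity:
  assumes "t \<ge> 0"
  shows "H1_on UNIV (u1 t)" "L2 (u1 t)" "L2 (u2 t)" "L2 (p t)" "weak_derivative_on UNIV (u1 t) (p t)"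
  using sol assms weak_deriv_UNIV_props[of "u1 t"]
  by (auto simp: global_solution_def continuous_H1L2_def L2_on_UNIV_iff p_def)

lemma u_continuous: "t \<ge> 0 \<Longrightarrow> continuous_on UNIV (u t)"
  unfolding u_def by (intro prim_continuous regularity)

text \<open>A representative \<open>c + u t\<close> that is odd almost everywhere satisfies
  \<open>2 * c + u t x + u t (- x) = 0\<close> almost everywhere, hence everywhere by continuity; at
  \<open>x = 0\<close> this says \<open>c = 0\<close>.\<close>

lemma u1_eq:
  assumes t: "t \<ge> 0"
  shows "AE x in lborel. u1 t x = u t x"
proof -
  obtain c where c: "AE x in lborel. u1 t x = c + u t x"
    using weak_deriv_UNIV[OF regularity(2,4)[OF t]] regularity(5)[OF t] by (auto simp: weak_derivative_on_UNIV u_def)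
  have odd': "AE x in lborel. u1 t (- x) = - u1 t x" using odd t by (simp add: odd_in_space_def)
  have ae: "AE x in lborel. -1 < x \<and> x < 1 \<longrightarrow> 2 * c + u t x + u t (- x) = 0"
    using c AE_lborel_uminus[OF c] odd' by eventually_elim auto
  have "continuous_on {-1<..<1} (\<lambda>x. 2 * c + u t x + u t (- x))"
    by (intro continuous_intros continuous_on_compose2[OF u_continuous[OF t]] continuous_on_subset[OF u_continuous[OF t]]) auto
  from AE_zero_continuous[OF this ae, of 0] have "c = 0" by (simp add: u_def)
  with c show ?thesis by simp
qed

lemma u_L2: "t \<ge> 0 \<Longrightarrow> L2 (u t)"
proof -
  assume t: "t \<ge> 0"
  show "L2 (u t)"
    by (rule L2I_dominated[OF borel_measurable_continuous_onI[OF u_continuous[OF t]] L2_integrable_sq[OF regularity(2)[OF t]]])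
      (use u1_eq[OF t] in \<open>eventually_elim, simp\<close>)
qed

lemma norm_bound:
  assumes "t \<ge> 0"
  shows "ip (u t) (u t) + ip (p t) (p t) + ip (u2 t) (u2 t) < \<delta>\<^sup>2" "\<delta> > 0"
proof -
  have 0: "0 \<le> H1L2_norm_on UNIV (u1 t) (u2 t)" by (simp add: H1L2_norm_on_def)
  then show "\<delta> > 0" using small[OF assms] by simp
  have "(H1L2_norm_on UNIV (u1 t) (u2 t))\<^sup>2 < \<delta>\<^sup>2"
    using small[OF assms] 0 by (intro power_strict_mono) auto
  moreover have "ip (u1 t) (u1 t) = ip (u t) (u t)"
    using ip_cong_AE[OF u1_eq[OF assms] regularity(2)[OF assms] u_L2[OF assms] regularity(2)[OF assms]]
      ip_cong_AE[OF u1_eq[OF assms] regularity(2)[OF assms] u_L2[OF assms] u_L2[OF assms]] by (simp add: ip_commute)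
  ultimately show "ip (u t) (u t) + ip (p t) (p t) + ip (u2 t) (u2 t) < \<delta>\<^sup>2"
    unfolding H1L2_norm_on_UNIV_square by (simp add: p_def)
qed

lemma u_small:
  assumes "t \<ge> 0"
  shows "\<bar>u t x\<bar> < \<delta>" "\<bar>u t x\<bar> < 1"
proof -
  have "(u t x)\<^sup>2 \<le> ip (u t) (u t) + ip (p t) (p t)"
    using prim_square_bound[OF regularity(4)[OF assms], of x] u_L2[OF assms] by (simp add: u_def)
  also have "\<dots> < \<delta>\<^sup>2" using norm_bound(1)[OF assms] ip_nonneg[of "u2 t"] by linarith
  finally have "\<bar>u t x\<bar>\<^sup>2 < \<delta>\<^sup>2" by simp
  then show "\<bar>u t x\<bar> < \<delta>" by (rule power2_less_imp_less) (use norm_bound(2)[OF assms] in simp)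
  then show "\<bar>u t x\<bar> < 1" using \<delta> by simp
qed

text \<open>Transfers continuity in time from the \<open>H^1\<close> norm of differences of
  \<open>u1\<close> to the separate \<open>L2\<close> curves \<open>u\<close> and \<open>p\<close>,
  through uniqueness of the weak derivative of a difference.\<close>

lemma sqd_le_norm:
  assumes "s \<ge> 0" "t \<ge> 0"
  shows "sqd (u s) (u t) + sqd (p s) (p t) + sqd (u2 s) (u2 t) \<le> (H1L2_norm_on UNIV (\<lambda>x. u1 s x - u1 t x) (\<lambda>x. u2 s x - u2 t x))\<^sup>2"
proof -
  let ?d = "\<lambda>x. u1 s x - u1 t x"
  have wd: "weak_derivative_on UNIV ?d (\<lambda>x. p s x - p t x)"
    using assms by (intro weak_derivative_on_UNIV_diff regularity)
  have L: "L2 ?d" "L2 (\<lambda>x. p s x - p t x)" "L2 (\<lambda>x. u s x - u t x)" using assms by (auto intro!: L2_diff regularity u_L2)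
  have "H1_on UNIV ?d" using wd L by (auto simp: H1_on_def L2_on_UNIV_iff)
  note d = weak_deriv_UNIV_props[OF this]
  have ae: "AE x in lborel. weak_deriv UNIV ?d x = p s x - p t x"
    by (rule weak_derivative_on_UNIV_unique[OF d(2) L(2) d(3) wd])
  have e1: "ip (weak_deriv UNIV ?d) (weak_deriv UNIV ?d) = sqd (p s) (p t)"
    unfolding sqd_eq ip_self_eq
    by (rule integral_cong_AE) (use L2_measurable[OF d(2)] L2_measurable[OF L(2)] in measurable, use ae in \<open>eventually_elim, simp\<close>)
  have e2: "ip ?d ?d = sqd (u s) (u t)"
    unfolding sqd_eq ip_self_eq
    by (rule integral_cong_AE) (use L2_measurable[OF L(1)] L2_measurable[OF L(3)] in measurable,
       use u1_eq[OF assms(1)] u1_eq[OF assms(2)] in \<open>eventually_elim, simp\<close>)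
  show ?thesis unfolding H1L2_norm_on_UNIV_square e1 e2 by (simp add: sqd_def)
qed

lemma curves: "L2curve u" "L2curve p" "L2curve u2"
proof -
  define n where "n t s = (H1L2_norm_on UNIV (\<lambda>x. u1 s x - u1 t x) (\<lambda>x. u2 s x - u2 t x))\<^sup>2" for t s
  have lim: "(n t \<longlongrightarrow> 0) (at t)" if t: "t > 0" for t
  proof -
    have "at t within {0..} = at t" using t by (intro at_within_interior) simp
    then have "((\<lambda>s. H1L2_norm_on UNIV (\<lambda>x. u1 s x - u1 t x) (\<lambda>x. u2 s x - u2 t x)) \<longlongrightarrow> 0) (at t)"
      using sol[unfolded global_solution_def continuous_H1L2_def, THEN conjunct1, THEN conjunct2, rule_format, of t] t
      by simp
    from tendsto_power[OF this, of 2] show ?thesis by (simp add: n_def[abs_def])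
  qed
  have ev: "\<forall>\<^sub>F s in at t. s \<ge> 0" if "t > 0" for t :: real
    using order_tendstoD(1)[OF tendsto_ident_at that] by (rule eventually_mono) simp
  have le: "sqd (u s) (u t) \<le> n t s" "sqd (p s) (p t) \<le> n t s" "sqd (u2 s) (u2 t) \<le> n t s" if "s \<ge> 0" "t > 0" for s t
    using sqd_le_norm[of s t] that sqd_nonneg[of "u s" "u t"] sqd_nonneg[of "p s" "p t"] sqd_nonneg[of "u2 s" "u2 t"]
    unfolding n_def by linarith+
  show "L2curve u" "L2curve p" "L2curve u2"
    unfolding L2curve_def
    by (intro allI impI L2limI_bound[OF _ _ _ lim] eventually_mono[OF ev] u_L2 regularity le; simp)+
qed

lemma g_L2_bound:
  assumes "t \<ge> 0"
  shows "\<bar>f (u t x)\<bar> \<le> C * \<bar>u t x\<bar>" "\<bar>g t x\<bar> \<le> (\<bar>m\<bar> + C) * \<bar>u t x\<bar>"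
proof -
  show 1: "\<bar>f (u t x)\<bar> \<le> C * \<bar>u t x\<bar>" using f_lip[of "u t x" 0] u_small(2)[OF assms, of x] by (simp add: f_0)
  have "\<bar>g t x\<bar> \<le> \<bar>m * u t x\<bar> + \<bar>f (u t x)\<bar>" unfolding g_def by (rule abs_triangle_ineq)
  then show "\<bar>g t x\<bar> \<le> (\<bar>m\<bar> + C) * \<bar>u t x\<bar>" using 1 by (simp add: abs_mult distrib_right)
qed

lemma fu_measurable: "t \<ge> 0 \<Longrightarrow> (\<lambda>x. f (u t x)) \<in> borel_measurable borel"
  using borel_measurable_continuous_onI[OF f_cont] borel_measurable_continuous_onI[OF u_continuous[of t]] by measurable

lemma fu_L2: "t \<ge> 0 \<Longrightarrow> L2 (\<lambda>x. f (u t x))"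
proof -
  assume t: "t \<ge> 0"
  show "L2 (\<lambda>x. f (u t x))"
  proof (rule L2I_dominated[OF fu_measurable[OF t] L2_integrable_sq[OF L2_cmult[OF u_L2[OF t], of C]]], rule AE_I2)
    fix x show "(f (u t x))\<^sup>2 \<le> (C * u t x)\<^sup>2"
      using power_mono[OF g_L2_bound(1)[OF t, of x], of 2] by (simp add: power_mult_distrib)
  qed
qed

lemma g_L2: "t \<ge> 0 \<Longrightarrow> L2 (g t)"
  unfolding g_def[abs_def] by (intro L2_add L2_cmult u_L2 fu_L2)

lemma g_curve: "L2curve g"
  unfolding L2curve_def
proof (intro allI impI)
  fix t :: real assume t: "t > 0"
  have ev: "\<forall>\<^sub>F s in at t. s \<ge> 0"
    using order_tendstoD(1)[OF tendsto_ident_at t] by (rule eventually_mono) simp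
  have ul: "L2lim u (u t) (at t)" using curves(1) t by (simp add: L2curve_def)
  have "L2lim (\<lambda>s x. f (u s x)) (\<lambda>x. f (u t x)) (at t)"
  proof (rule L2limI_bound[where g="\<lambda>s. C\<^sup>2 * sqd (u s) (u t)"])
    show "\<forall>\<^sub>F s in at t. L2 (\<lambda>x. f (u s x))" using ev by eventually_elim (rule fu_L2)
    show "L2 (\<lambda>x. f (u t x))" using t by (intro fu_L2) simp
    show "((\<lambda>s. C\<^sup>2 * sqd (u s) (u t)) \<longlongrightarrow> 0) (at t)"
      using tendsto_mult[OF tendsto_const L2limD(3)[OF ul], of "C\<^sup>2"] by simp
    show "\<forall>\<^sub>F s in at t. sqd (\<lambda>x. f (u s x)) (\<lambda>x. f (u t x)) \<le> C\<^sup>2 * sqd (u s) (u t)"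
      using ev
    proof eventually_elim
      case (elim s)
      have "sqd (\<lambda>x. f (u s x)) (\<lambda>x. f (u t x)) \<le> (\<integral>x. C\<^sup>2 * (u s x - u t x)\<^sup>2 \<partial>lborel)"
        unfolding sqd_eq
      proof (rule integral_mono)
        show "integrable lborel (\<lambda>x. (f (u s x) - f (u t x))\<^sup>2)"
          using elim t by (intro L2_integrable_sq L2_diff fu_L2) auto
        have "integrable lborel (\<lambda>x. (u s x - u t x)\<^sup>2)"
          using elim t by (intro L2_integrable_sq L2_diff u_L2) auto
        then show "integrable lborel (\<lambda>x. C\<^sup>2 * (u s x - u t x)\<^sup>2)" by simp
        fix x
        have "\<bar>f (u s x) - f (u t x)\<bar> \<le> C * \<bar>u s x - u t x\<bar>"
          using f_lip[OF u_small(2)[OF elim] u_small(2)[of t]] t by simp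
        from power_mono[OF this, of 2] show "(f (u s x) - f (u t x))\<^sup>2 \<le> C\<^sup>2 * (u s x - u t x)\<^sup>2"
          by (simp add: power_mult_distrib)
      qed
      then show ?case by (simp add: sqd_eq)
    qed
  qed
  from L2lim_add[OF L2lim_cmult[OF ul, of m] this] show "L2lim g (g t) (at t)"
    by (simp add: g_def[abs_def])
qed

lemma set_integral_lin:
  assumes "set_integrable lborel S \<alpha>" "set_integrable lborel S \<beta>"
  shows "(LBINT t:S. \<alpha> t + c * \<beta> t) = (LBINT t:S. \<alpha> t) + c * (LBINT t:S. \<beta> t :: real)"
  using set_integral_add(2)[OF assms(1) set_integrable_mult_right[OF assms(2), of c]] by simp

text \<open>The motion of the test function adds \<open>\<sigma> * deriv \<phi>\<close> to its time
  derivative; the weak space derivative of \<open>u1\<close> turns this contribution into a pairing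
  with \<open>p\<close>.\<close>

lemma weak_first:
  assumes \<phi>: "test_fun \<phi>" and \<theta>: "test_function_on {0<..} \<theta>"
  shows "(LBINT t:{0<..}. ip (u t) (\<lambda>x. \<phi> (x + \<sigma> * t)) * deriv \<theta> t) =
    - (LBINT t:{0<..}. ip (u2 t) (\<lambda>x. \<phi> (x + \<sigma> * t)) * \<theta> t) + \<sigma> * (LBINT t:{0<..}. ip (p t) (\<lambda>x. \<phi> (x + \<sigma> * t)) * \<theta> t)"
proof -
  let ?\<Phi> = "\<lambda>z. \<theta> (fst z) * \<phi> (snd z + \<sigma> * fst z)"
  have sh: "test_fun (\<lambda>x. \<phi> (x + h))" "L2 (\<lambda>x. \<phi> (x + h))" "L2 (\<lambda>x. deriv \<phi> (x + h))" for h
    using test_fun_shift(1)[OF \<phi>] test_fun_shift(1)[OF test_function_on_deriv[OF \<phi>]] by (auto intro: test_fun_L2)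
  have d: "test_function_on {0<..} (deriv \<theta>)" by (rule test_function_on_deriv[OF \<theta>])
  note ci = set_integrable_times_test[OF ip_shift_curve_isCont[OF _ test_fun_L2[OF \<phi>]]]
  have l: "(LBINT x. u1 t x * deriv (\<lambda>s. ?\<Phi> (s, x)) t) =
     ip (u t) (\<lambda>x. \<phi> (x + \<sigma> * t)) * deriv \<theta> t - \<sigma> * (ip (p t) (\<lambda>x. \<phi> (x + \<sigma> * t)) * \<theta> t)" if t: "t > 0" for t
  proof -
    have t0: "t \<ge> 0" using t by simp
    have "(LBINT x. u1 t x * deriv (\<lambda>s. ?\<Phi> (s, x)) t) =
      (LBINT x. deriv \<theta> t * (u1 t x * \<phi> (x + \<sigma> * t)) + \<sigma> * \<theta> t * (u1 t x * deriv \<phi> (x + \<sigma> * t)))"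
      by (simp only: fst_conv snd_conv test_function_travelling(2)[OF \<phi> \<theta>]) (simp add: algebra_simps)
    also have "\<dots> = deriv \<theta> t * ip (u1 t) (\<lambda>x. \<phi> (x + \<sigma> * t)) + \<sigma> * \<theta> t * ip (u1 t) (\<lambda>x. deriv \<phi> (x + \<sigma> * t))"
      using L2_integrable_mult[OF regularity(2)[OF t0] sh(2)] L2_integrable_mult[OF regularity(2)[OF t0] sh(3)] by (simp add: ip_def)
    also have "ip (u1 t) (\<lambda>x. deriv \<phi> (x + \<sigma> * t)) = - ip (p t) (\<lambda>x. \<phi> (x + \<sigma> * t))"
      using regularity(5)[OF t0] sh(1)[of "\<sigma> * t"] by (simp add: weak_derivative_on_UNIV test_fun_shift(2)[OF \<phi>, symmetric])
    also have "ip (u1 t) (\<lambda>x. \<phi> (x + \<sigma> * t)) = ip (u t) (\<lambda>x. \<phi> (x + \<sigma> * t))"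
      by (rule ip_cong_AE[OF u1_eq[OF t0] regularity(2)[OF t0] u_L2[OF t0] sh(2)])
    finally show ?thesis by (simp add: mult_ac)
  qed
  have r: "(LBINT x. u2 t x * ?\<Phi> (t, x)) = ip (u2 t) (\<lambda>x. \<phi> (x + \<sigma> * t)) * \<theta> t" for t
    unfolding ip_def integral_mult_left_zero[symmetric] by (simp add: mult_ac)
  have "- (LBINT t:{0<..}. (LBINT x. u1 t x * deriv (\<lambda>s. ?\<Phi> (s, x)) t)) = (LBINT t:{0<..}. (LBINT x. u2 t x * ?\<Phi> (t, x)))"
    using sol test_function_travelling(1)[OF \<phi> \<theta>, of \<sigma>] unfolding global_solution_def distributional_solution_def by blast
  moreover have "(LBINT t:{0<..}. (LBINT x. u1 t x * deriv (\<lambda>s. ?\<Phi> (s, x)) t)) =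
    (LBINT t:{0<..}. ip (u t) (\<lambda>x. \<phi> (x + \<sigma> * t)) * deriv \<theta> t - \<sigma> * (ip (p t) (\<lambda>x. \<phi> (x + \<sigma> * t)) * \<theta> t))"
    by (rule set_lebesgue_integral_cong) (use l in auto)
  moreover have "\<dots> = (LBINT t:{0<..}. ip (u t) (\<lambda>x. \<phi> (x + \<sigma> * t)) * deriv \<theta> t) - \<sigma> * (LBINT t:{0<..}. ip (p t) (\<lambda>x. \<phi> (x + \<sigma> * t)) * \<theta> t)"
    by (subst set_integral_diff(2)) (auto intro!: ci curves d \<theta> set_integrable_mult_right)
  ultimately show ?thesis unfolding r by simp
qed

text \<open>Of the two space derivatives on \<open>\<phi>\<close> only one is moved to
  \<open>u1\<close>, since \<open>p\<close> has no weak derivative in \<open>L2\<close>. The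
  pairings with \<open>deriv \<phi>\<close> that remain cancel in
  \<open>transported_characteristic\<close>.\<close>

lemma weak_second:
  assumes \<phi>: "test_fun \<phi>" and \<theta>: "test_function_on {0<..} \<theta>"
  shows "(LBINT t:{0<..}. ip (u2 t) (\<lambda>x. \<phi> (x + \<sigma> * t)) * deriv \<theta> t) =
    - \<sigma> * (LBINT t:{0<..}. ip (u2 t) (\<lambda>x. deriv \<phi> (x + \<sigma> * t)) * \<theta> t)
    + (LBINT t:{0<..}. ip (p t) (\<lambda>x. deriv \<phi> (x + \<sigma> * t)) * \<theta> t) - (LBINT t:{0<..}. ip (g t) (\<lambda>x. \<phi> (x + \<sigma> * t)) * \<theta> t)"
proof -
  let ?\<Phi> = "\<lambda>z. \<theta> (fst z) * \<phi> (snd z + \<sigma> * fst z)"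
  have d\<phi>: "test_fun (deriv \<phi>)" by (rule test_function_on_deriv[OF \<phi>])
  have sh: "test_fun (\<lambda>x. deriv \<phi> (x + h))" "L2 (\<lambda>x. \<phi> (x + h))" "L2 (\<lambda>x. deriv \<phi> (x + h))" "L2 (\<lambda>x. deriv (deriv \<phi>) (x + h))" for h
    using test_fun_shift(1)[OF \<phi>] test_fun_shift(1)[OF d\<phi>] test_fun_shift(1)[OF test_function_on_deriv[OF d\<phi>]] by (auto intro: test_fun_L2)
  have d: "test_function_on {0<..} (deriv \<theta>)" by (rule test_function_on_deriv[OF \<theta>])
  note ci = set_integrable_times_test[OF ip_shift_curve_isCont[OF _ test_fun_L2[OF \<phi>]]]
    set_integrable_times_test[OF ip_shift_curve_isCont[OF _ test_fun_L2[OF d\<phi>]]]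
  have l: "(LBINT x. u2 t x * deriv (\<lambda>s. ?\<Phi> (s, x)) t) =
     ip (u2 t) (\<lambda>x. \<phi> (x + \<sigma> * t)) * deriv \<theta> t + \<sigma> * (ip (u2 t) (\<lambda>x. deriv \<phi> (x + \<sigma> * t)) * \<theta> t)" if t: "t > 0" for t
  proof -
    have t0: "t \<ge> 0" using t by simp
    have "(LBINT x. u2 t x * deriv (\<lambda>s. ?\<Phi> (s, x)) t) =
      (LBINT x. deriv \<theta> t * (u2 t x * \<phi> (x + \<sigma> * t)) + \<sigma> * \<theta> t * (u2 t x * deriv \<phi> (x + \<sigma> * t)))"
      by (simp only: fst_conv snd_conv test_function_travelling(2)[OF \<phi> \<theta>]) (simp add: algebra_simps)
    also have "\<dots> = deriv \<theta> t * ip (u2 t) (\<lambda>x. \<phi> (x + \<sigma> * t)) + \<sigma> * \<theta> t * ip (u2 t) (\<lambda>x. deriv \<phi> (x + \<sigma> * t))"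
      using L2_integrable_mult[OF regularity(3)[OF t0] sh(2)] L2_integrable_mult[OF regularity(3)[OF t0] sh(3)] by (simp add: ip_def)
    finally show ?thesis by (simp add: mult_ac)
  qed
  have r: "(LBINT x. u1 t x * (deriv ^^ 2) (\<lambda>y. ?\<Phi> (t, y)) x + (m * u1 t x + f (u1 t x)) * ?\<Phi> (t, x)) =
     - (ip (p t) (\<lambda>x. deriv \<phi> (x + \<sigma> * t)) * \<theta> t) + ip (g t) (\<lambda>x. \<phi> (x + \<sigma> * t)) * \<theta> t" if t: "t > 0" for t
  proof -
    have t0: "t \<ge> 0" using t by simp
    have ff: "f \<in> borel_measurable borel" by (rule borel_measurable_continuous_onI[OF f_cont])
    have "(LBINT x. u1 t x * (deriv ^^ 2) (\<lambda>y. ?\<Phi> (t, y)) x + (m * u1 t x + f (u1 t x)) * ?\<Phi> (t, x)) =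
      (LBINT x. u1 t x * (\<theta> t * deriv (deriv \<phi>) (x + \<sigma> * t)) + (m * u1 t x + f (u1 t x)) * (\<theta> t * \<phi> (x + \<sigma> * t)))"
      using test_function_travelling(3)[OF \<phi> \<theta>] by simp
    also have "\<dots> = (LBINT x. \<theta> t * (u1 t x * deriv (deriv \<phi>) (x + \<sigma> * t)) + \<theta> t * (g t x * \<phi> (x + \<sigma> * t)))"
    proof (rule integral_cong_AE)
      show "AE x in lborel. u1 t x * (\<theta> t * deriv (deriv \<phi>) (x + \<sigma> * t)) + (m * u1 t x + f (u1 t x)) * (\<theta> t * \<phi> (x + \<sigma> * t))
         = \<theta> t * (u1 t x * deriv (deriv \<phi>) (x + \<sigma> * t)) + \<theta> t * (g t x * \<phi> (x + \<sigma> * t))"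
        using u1_eq[OF t0] by eventually_elim (simp add: g_def algebra_simps)
    qed (use L2_measurable[OF regularity(2)[OF t0]] L2_measurable[OF g_L2[OF t0]] L2_measurable[OF sh(4)] L2_measurable[OF sh(2)] ff in measurable)
    also have "\<dots> = \<theta> t * ip (u1 t) (\<lambda>x. deriv (deriv \<phi>) (x + \<sigma> * t)) + \<theta> t * ip (g t) (\<lambda>x. \<phi> (x + \<sigma> * t))"
      using L2_integrable_mult[OF regularity(2)[OF t0] sh(4)] L2_integrable_mult[OF g_L2[OF t0] sh(2)] by (simp add: ip_def)
    also have "ip (u1 t) (\<lambda>x. deriv (deriv \<phi>) (x + \<sigma> * t)) = - ip (p t) (\<lambda>x. deriv \<phi> (x + \<sigma> * t))"
      using regularity(5)[OF t0] sh(1)[of "\<sigma> * t"] by (simp add: weak_derivative_on_UNIV test_fun_shift(2)[OF d\<phi>, symmetric])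
    finally show ?thesis by (simp add: mult_ac)
  qed
  have "- (LBINT t:{0<..}. (LBINT x. u2 t x * deriv (\<lambda>s. ?\<Phi> (s, x)) t)) =
     (LBINT t:{0<..}. (LBINT x. u1 t x * (deriv ^^ 2) (\<lambda>y. ?\<Phi> (t, y)) x + (m * u1 t x + f (u1 t x)) * ?\<Phi> (t, x)))"
    using sol test_function_travelling(1)[OF \<phi> \<theta>, of \<sigma>] unfolding global_solution_def distributional_solution_def by blast
  moreover have "(LBINT t:{0<..}. (LBINT x. u2 t x * deriv (\<lambda>s. ?\<Phi> (s, x)) t)) =
    (LBINT t:{0<..}. ip (u2 t) (\<lambda>x. \<phi> (x + \<sigma> * t)) * deriv \<theta> t + \<sigma> * (ip (u2 t) (\<lambda>x. deriv \<phi> (x + \<sigma> * t)) * \<theta> t))"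
    by (rule set_lebesgue_integral_cong) (use l in auto)
  moreover have "\<dots> = (LBINT t:{0<..}. ip (u2 t) (\<lambda>x. \<phi> (x + \<sigma> * t)) * deriv \<theta> t) + \<sigma> * (LBINT t:{0<..}. ip (u2 t) (\<lambda>x. deriv \<phi> (x + \<sigma> * t)) * \<theta> t)"
    by (subst set_integral_add(2)) (auto intro!: ci curves d \<theta> set_integrable_mult_right)
  moreover have "(LBINT t:{0<..}. (LBINT x. u1 t x * (deriv ^^ 2) (\<lambda>y. ?\<Phi> (t, y)) x + (m * u1 t x + f (u1 t x)) * ?\<Phi> (t, x))) =
    (LBINT t:{0<..}. - (ip (p t) (\<lambda>x. deriv \<phi> (x + \<sigma> * t)) * \<theta> t) + ip (g t) (\<lambda>x. \<phi> (x + \<sigma> * t)) * \<theta> t)"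
    by (rule set_lebesgue_integral_cong) (use r in auto)
  moreover have "\<dots> = - (LBINT t:{0<..}. ip (p t) (\<lambda>x. deriv \<phi> (x + \<sigma> * t)) * \<theta> t) + (LBINT t:{0<..}. ip (g t) (\<lambda>x. \<phi> (x + \<sigma> * t)) * \<theta> t)"
    using set_integral_lin[OF ci(1)[OF g_curve _ \<theta>] ci(2)[OF curves(2) _ \<theta>], where c="-1"]
    by simp
  ultimately show ?thesis by simp
qed

text \<open>Valid for every speed, which is what later allows \<open>u\<close> to be multiplied by
  quantities moving in either direction.\<close>

lemma transported_u: "transported \<sigma> u (\<lambda>t x. u2 t x - \<sigma> * p t x)"
proof (rule transportedI[OF curves(1)])
  have "L2curve (\<lambda>t x. u2 t x + (- \<sigma>) * p t x)"
    using curves unfolding L2curve_def by (intro allI impI L2lim_add L2lim_cmult) auto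
  then show "L2curve (\<lambda>t x. u2 t x - \<sigma> * p t x)" by simp
  fix \<phi> \<theta> :: "real \<Rightarrow> real" assume \<phi>: "test_fun \<phi>" and \<theta>: "test_function_on {0<..} \<theta>"
  have sh: "L2 (\<lambda>x. \<phi> (x + h))" for h using test_fun_shift(1)[OF \<phi>] by (rule test_fun_L2)
  note ci = set_integrable_times_test[OF ip_shift_curve_isCont[OF _ test_fun_L2[OF \<phi>]] \<theta>]
  have "(LBINT t:{0<..}. ip (\<lambda>x. u2 t x - \<sigma> * p t x) (\<lambda>x. \<phi> (x + \<sigma> * t)) * \<theta> t) =
    (LBINT t:{0<..}. ip (u2 t) (\<lambda>x. \<phi> (x + \<sigma> * t)) * \<theta> t + (- \<sigma>) * (ip (p t) (\<lambda>x. \<phi> (x + \<sigma> * t)) * \<theta> t))"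
    by (rule set_lebesgue_integral_cong)
      (simp_all add: ip_diff_left[OF regularity(3) L2_cmult[OF regularity(4)] sh] ip_cmult_left left_diff_distrib mult.assoc)
  also have "\<dots> = (LBINT t:{0<..}. ip (u2 t) (\<lambda>x. \<phi> (x + \<sigma> * t)) * \<theta> t) + (- \<sigma>) * (LBINT t:{0<..}. ip (p t) (\<lambda>x. \<phi> (x + \<sigma> * t)) * \<theta> t)"
    by (rule set_integral_lin[OF ci[OF curves(3)] ci[OF curves(2)]])
  finally show "(LBINT t:{0<..}. ip (u t) (\<lambda>x. \<phi> (x + \<sigma> * t)) * deriv \<theta> t) =
     - (LBINT t:{0<..}. ip (\<lambda>x. u2 t x - \<sigma> * p t x) (\<lambda>x. \<phi> (x + \<sigma> * t)) * \<theta> t)"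
    using weak_first[OF \<phi> \<theta>, of \<sigma>] by simp
qed

text \<open>The wave operator factors into transport operators of opposite speeds. In weak form, the
  pairings of \<open>deriv \<phi>\<close> with \<open>u2\<close> cancel directly and those with
  \<open>p\<close> cancel because \<open>\<sigma> * \<sigma> = 1\<close>.\<close>

lemma transported_characteristic:
  assumes \<sigma>: "\<sigma> * \<sigma> = 1"
  shows "transported \<sigma> (\<lambda>t x. u2 t x + \<sigma> * p t x) g"
proof (rule transportedI[OF _ g_curve])
  show "L2curve (\<lambda>t x. u2 t x + \<sigma> * p t x)"
    using curves unfolding L2curve_def by (intro allI impI L2lim_add L2lim_cmult) auto
  fix \<phi> \<theta> :: "real \<Rightarrow> real" assume \<phi>: "test_fun \<phi>" and \<theta>: "test_function_on {0<..} \<theta>"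
  have d\<phi>: "test_fun (deriv \<phi>)" by (rule test_function_on_deriv[OF \<phi>])
  have sh: "test_fun (\<lambda>x. \<phi> (x + h))" "L2 (\<lambda>x. \<phi> (x + h))" "L2 (\<lambda>x. deriv \<phi> (x + h))" for h
    using test_fun_shift(1)[OF \<phi>] test_fun_shift(1)[OF d\<phi>] by (auto intro: test_fun_L2)
  note ci = set_integrable_times_test[OF ip_shift_curve_isCont[OF _ test_fun_L2[OF \<phi>]] test_function_on_deriv[OF \<theta>]]
  have "(LBINT t:{0<..}. ip (\<lambda>x. u2 t x + \<sigma> * p t x) (\<lambda>x. \<phi> (x + \<sigma> * t)) * deriv \<theta> t) =
    (LBINT t:{0<..}. ip (u2 t) (\<lambda>x. \<phi> (x + \<sigma> * t)) * deriv \<theta> t + \<sigma> * (ip (p t) (\<lambda>x. \<phi> (x + \<sigma> * t)) * deriv \<theta> t))"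
    by (rule set_lebesgue_integral_cong)
      (simp_all add: ip_add_left[OF regularity(3) L2_cmult[OF regularity(4)] sh(2)] ip_cmult_left distrib_right mult.assoc)
  also have "\<dots> = (LBINT t:{0<..}. ip (u2 t) (\<lambda>x. \<phi> (x + \<sigma> * t)) * deriv \<theta> t) + \<sigma> * (LBINT t:{0<..}. ip (p t) (\<lambda>x. \<phi> (x + \<sigma> * t)) * deriv \<theta> t)"
    by (rule set_integral_lin[OF ci[OF curves(3)] ci[OF curves(2)]])
  \<comment> \<open>The system gives no equation for the time derivative of \<open>p\<close>. Moving
    its space derivative to \<open>\<phi>\<close> reduces this term to the first equation, tested
    with \<open>deriv \<phi>\<close>.\<close>
  also have "(LBINT t:{0<..}. ip (p t) (\<lambda>x. \<phi> (x + \<sigma> * t)) * deriv \<theta> t) = - (LBINT t:{0<..}. ip (u t) (\<lambda>x. deriv \<phi> (x + \<sigma> * t)) * deriv \<theta> t)"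
  proof -
    have "(LBINT t:{0<..}. ip (p t) (\<lambda>x. \<phi> (x + \<sigma> * t)) * deriv \<theta> t) = (LBINT t:{0<..}. - (ip (u t) (\<lambda>x. deriv \<phi> (x + \<sigma> * t)) * deriv \<theta> t))"
    proof (rule set_lebesgue_integral_cong)
      show "\<forall>t. t \<in> {0<..} \<longrightarrow> ip (p t) (\<lambda>x. \<phi> (x + \<sigma> * t)) * deriv \<theta> t = - (ip (u t) (\<lambda>x. deriv \<phi> (x + \<sigma> * t)) * deriv \<theta> t)"
      proof (intro allI impI)
        fix t :: real assume "t \<in> {0<..}"
        then have t0: "t \<ge> 0" by simp
        have "ip (u1 t) (\<lambda>x. deriv \<phi> (x + \<sigma> * t)) = - ip (p t) (\<lambda>x. \<phi> (x + \<sigma> * t))"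
          using regularity(5)[OF t0] sh(1)[of "\<sigma> * t"] by (simp add: weak_derivative_on_UNIV test_fun_shift(2)[OF \<phi>, symmetric])
        moreover have "ip (u1 t) (\<lambda>x. deriv \<phi> (x + \<sigma> * t)) = ip (u t) (\<lambda>x. deriv \<phi> (x + \<sigma> * t))"
          by (rule ip_cong_AE[OF u1_eq[OF t0] regularity(2)[OF t0] u_L2[OF t0] sh(3)])
        ultimately show "ip (p t) (\<lambda>x. \<phi> (x + \<sigma> * t)) * deriv \<theta> t = - (ip (u t) (\<lambda>x. deriv \<phi> (x + \<sigma> * t)) * deriv \<theta> t)" by simp
      qed
    qed simp
    then show ?thesis by (simp add: set_lebesgue_integral_def)
  qed
  finally have "(LBINT t:{0<..}. ip (\<lambda>x. u2 t x + \<sigma> * p t x) (\<lambda>x. \<phi> (x + \<sigma> * t)) * deriv \<theta> t) =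
     - (\<sigma> * (LBINT t:{0<..}. ip (u2 t) (\<lambda>x. deriv \<phi> (x + \<sigma> * t)) * \<theta> t))
     + (LBINT t:{0<..}. ip (p t) (\<lambda>x. deriv \<phi> (x + \<sigma> * t)) * \<theta> t) - (LBINT t:{0<..}. ip (g t) (\<lambda>x. \<phi> (x + \<sigma> * t)) * \<theta> t)
     + \<sigma> * (LBINT t:{0<..}. ip (u2 t) (\<lambda>x. deriv \<phi> (x + \<sigma> * t)) * \<theta> t)
     - (\<sigma> * \<sigma>) * (LBINT t:{0<..}. ip (p t) (\<lambda>x. deriv \<phi> (x + \<sigma> * t)) * \<theta> t)"
    unfolding weak_first[OF d\<phi> \<theta>, of \<sigma>] weak_second[OF \<phi> \<theta>, of \<sigma>] by (simp add: algebra_simps)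
  then show "(LBINT t:{0<..}. ip (\<lambda>x. u2 t x + \<sigma> * p t x) (\<lambda>x. \<phi> (x + \<sigma> * t)) * deriv \<theta> t) =
     - (LBINT t:{0<..}. ip (g t) (\<lambda>x. \<phi> (x + \<sigma> * t)) * \<theta> t)"
    unfolding \<sigma> by simp
qed

end


section \<open>The virial inequality\<close>

lemma has_derivative_abs_compose:
  fixes k :: "real \<Rightarrow> real"
  assumes "(k has_real_derivative d) (at \<bar>x\<bar>)" "x \<noteq> 0"
  shows "((\<lambda>x. k \<bar>x\<bar>) has_real_derivative sgn x * d) (at x)"
    and "((\<lambda>x. sgn x * k \<bar>x\<bar>) has_real_derivative d) (at x)"
proof -
  consider "x > 0" | "x < 0" using assms(2) by linarith
  then have "((\<lambda>x. k \<bar>x\<bar>) has_real_derivative sgn x * d) (at x) \<and> ((\<lambda>x. sgn x * k \<bar>x\<bar>) has_real_derivative d) (at x)"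
  proof cases
    case 1
    have ev: "\<forall>\<^sub>F y in nhds x. y \<in> {0<..}" using 1 by (intro eventually_nhds_in_open) auto
    have k: "(k has_real_derivative d) (at x)" using assms(1) 1 by simp
    have "((\<lambda>x. k \<bar>x\<bar>) has_real_derivative d) (at x)"
      using k by (rule DERIV_cong_ev[THEN iffD1, OF refl _ refl, rotated]) (use ev in \<open>eventually_elim, simp\<close>)
    moreover have "((\<lambda>x. sgn x * k \<bar>x\<bar>) has_real_derivative d) (at x)"
      using k by (rule DERIV_cong_ev[THEN iffD1, OF refl _ refl, rotated]) (use ev in \<open>eventually_elim, simp\<close>)
    ultimately show ?thesis using 1 by simp
  next
    case 2
    have ev: "\<forall>\<^sub>F y in nhds x. y \<in> {..<0}" using 2 by (intro eventually_nhds_in_open) auto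
    have "((\<lambda>x. k (- x)) has_real_derivative d * - 1) (at x)"
      by (rule DERIV_chain2[of k]) (use assms(1) 2 in \<open>auto intro!: derivative_eq_intros\<close>)
    then have k: "((\<lambda>x. k (- x)) has_real_derivative - d) (at x)" by simp
    have "((\<lambda>x. k \<bar>x\<bar>) has_real_derivative - d) (at x)"
      using k by (rule DERIV_cong_ev[THEN iffD1, OF refl _ refl, rotated]) (use ev in \<open>eventually_elim, simp\<close>)
    moreover have "((\<lambda>x. sgn x * k \<bar>x\<bar>) has_real_derivative d) (at x)"
      using DERIV_minus[OF k, unfolded minus_minus]
      by (rule DERIV_cong_ev[THEN iffD1, OF refl _ refl, rotated]) (use ev in \<open>eventually_elim, simp\<close>)
    ultimately show ?thesis using 2 by simp
  qed
  then show "((\<lambda>x. k \<bar>x\<bar>) has_real_derivative sgn x * d) (at x)"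
    and "((\<lambda>x. sgn x * k \<bar>x\<bar>) has_real_derivative d) (at x)" by blast+
qed

lemma exp_minus_Lipschitz:
  assumes "0 \<le> a" "0 \<le> b"
  shows "\<bar>exp (- a) - exp (- b)\<bar> \<le> \<bar>a - (b::real)\<bar>"
proof -
  have *: "exp (- a) - exp (- b) \<le> b - a" if "0 \<le> a" "a \<le> b" for a b :: real
  proof -
    have "exp (- a) - exp (- b) = exp (- a) * (1 - exp (- (b - a)))"
      by (simp add: right_diff_distrib exp_add[symmetric] del: exp_diff)
    also have "\<dots> \<le> 1 * (1 - exp (- (b - a)))" using that by (intro mult_right_mono) auto
    also have "\<dots> \<le> b - a"
    proof -
      have "1 - exp (- d) \<le> d" for d :: real using exp_ge_add_one_self[of "- d"] by linarith
      then show ?thesis by (simp only: mult_1)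
    qed
    finally show ?thesis .
  qed
  show ?thesis using *[of a b] *[of b a] assms by (cases "a \<le> b") (auto simp: abs_if)
qed

definition wt :: "real \<Rightarrow> real \<Rightarrow> real" where
  "wt c x = exp (- (c * \<bar>x\<bar>))"

definition wtd :: "real \<Rightarrow> real \<Rightarrow> real" where
  "wtd c x = - c * (sgn x * wt c x)"

text \<open>The bounded primitive of \<open>wt 2\<close> that vanishes at the origin:
  \<open>psi' = wt 2\<close>, and the next derivative \<open>wtd 2\<close> jumps at
  \<open>0\<close>.\<close>

definition psi :: "real \<Rightarrow> real" where
  "psi x = sgn x * ((1 - exp (- (2 * \<bar>x\<bar>))) / 2)"

lemma sgn_measurable: "(sgn :: real \<Rightarrow> real) \<in> borel_measurable borel"
proof -
  have "(sgn :: real \<Rightarrow> real) = (\<lambda>x. if 0 < x then 1 else if x < 0 then -1 else 0)" by (auto simp: sgn_if)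
  then show ?thesis by simp
qed

lemma abs_sgn_le_1: "\<bar>sgn x\<bar> \<le> (1::real)"
  by (simp add: sgn_if)

lemma wt_measurable: "wt c \<in> borel_measurable borel"
  unfolding wt_def[abs_def] by measurable

lemma wtd_measurable: "wtd c \<in> borel_measurable borel"
  unfolding wtd_def[abs_def] using sgn_measurable wt_measurable[of c] by measurable

lemma psi_measurable: "psi \<in> borel_measurable borel"
  unfolding psi_def[abs_def] using sgn_measurable by measurable

lemma wt_pos: "0 < wt c x" by (simp add: wt_def)

lemma wt_bound: "c \<ge> 0 \<Longrightarrow> wt c x \<le> 1" by (simp add: wt_def)

lemma wt_abs_bound: "c \<ge> 0 \<Longrightarrow> \<bar>wt c x\<bar> \<le> 1" using wt_bound[of c x] wt_pos[of c x] by simp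

lemma wtd_bound: "c \<ge> 0 \<Longrightarrow> \<bar>wtd c x\<bar> \<le> c * wt c x"
  using wt_pos[of c x] mult_left_mono[of "\<bar>sgn x\<bar> * wt c x" "wt c x" c] mult_right_mono[OF abs_sgn_le_1[of x], of "wt c x"]
  by (simp add: wtd_def abs_mult)

lemma wt_Lipschitz: "c \<ge> 0 \<Longrightarrow> \<bar>wt c x - wt c y\<bar> \<le> c * \<bar>x - y\<bar>"
proof -
  assume c: "c \<ge> 0"
  have "\<bar>wt c x - wt c y\<bar> \<le> \<bar>c * \<bar>x\<bar> - c * \<bar>y\<bar>\<bar>" unfolding wt_def using c by (intro exp_minus_Lipschitz) auto
  also have "\<dots> = c * \<bar>\<bar>x\<bar> - \<bar>y\<bar>\<bar>" using c by (simp add: right_diff_distrib[symmetric] abs_mult)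
  also have "\<dots> \<le> c * \<bar>x - y\<bar>" using c by (intro mult_left_mono) auto
  finally show ?thesis .
qed

lemma wt_deriv: "x \<noteq> 0 \<Longrightarrow> (wt c has_real_derivative wtd c x) (at x)"
proof -
  assume x: "x \<noteq> 0"
  have "((\<lambda>r. exp (- (c * r))) has_real_derivative - c * exp (- (c * \<bar>x\<bar>))) (at \<bar>x\<bar>)"
    by (rule derivative_eq_intros refl)+ simp
  from has_derivative_abs_compose(1)[OF this x] show ?thesis
    unfolding wt_def[abs_def] wtd_def by (simp add: mult_ac)
qed

lemma half_one_minus_bound: "0 < e \<Longrightarrow> e \<le> 1 \<Longrightarrow> \<bar>(1 - e) / 2\<bar> \<le> (1::real)"
  by (simp add: abs_le_iff)

lemma psi_bound: "\<bar>psi x\<bar> \<le> 1"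
proof -
  have "\<bar>(1 - exp (- (2 * \<bar>x\<bar>))) / 2\<bar> \<le> 1" by (rule half_one_minus_bound) simp_all
  then show ?thesis using mult_mono[OF abs_sgn_le_1[of x], of "\<bar>(1 - exp (- (2 * \<bar>x\<bar>))) / 2\<bar>" 1]
    unfolding psi_def abs_mult by simp
qed

lemma psi_deriv: "x \<noteq> 0 \<Longrightarrow> (psi has_real_derivative wt 2 x) (at x)"
proof -
  assume x: "x \<noteq> 0"
  have "((\<lambda>r. (1 - exp (- (2 * r))) / 2) has_real_derivative exp (- (2 * \<bar>x\<bar>))) (at \<bar>x\<bar>)"
    by (rule derivative_eq_intros refl)+ simp_all
  from has_derivative_abs_compose(2)[OF this x] show ?thesis
    unfolding psi_def[abs_def] wt_def .
qed

lemma psi_Lipschitz: "\<bar>psi x - psi y\<bar> \<le> 1 * \<bar>x - y\<bar>"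
proof -
  define A :: "real \<Rightarrow> real" where "A r = (1 - exp (- (2 * r))) / 2" for r
  have A0: "A 0 = 0" by (simp add: A_def)
  have same: "\<bar>A a - A b\<bar> \<le> \<bar>a - b\<bar>" if "0 \<le> a" "0 \<le> b" for a b
  proof -
    have "A a - A b = - ((exp (- (2 * a)) - exp (- (2 * b))) / 2)" by (simp add: A_def field_simps)
    then have eq: "\<bar>A a - A b\<bar> = \<bar>exp (- (2 * a)) - exp (- (2 * b))\<bar> / 2" by (simp only: abs_minus_cancel abs_divide abs_numeral)
    have "\<bar>2 * a - 2 * b\<bar> = 2 * \<bar>a - b\<bar>" using abs_mult[of 2 "a - b"] by (simp add: right_diff_distrib)
    then show ?thesis unfolding eq using exp_minus_Lipschitz[of "2 * a" "2 * b"] that by simp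
  qed
  have le: "0 \<le> A a" "A a \<le> a" if "0 \<le> a" for a
    using same[of a 0] exp_le_one_iff[of "- (2 * a)"] that A0 by (simp_all add: A_def)
  have psi: "psi z = A z" "psi (- z) = - A z" if "z \<ge> 0" for z
  proof -
    have "psi z = A z \<and> psi (- z) = - A z"
    proof (cases "z = 0")
      case False
      with that have z: "\<bar>z\<bar> = z" "\<bar>- z\<bar> = z" "sgn z = 1" "sgn (- z) = -1" by (auto simp: sgn_if)
      show ?thesis unfolding psi_def z A_def by (simp add: field_simps)
    qed (simp add: psi_def A_def)
    then show "psi z = A z" "psi (- z) = - A z" by blast+
  qed
  consider "x \<ge> 0" "y \<ge> 0" | "- x \<ge> 0" "- y \<ge> 0" | "x \<ge> 0" "- y \<ge> 0" | "- x \<ge> 0" "y \<ge> 0" by linarith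
  then show ?thesis
  proof cases
    case 1
    then show ?thesis using same[of x y] psi(1)[of x] psi(1)[of y] by simp
  next
    case 2
    then show ?thesis using same[OF 2] psi(2)[OF 2(1)] psi(2)[OF 2(2)] by (simp add: abs_minus_commute)
  next
    case 3
    then show ?thesis using le[of x] le[of "-y"] psi(1)[of x] psi(2)[OF 3(2)] by simp
  next
    case 4
    then show ?thesis using le[of y] le[of "-x"] psi(1)[of y] psi(2)[OF 4(1)] by simp
  qed
qed

lemma integrable_weighted:
  assumes "L2 a" "L2 b" "c \<in> borel_measurable borel" "\<And>x. \<bar>c x\<bar> \<le> M"
  shows "integrable lborel (\<lambda>x. c x * (a x * b x))"
  using L2_integrable_mult[OF L2_bounded_mult[OF assms(1,3,4)] assms(2)] by (simp add: mult.assoc)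

lemma integrable_dominated_sq:
  assumes "L2 a" "h \<in> borel_measurable borel" "\<And>x. \<bar>h x\<bar> \<le> K * (a x * a x)"
  shows "integrable lborel h"
proof (rule Bochner_Integration.integrable_bound)
  show "integrable lborel (\<lambda>x. K * (a x * a x))" using L2_integrable_mult[OF assms(1,1)] by simp
  show "AE x in lborel. norm (h x) \<le> norm (K * (a x * a x))"
  proof (rule AE_I2)
    fix x show "norm (h x) \<le> norm (K * (a x * a x))" using assms(3)[of x] unfolding real_norm_def by linarith
  qed
qed (use assms(2) in simp)

lemma AE_sgn_square: "AE x in lborel. sgn x * sgn x = (1::real)"
  using AE_lborel_singleton[of "0::real"] by eventually_elim (simp add: sgn_if)

text \<open>The derivative of the square of \<open>prim P\<close> is integrated against
  \<open>sgn x * wt c x\<close>. The jump of this weight at the origin costs nothing because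
  \<open>prim P\<close> vanishes there. The case \<open>c = 2\<close> produces the defect, the case
  \<open>c = 3\<close> its coercivity.\<close>

lemma integral_square_identity:
  assumes P: "L2 P" and U: "L2 (prim P)" and c: "c \<ge> 0"
  shows "(\<integral>x. wt c x * (sgn x * prim P x * P x) \<partial>lborel) = c / 2 * (\<integral>x. wt c x * (prim P x * prim P x) \<partial>lborel)"
proof -
  have sw: "(\<lambda>x. sgn x * wt c x) \<in> borel_measurable borel" "\<bar>sgn x * wt c x\<bar> \<le> 1" for x
    using sgn_measurable wt_measurable[of c] mult_mono[OF abs_sgn_le_1[of x] wt_abs_bound[OF c, of x]]
    by (auto simp: abs_mult)
  have i1: "integrable lborel (\<lambda>x. wt c x * (prim P x * prim P x))"
    by (rule integrable_weighted[OF U U wt_measurable wt_abs_bound[OF c]])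
  have i2: "integrable lborel (\<lambda>x. sgn x * wt c x * (prim P x * P x))"
    by (rule integrable_weighted[OF U P sw])
  have kd: "((\<lambda>y. exp (- (c * y))) has_real_derivative - c * exp (- (c * y))) (at y)" for y
    by (auto intro!: derivative_eq_intros)
  have hd: "((\<lambda>y. y * y) has_real_derivative 2 * y) (at y)" for y :: real
    by (auto intro!: derivative_eq_intros)
  have e: "- c * exp (- (c * \<bar>x\<bar>)) * (prim P x * prim P x) + sgn x * exp (- (c * \<bar>x\<bar>)) * (2 * prim P x) * P x
     = (- c) * (wt c x * (prim P x * prim P x)) + 2 * (sgn x * wt c x * (prim P x * P x))" for x
    by (simp add: wt_def mult_ac)
  have "(\<integral>x. - c * exp (- (c * \<bar>x\<bar>)) * (prim P x * prim P x) + sgn x * exp (- (c * \<bar>x\<bar>)) * (2 * prim P x) * P x \<partial>lborel) = 0"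
  proof (rule chain_rule_line[OF P kd _ hd])
    show "integrable lborel (\<lambda>x. - c * exp (- (c * \<bar>x\<bar>)) * (prim P x * prim P x) + sgn x * exp (- (c * \<bar>x\<bar>)) * (2 * prim P x) * P x)"
      unfolding e using i1 i2 by simp
    show "integrable lborel (\<lambda>x. exp (- (c * \<bar>x\<bar>)) * (prim P x * prim P x))" using i1 by (simp add: wt_def)
  qed (auto intro!: continuous_intros)
  then have "(- c) * (\<integral>x. wt c x * (prim P x * prim P x) \<partial>lborel) + 2 * (\<integral>x. sgn x * wt c x * (prim P x * P x) \<partial>lborel) = 0"
    unfolding e using i1 i2 by simp
  moreover have "(\<integral>x. sgn x * wt c x * (prim P x * P x) \<partial>lborel) = (\<integral>x. wt c x * (sgn x * prim P x * P x) \<partial>lborel)"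
    by (simp add: mult_ac)
  ultimately show ?thesis by simp
qed

text \<open>With \<open>prim P x = exp \<bar>x\<bar> * v x\<close> the factor
  \<open>P x - sgn x * prim P x\<close> is \<open>exp \<bar>x\<bar>\<close> times the derivative of
  \<open>v\<close>, so this is the squared \<open>L2\<close> norm of that derivative.\<close>

definition virial_defect :: "(real \<Rightarrow> real) \<Rightarrow> real" where
  "virial_defect P = (\<integral>x. wt 2 x * ((P x - sgn x * prim P x) * (P x - sgn x * prim P x)) \<partial>lborel)"

lemma defect_L2:
  assumes "L2 P" "L2 (prim P)"
  shows "L2 (\<lambda>x. P x - sgn x * prim P x)"
  by (intro L2_diff assms L2_bounded_mult[OF _ sgn_measurable abs_sgn_le_1])

text \<open>Expanding the square produces a cross term which, for the rate 2, is minus twice the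
  integral of \<open>wt 2\<close> times the squared primitive; this reverses the sign of that term
  in the expansion.\<close>

lemma virial_defect_eq:
  assumes P: "L2 P" and U: "L2 (prim P)"
  shows "virial_defect P = (\<integral>x. wt 2 x * (P x * P x) \<partial>lborel) - (\<integral>x. wt 2 x * (prim P x * prim P x) \<partial>lborel)"
proof -
  have sw: "(\<lambda>x. sgn x * wt 2 x) \<in> borel_measurable borel" "\<bar>sgn x * wt 2 x\<bar> \<le> 1" for x
    using sgn_measurable wt_measurable[of 2] mult_mono[OF abs_sgn_le_1[of x] wt_abs_bound[of 2 x]]
    by (auto simp: abs_mult)
  have i1: "integrable lborel (\<lambda>x. wt 2 x * (prim P x * prim P x))" "integrable lborel (\<lambda>x. wt 2 x * (P x * P x))"
    by (auto intro!: integrable_weighted[OF U U wt_measurable wt_abs_bound] integrable_weighted[OF P P wt_measurable wt_abs_bound])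
  have i2: "integrable lborel (\<lambda>x. wt 2 x * (sgn x * prim P x * P x))"
    using integrable_weighted[OF U P sw] by (simp add: mult_ac)
  have m: "prim P \<in> borel_measurable borel" "P \<in> borel_measurable borel" using P U by (auto dest: L2_measurable)
  have "virial_defect P = (\<integral>x. wt 2 x * (P x * P x) - 2 * (wt 2 x * (sgn x * prim P x * P x)) + wt 2 x * (prim P x * prim P x) \<partial>lborel)"
    unfolding virial_defect_def
  proof (rule integral_cong_AE)
    show "AE x in lborel. wt 2 x * ((P x - sgn x * prim P x) * (P x - sgn x * prim P x)) =
       wt 2 x * (P x * P x) - 2 * (wt 2 x * (sgn x * prim P x * P x)) + wt 2 x * (prim P x * prim P x)"
      using AE_sgn_square
    proof eventually_elim
      case (elim x)
      have "wt 2 x * ((P x - sgn x * prim P x) * (P x - sgn x * prim P x)) =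
        wt 2 x * (P x * P x) - 2 * (wt 2 x * (sgn x * prim P x * P x)) + (sgn x * sgn x) * (wt 2 x * (prim P x * prim P x))"
        by (simp add: algebra_simps)
      then show ?case unfolding elim by simp
    qed
  qed (use m sgn_measurable wt_measurable[of 2] in measurable)
  also have "\<dots> = (\<integral>x. wt 2 x * (P x * P x) \<partial>lborel) - 2 * (\<integral>x. wt 2 x * (sgn x * prim P x * P x) \<partial>lborel) + (\<integral>x. wt 2 x * (prim P x * prim P x) \<partial>lborel)"
    using i1 i2 by simp
  finally show ?thesis using integral_square_identity[OF P U, of 2] by simp
qed

text \<open>The faster rate leaves a surplus: the identity with \<open>c = 3\<close> provides three
  copies of the integral of the squared primitive, while inserting
  \<open>P = z + sgn x * prim P\<close> consumes two. The rate 2 would leave nothing.\<close>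

lemma defect_controls:
  assumes P: "L2 P" and U: "L2 (prim P)"
  shows "(\<integral>x. wt 3 x * (prim P x * prim P x) \<partial>lborel) \<le> 4 * virial_defect P"
    "(\<integral>x. wt 3 x * (P x * P x) \<partial>lborel) \<le> 10 * virial_defect P"
proof -
  define z where "z x = P x - sgn x * prim P x" for x
  have zL: "L2 z" unfolding z_def[abs_def] by (rule defect_L2[OF P U])
  have sw: "(\<lambda>x. sgn x * wt 3 x) \<in> borel_measurable borel" "\<bar>sgn x * wt 3 x\<bar> \<le> 1" for x
    using sgn_measurable wt_measurable[of 3] mult_mono[OF abs_sgn_le_1[of x] wt_abs_bound[of 3 x]]
    by (auto simp: abs_mult)
  have i: "integrable lborel (\<lambda>x. wt 3 x * (prim P x * prim P x))" "integrable lborel (\<lambda>x. wt 3 x * (P x * P x))"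
    "integrable lborel (\<lambda>x. wt 3 x * (z x * z x))" "integrable lborel (\<lambda>x. wt 2 x * (z x * z x))"
    using P U zL by (auto intro!: integrable_weighted[where M=1] wt_measurable wt_abs_bound)
  have j: "integrable lborel (\<lambda>x. wt 3 x * (sgn x * prim P x * P x))"
    using integrable_weighted[OF U P sw] by (simp add: mult_ac)
  have m: "prim P \<in> borel_measurable borel" "P \<in> borel_measurable borel" "z \<in> borel_measurable borel"
    using P U zL by (auto dest: L2_measurable)
  let ?U = "\<integral>x. wt 3 x * (prim P x * prim P x) \<partial>lborel" and ?Z = "\<integral>x. wt 3 x * (z x * z x) \<partial>lborel"
  have ZD: "?Z \<le> virial_defect P"
    unfolding virial_defect_def z_def[symmetric]
  proof (rule integral_mono[OF i(3,4)])
    fix x show "wt 3 x * (z x * z x) \<le> wt 2 x * (z x * z x)"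
      by (intro mult_right_mono) (auto simp: wt_def)
  qed
  \<comment> \<open>Half of the surplus absorbs the cross term with \<open>z\<close>:
    \<open>3 * ?U \<le> 5/2 * ?U + 2 * ?Z\<close> gives the factor 4. The square of
    \<open>z + sgn x * prim P\<close> then costs 2 + 2 * 4 = 10.\<close>
  have "2 * (\<integral>x. wt 3 x * (sgn x * prim P x * P x) \<partial>lborel) \<le> (\<integral>x. 5/2 * (wt 3 x * (prim P x * prim P x)) + 2 * (wt 3 x * (z x * z x)) \<partial>lborel)"
    unfolding integral_mult_right_zero[symmetric]
  proof (rule integral_mono_AE)
    show "AE x in lborel. 2 * (wt 3 x * (sgn x * prim P x * P x)) \<le> 5/2 * (wt 3 x * (prim P x * prim P x)) + 2 * (wt 3 x * (z x * z x))"
      using AE_sgn_square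
    proof eventually_elim
      case (elim x)
      have "P x = z x + sgn x * prim P x" by (simp add: z_def)
      then have "2 * (sgn x * prim P x * P x) = 2 * (sgn x * prim P x) * z x + 2 * (sgn x * sgn x) * (prim P x * prim P x)"
        by (simp add: algebra_simps)
      also have "\<dots> = 2 * (sgn x * prim P x) * z x + 2 * (prim P x * prim P x)" unfolding elim by simp
      also have "2 * (sgn x * prim P x) * z x \<le> 1/2 * ((sgn x * sgn x) * (prim P x * prim P x)) + 2 * (z x * z x)"
        using sum_squares_ge_zero[of "sgn x * prim P x - 2 * z x" 0] by (simp add: algebra_simps)
      finally have "2 * (sgn x * prim P x * P x) \<le> 5/2 * (prim P x * prim P x) + 2 * (z x * z x)" unfolding elim by simp
      from mult_left_mono[OF this less_imp_le[OF wt_pos[of 3 x]]] show ?case by (simp add: algebra_simps)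
    qed
  qed (use i j in auto)
  also have "\<dots> = 5/2 * ?U + 2 * ?Z" using i by simp
  finally have "3 * ?U \<le> 5/2 * ?U + 2 * ?Z" using integral_square_identity[OF P U, of 3] by simp
  then show 1: "?U \<le> 4 * virial_defect P" using ZD by linarith
  have "(\<integral>x. wt 3 x * (P x * P x) \<partial>lborel) \<le> (\<integral>x. 2 * (wt 3 x * (z x * z x)) + 2 * (wt 3 x * (prim P x * prim P x)) \<partial>lborel)"
  proof (rule integral_mono_AE)
    show "AE x in lborel. wt 3 x * (P x * P x) \<le> 2 * (wt 3 x * (z x * z x)) + 2 * (wt 3 x * (prim P x * prim P x))"
      using AE_sgn_square
    proof eventually_elim
      case (elim x)
      have "P x = z x + sgn x * prim P x" by (simp add: z_def)
      then have "P x * P x \<le> 2 * (z x * z x) + 2 * ((sgn x * sgn x) * (prim P x * prim P x))"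
        using square_add_le[of "z x" "sgn x * prim P x"] by (simp add: power2_eq_square algebra_simps)
      from mult_left_mono[OF this less_imp_le[OF wt_pos[of 3 x]]] show ?case unfolding elim by (simp add: algebra_simps)
    qed
  qed (use i in auto)
  also have "\<dots> = 2 * ?Z + 2 * ?U" using i by simp
  finally show "(\<integral>x. wt 3 x * (P x * P x) \<partial>lborel) \<le> 10 * virial_defect P" using 1 ZD by linarith
qed

section \<open>The nonlinear term\<close>

lemma abs_powr_deriv:
  fixes y q :: real
  assumes "q > 1"
  shows "((\<lambda>y. \<bar>y\<bar> powr q) has_real_derivative q * (\<bar>y\<bar> powr (q - 1) * sgn y)) (at y)"
proof (cases "y = 0")
  case False
  have "((\<lambda>r. r powr q) has_real_derivative q * \<bar>y\<bar> powr (q - 1)) (at \<bar>y\<bar>)"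
    using False by (intro has_real_derivative_powr) auto
  from has_derivative_abs_compose(1)[OF this False] show ?thesis by (simp add: mult_ac)
next
  case True
  have "((\<lambda>h. \<bar>h\<bar> powr (q - 1)) \<longlongrightarrow> 0) (at (0::real))"
    using assms by (intro tendsto_zero_powrI[where b="q-1"]) (auto intro!: tendsto_eq_intros)
  then have "((\<lambda>h. (\<bar>0 + h\<bar> powr q - \<bar>0\<bar> powr q) / h) \<longlongrightarrow> 0) (at (0::real))"
  proof (rule Lim_null_comparison[rotated])
    show "\<forall>\<^sub>F h in at (0::real). norm ((\<bar>0 + h\<bar> powr q - \<bar>0\<bar> powr q) / h) \<le> \<bar>h\<bar> powr (q - 1)"
      unfolding eventually_at_filter
    proof (rule always_eventually, intro allI impI)
      fix h :: real assume "h \<noteq> 0"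
      then show "norm ((\<bar>0 + h\<bar> powr q - \<bar>0\<bar> powr q) / h) \<le> \<bar>h\<bar> powr (q - 1)"
        by (simp add: powr_diff abs_divide)
    qed
  qed
  with True show ?thesis by (simp add: DERIV_def)
qed

lemma abs_powr_sgn_continuous:
  fixes r :: real
  assumes "r > 0"
  shows "continuous_on UNIV (\<lambda>y. \<bar>y\<bar> powr r * sgn y)"
proof -
  have "\<bar>y\<bar> powr r * sgn y = (max y 0) powr r - (max (- y) 0) powr r" for y :: real
    by (cases "y > 0"; cases "y = 0") auto
  moreover have "continuous_on UNIV (\<lambda>y. (max y 0) powr r - (max (- y) 0) powr r)"
    using assms by (intro continuous_on_diff continuous_on_powr' continuous_intros) auto
  ultimately show ?thesis by simp
qed

text \<open>Completion of the square in \<open>\<bar>a\<bar> powr (q / 2)\<close> and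
  \<open>\<bar>a\<bar> powr ((q - 2) / 2) * \<bar>z\<bar>\<close>. The coefficient
  \<open>(q - 2) / 2\<close> is half of the surplus \<open>q - 2\<close> that the integration by
  parts in \<open>nonlinear_term_bound\<close> leaves.\<close>

lemma weighted_Young:
  fixes a z q :: real
  assumes q: "q > 2"
  shows "q * (\<bar>a\<bar> powr (q - 1) * \<bar>z\<bar>) \<le> (q - 2) / 2 * \<bar>a\<bar> powr q + q\<^sup>2 / (2 * (q - 2)) * (\<bar>a\<bar> powr (q - 2) * (z * z))"
proof -
  define X Y where "X = \<bar>a\<bar> powr (q / 2)" and "Y = \<bar>a\<bar> powr ((q - 2) / 2) * \<bar>z\<bar>"
  have XY: "\<bar>a\<bar> powr (q - 1) * \<bar>z\<bar> = X * Y" by (simp add: X_def Y_def powr_add[symmetric] diff_divide_distrib)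
  have X: "\<bar>a\<bar> powr q = X * X" by (simp add: X_def powr_add[symmetric])
  have Y: "\<bar>a\<bar> powr (q - 2) * (z * z) = Y * Y"
  proof -
    have "Y * Y = (\<bar>a\<bar> powr ((q - 2) / 2) * \<bar>a\<bar> powr ((q - 2) / 2)) * (\<bar>z\<bar> * \<bar>z\<bar>)" by (simp add: Y_def mult_ac)
    also have "\<dots> = \<bar>a\<bar> powr (q - 2) * (z * z)" by (simp add: powr_add[symmetric])
    finally show ?thesis by simp
  qed
  have "0 \<le> ((q - 2) * X - q * Y)\<^sup>2 / (2 * (q - 2))" using q by simp
  also have "\<dots> = (q - 2) / 2 * (X * X) - q * (X * Y) + q\<^sup>2 / (2 * (q - 2)) * (Y * Y)"
    using q by (simp add: power2_eq_square field_simps)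
  finally show ?thesis unfolding XY X Y by simp
qed

text \<open>In the integration by parts the weight contributes -2 and the power \<open>q\<close>, so
  after \<open>P = z + sgn x * prim P\<close> a positive multiple \<open>q - 2\<close> of the
  left-hand side survives. Young's inequality uses up half of it, and the bound by
  \<open>\<delta>\<close> makes the remaining coefficient of \<open>z * z\<close> small.\<close>

lemma nonlinear_term_bound:
  assumes P: "L2 P" and U: "L2 (prim P)" and q: "q > 2" and small: "\<And>x. \<bar>prim P x\<bar> < \<delta>" "\<delta> < 1"
  shows "(\<integral>x. wt 2 x * \<bar>prim P x\<bar> powr q \<partial>lborel) \<le> q\<^sup>2 * \<delta> powr (q - 2) / (q - 2)\<^sup>2 * virial_defect P"
    and "integrable lborel (\<lambda>x. wt 2 x * \<bar>prim P x\<bar> powr q)"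
proof -
  \<comment> \<open>Up to the factor \<open>q\<close>, the derivative of
    \<open>\<bar>y\<bar> powr q\<close> evaluated along the primitive.\<close>
  define V where "V x = \<bar>prim P x\<bar> powr (q - 1) * sgn (prim P x)" for x
  define z where "z x = P x - sgn x * prim P x" for x
  have zL: "L2 z" unfolding z_def[abs_def] by (rule defect_L2[OF P U])
  have m: "prim P \<in> borel_measurable borel" "P \<in> borel_measurable borel" using P U by (auto dest: L2_measurable)
  have ub: "\<bar>prim P x\<bar> \<le> 1" for x using small(1)[of x] small(2) by simp
  have powr_le: "\<bar>prim P x\<bar> powr r \<le> \<bar>prim P x\<bar>" if "r \<ge> 1" for r x
    using powr_mono'[of 1 r "\<bar>prim P x\<bar>"] ub[of x] that by simp
  have powr_le2: "\<bar>prim P x\<bar> powr q \<le> prim P x * prim P x" for x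
  proof -
    have "\<bar>prim P x\<bar> powr q = \<bar>prim P x\<bar> powr (q - 1) * \<bar>prim P x\<bar> powr 1" unfolding powr_add[symmetric] by simp
    also have "\<dots> \<le> \<bar>prim P x\<bar> * \<bar>prim P x\<bar>" using powr_le[of "q - 1" x] q by (intro mult_mono) auto
    finally show ?thesis by simp
  qed
  have VL: "L2 V"
  proof (rule L2I_dominated[OF _ L2_integrable_sq[OF U]], unfold V_def)
    show "(\<lambda>x. \<bar>prim P x\<bar> powr (q - 1) * sgn (prim P x)) \<in> borel_measurable borel"
      using m sgn_measurable by measurable
    show "AE x in lborel. (\<bar>prim P x\<bar> powr (q - 1) * sgn (prim P x))\<^sup>2 \<le> (prim P x)\<^sup>2"
    proof (rule AE_I2)
      fix x
      have "\<bar>\<bar>prim P x\<bar> powr (q - 1) * sgn (prim P x)\<bar> \<le> \<bar>prim P x\<bar> * 1"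
        unfolding abs_mult using powr_le[of "q - 1" x] q abs_sgn_le_1[of "prim P x"] by (intro mult_mono) auto
      then show "(\<bar>prim P x\<bar> powr (q - 1) * sgn (prim P x))\<^sup>2 \<le> (prim P x)\<^sup>2"
        by (simp add: abs_le_square_iff)
    qed
  qed
  have wq: "\<bar>c * \<bar>prim P x\<bar> powr q\<bar> \<le> 1 * (prim P x * prim P x)" if "\<bar>c\<bar> \<le> 1" for c x
    unfolding abs_mult using that powr_le2[of x] by (intro mult_mono) auto
  show i1: "integrable lborel (\<lambda>x. wt 2 x * \<bar>prim P x\<bar> powr q)"
  proof (rule integrable_dominated_sq[OF U _ wq[OF wt_abs_bound]])
    show "(\<lambda>x. wt 2 x * \<bar>prim P x\<bar> powr q) \<in> borel_measurable borel"
      using m(1) wt_measurable[of 2] by (intro borel_measurable_times powr_real_measurable borel_measurable_abs borel_measurable_const)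
  qed simp
  have sw: "(\<lambda>x. sgn x * wt 2 x) \<in> borel_measurable borel" "\<bar>sgn x * wt 2 x\<bar> \<le> 1" for x
    using sgn_measurable wt_measurable[of 2] mult_mono[OF abs_sgn_le_1[of x] wt_abs_bound[of 2 x]]
    by (auto simp: abs_mult)
  have i2: "integrable lborel (\<lambda>x. sgn x * wt 2 x * (V x * P x))"
    by (rule integrable_weighted[OF VL P sw])
  have i3: "integrable lborel (\<lambda>x. wt 2 x * (z x * z x))"
    by (rule integrable_weighted[OF zL zL wt_measurable wt_abs_bound]) simp
  have kd: "((\<lambda>y. exp (- (2 * y))) has_real_derivative - 2 * exp (- (2 * y))) (at y)" for y :: real
    by (auto intro!: derivative_eq_intros)
  have e: "- 2 * exp (- (2 * \<bar>x\<bar>)) * \<bar>prim P x\<bar> powr q + sgn x * exp (- (2 * \<bar>x\<bar>)) * (q * (\<bar>prim P x\<bar> powr (q - 1) * sgn (prim P x))) * P x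
     = (- 2) * (wt 2 x * \<bar>prim P x\<bar> powr q) + q * (sgn x * wt 2 x * (V x * P x))" for x
    by (simp add: wt_def V_def mult_ac)
  have zero: "(\<integral>x. - 2 * exp (- (2 * \<bar>x\<bar>)) * \<bar>prim P x\<bar> powr q + sgn x * exp (- (2 * \<bar>x\<bar>)) * (q * (\<bar>prim P x\<bar> powr (q - 1) * sgn (prim P x))) * P x \<partial>lborel) = 0"
  proof (rule chain_rule_line[OF P kd _ abs_powr_deriv])
    show "integrable lborel (\<lambda>x. - 2 * exp (- (2 * \<bar>x\<bar>)) * \<bar>prim P x\<bar> powr q + sgn x * exp (- (2 * \<bar>x\<bar>)) * (q * (\<bar>prim P x\<bar> powr (q - 1) * sgn (prim P x))) * P x)"
      unfolding e using i1 i2 by simp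
    show "integrable lborel (\<lambda>x. exp (- (2 * \<bar>x\<bar>)) * \<bar>prim P x\<bar> powr q)" using i1 by (simp add: wt_def)
    show "continuous_on UNIV (\<lambda>y. q * (\<bar>y\<bar> powr (q - 1) * sgn y))"
      using q by (intro continuous_on_mult continuous_on_const abs_powr_sgn_continuous) auto
  qed (use q in \<open>auto intro!: continuous_intros\<close>)
  let ?Q = "q\<^sup>2 / (2 * (q - 2)) * \<delta> powr (q - 2)"
  have "(\<integral>x. (q - 2) / 2 * (wt 2 x * \<bar>prim P x\<bar> powr q) - ?Q * (wt 2 x * (z x * z x)) \<partial>lborel) \<le>
     (\<integral>x. (- 2) * (wt 2 x * \<bar>prim P x\<bar> powr q) + q * (sgn x * wt 2 x * (V x * P x)) \<partial>lborel)"
  proof (rule integral_mono_AE)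
    show "AE x in lborel. (q - 2) / 2 * (wt 2 x * \<bar>prim P x\<bar> powr q) - ?Q * (wt 2 x * (z x * z x)) \<le>
      (- 2) * (wt 2 x * \<bar>prim P x\<bar> powr q) + q * (sgn x * wt 2 x * (V x * P x))"
      using AE_sgn_square
    proof eventually_elim
      case (elim x)
      let ?u = "prim P x"
      have "?u * V x = \<bar>?u\<bar> powr q"
      proof -
        have "?u * V x = \<bar>?u\<bar> powr (q - 1) * \<bar>?u\<bar> powr 1" by (simp add: V_def sgn_if)
        then show ?thesis unfolding powr_add[symmetric] by simp
      qed
      moreover have "sgn x * (V x * P x) = sgn x * (V x * z x) + (sgn x * sgn x) * (?u * V x)"
        by (simp add: z_def algebra_simps)
      ultimately have s: "sgn x * (V x * P x) = sgn x * (V x * z x) + \<bar>?u\<bar> powr q" unfolding elim by simp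
      have "\<bar>sgn x * (V x * z x)\<bar> \<le> \<bar>?u\<bar> powr (q - 1) * \<bar>z x\<bar>"
      proof -
        have "\<bar>sgn x * (V x * z x)\<bar> = \<bar>sgn x\<bar> * (\<bar>sgn ?u\<bar> * (\<bar>?u\<bar> powr (q - 1) * \<bar>z x\<bar>))"
          by (simp add: V_def abs_mult mult_ac)
        also have "\<dots> \<le> 1 * (1 * (\<bar>?u\<bar> powr (q - 1) * \<bar>z x\<bar>))"
          using abs_sgn_le_1 by (intro mult_mono) auto
        finally show ?thesis by simp
      qed
      then have "q * (sgn x * (V x * z x)) \<ge> - (q * (\<bar>?u\<bar> powr (q - 1) * \<bar>z x\<bar>))"
        using q mult_left_mono[of "- (sgn x * (V x * z x))" "\<bar>?u\<bar> powr (q - 1) * \<bar>z x\<bar>" q] by (simp add: abs_le_iff)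
      moreover have "q * (\<bar>?u\<bar> powr (q - 1) * \<bar>z x\<bar>) \<le> (q - 2) / 2 * \<bar>?u\<bar> powr q + ?Q * (z x * z x)"
      proof -
        have "\<bar>?u\<bar> powr (q - 2) \<le> \<delta> powr (q - 2)" using small(1)[of x] q by (intro powr_mono2) auto
        then have "\<bar>?u\<bar> powr (q - 2) * (z x * z x) \<le> \<delta> powr (q - 2) * (z x * z x)" by (rule mult_right_mono) simp
        then have "q\<^sup>2 / (2 * (q - 2)) * (\<bar>?u\<bar> powr (q - 2) * (z x * z x)) \<le> q\<^sup>2 / (2 * (q - 2)) * (\<delta> powr (q - 2) * (z x * z x))"
          using q by (intro mult_left_mono) auto
        then show ?thesis using weighted_Young[OF q, of ?u "z x"] by (simp add: mult.assoc)
      qed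
      \<comment> \<open>\<open>A\<close> is the power, \<open>S\<close> the cross term with
        \<open>z\<close>, \<open>Y\<close> its bound and \<open>W\<close> the part of that bound
        that is quadratic in \<open>z\<close>.\<close>
      moreover have "(q - 2) / 2 * A - W \<le> - 2 * A + q * (S + A)"
        if "- Y \<le> q * S" "Y \<le> (q - 2) / 2 * A + W" for A W S Y :: real
      proof -
        have "q * (S + A) = q * S + 2 * ((q - 2) / 2 * A) + 2 * A" by (simp add: field_simps)
        then show ?thesis using that by linarith
      qed
      ultimately have "(q - 2) / 2 * \<bar>?u\<bar> powr q - ?Q * (z x * z x) \<le> - 2 * \<bar>?u\<bar> powr q + q * (sgn x * (V x * P x))"
        unfolding s by blast
      from mult_left_mono[OF this less_imp_le[OF wt_pos[of 2 x]]] show ?case by (simp add: algebra_simps)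
    qed
  qed (use i1 i2 i3 in auto)
  also have "\<dots> = 0" using zero unfolding e .
  finally have "(q - 2) / 2 * (\<integral>x. wt 2 x * \<bar>prim P x\<bar> powr q \<partial>lborel) \<le> ?Q * virial_defect P"
    using i1 i3 by (simp add: virial_defect_def z_def[symmetric])
  then have "(2 / (q - 2)) * ((q - 2) / 2 * (\<integral>x. wt 2 x * \<bar>prim P x\<bar> powr q \<partial>lborel)) \<le> (2 / (q - 2)) * (?Q * virial_defect P)"
    using q by (intro mult_left_mono) auto
  moreover have "(2 / (q - 2)) * ((q - 2) / 2 * (\<integral>x. wt 2 x * \<bar>prim P x\<bar> powr q \<partial>lborel)) = (\<integral>x. wt 2 x * \<bar>prim P x\<bar> powr q \<partial>lborel)"
    using q by simp
  moreover have "(2 / (q - 2)) * (?Q * virial_defect P) = q\<^sup>2 * \<delta> powr (q - 2) / (q - 2)\<^sup>2 * virial_defect P"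
  proof -
    have "(2 / r) * ((s / (2 * r) * d) * v) = s * d / r\<^sup>2 * v" for r s d v :: real
      by (simp add: power2_eq_square)
    then show ?thesis .
  qed
  ultimately show "(\<integral>x. wt 2 x * \<bar>prim P x\<bar> powr q \<partial>lborel) \<le> q\<^sup>2 * \<delta> powr (q - 2) / (q - 2)\<^sup>2 * virial_defect P"
    by simp
qed

text \<open>\<open>F\<close> is the potential of \<open>f\<close>, and
  \<open>y * f y / 2 - F y\<close> is what the virial identity retains of the nonlinearity: a linear
  force gives zero in this expression. The last assumption limits its contribution to half of the
  defect.\<close>

locale virial = small_odd_solution +
  fixes F :: "real \<Rightarrow> real" and q :: real
  assumes F_deriv: "\<And>y. (F has_real_derivative f y) (at y)" and F_0: "F 0 = 0"
    and q: "q > 2" and f_F_bound: "\<And>y. \<bar>y\<bar> < 1 \<Longrightarrow> \<bar>y * f y / 2 - F y\<bar> \<le> C * \<bar>y\<bar> powr q"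
    and \<delta>_small: "C * (q\<^sup>2 * \<delta> powr (q - 2) / (q - 2)\<^sup>2) \<le> 1 / 2"
begin

text \<open>A statement at a fixed time, whose left-hand side turns out to be the time derivative of
  \<open>virial_I\<close>. The first two terms integrate to minus the defect; the other two combine,
  after an integration by parts, into the nonlinear remainder, which consumes at most half of
  it.\<close>

lemma virial_static:
  assumes t: "t \<ge> 0"
  shows "(\<integral>x. - (wt 2 x * (p t x * p t x)) + wt 2 x * (sgn x * u t x * p t x) + psi x * (g t x * p t x) + 1/2 * (wt 2 x * (u t x * g t x)) \<partial>lborel)
     \<le> - (1/2) * virial_defect (p t)"
proof -
  have P: "L2 (p t)" and U: "L2 (u t)" and G: "L2 (g t)" by (intro regularity u_L2 g_L2 t)+
  have U': "L2 (prim (p t))" using U by (simp add: u_def)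
  have Fm: "F \<in> borel_measurable borel"
    using F_deriv by (intro borel_measurable_continuous_onI) (auto simp: continuous_on_eq_continuous_at intro: DERIV_isCont)
  have um: "u t \<in> borel_measurable borel" using U by (rule L2_measurable)
  \<comment> \<open>The full potential of the force \<open>g\<close>, with its linear part.\<close>
  define GG where "GG y = m / 2 * (y * y) + F y" for y
  have ub: "\<bar>u t x\<bar> < 1" for x by (rule u_small(2)[OF t])
  \<comment> \<open>A crude quadratic bound that serves integrability; the small factor comes from
    the separate power estimate below.\<close>
  have Fb: "\<bar>F (u t x)\<bar> \<le> 2 * C * (u t x * u t x)" for x
  proof -
    have "\<bar>u t x\<bar> powr q \<le> \<bar>u t x\<bar> powr 2" using powr_mono'[of 2 q "\<bar>u t x\<bar>"] ub[of x] q by simp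
    also have "\<dots> = u t x * u t x" by (simp add: powr_numeral power2_eq_square flip: abs_mult)
    finally have "C * \<bar>u t x\<bar> powr q \<le> C * (u t x * u t x)" using C by (intro mult_left_mono) auto
    moreover have "\<bar>u t x * f (u t x) / 2\<bar> \<le> C * (u t x * u t x)"
    proof -
      have "\<bar>u t x\<bar> * \<bar>f (u t x)\<bar> \<le> \<bar>u t x\<bar> * (C * \<bar>u t x\<bar>)" by (intro mult_left_mono g_L2_bound(1)[OF t]) auto
      moreover have "0 \<le> \<bar>u t x\<bar> * (C * \<bar>u t x\<bar>)" using C by auto
      moreover have "\<bar>u t x\<bar> * (C * \<bar>u t x\<bar>) = C * (u t x * u t x)" by (simp flip: abs_mult)
      ultimately show ?thesis by (simp add: abs_mult)
    qed
    ultimately show ?thesis using f_F_bound[OF ub[of x]] by (simp add: mult.assoc)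
  qed
  have GGb: "\<bar>c * GG (u t x)\<bar> \<le> (\<bar>m\<bar> + 2 * C) * (u t x * u t x)" if "\<bar>c\<bar> \<le> 1" for c x
  proof -
    have "\<bar>c * GG (u t x)\<bar> \<le> 1 * \<bar>GG (u t x)\<bar>" unfolding abs_mult using that by (intro mult_right_mono) auto
    also have "\<bar>GG (u t x)\<bar> \<le> \<bar>m / 2 * (u t x * u t x)\<bar> + \<bar>F (u t x)\<bar>" unfolding GG_def by (rule abs_triangle_ineq)
    also have "\<bar>m / 2 * (u t x * u t x)\<bar> \<le> \<bar>m\<bar> * (u t x * u t x)" by (simp add: abs_mult)
    finally show ?thesis using Fb[of x] by (simp add: distrib_right)
  qed
  have GGm: "(\<lambda>x. GG (u t x)) \<in> borel_measurable borel" unfolding GG_def using um Fm by measurable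
  have iGG: "integrable lborel (\<lambda>x. c x * GG (u t x))" if "c \<in> borel_measurable borel" "\<And>x. \<bar>c x\<bar> \<le> 1" for c
    by (rule integrable_dominated_sq[OF U borel_measurable_times[OF that(1) GGm] GGb[OF that(2)]])
  have w: "\<bar>wt 2 x\<bar> \<le> 1" for x by (rule wt_abs_bound) simp
  have i: "integrable lborel (\<lambda>x. wt 2 x * (p t x * p t x))" "integrable lborel (\<lambda>x. wt 2 x * (u t x * u t x))"
     "integrable lborel (\<lambda>x. wt 2 x * (u t x * g t x))" "integrable lborel (\<lambda>x. psi x * (g t x * p t x))"
    by (rule integrable_weighted[OF P P wt_measurable w] integrable_weighted[OF U U wt_measurable w]
        integrable_weighted[OF U G wt_measurable w] integrable_weighted[OF G P psi_measurable psi_bound])+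
  have sw: "(\<lambda>x. sgn x * wt 2 x) \<in> borel_measurable borel" "\<bar>sgn x * wt 2 x\<bar> \<le> 1" for x
    using sgn_measurable wt_measurable[of 2] mult_mono[OF abs_sgn_le_1[of x] w[of x]]
    by (auto simp: abs_mult)
  have j: "integrable lborel (\<lambda>x. wt 2 x * (sgn x * u t x * p t x))"
    using integrable_weighted[OF U P sw] by (simp add: mult_ac)
  have kd: "((\<lambda>y. (1 - exp (- (2 * y))) / 2) has_real_derivative exp (- (2 * y))) (at y)" for y :: real
    by (auto intro!: derivative_eq_intros)
  have hd: "(GG has_real_derivative m * y + f y) (at y)" for y
    unfolding GG_def[abs_def] by (auto intro!: derivative_eq_intros F_deriv)
  have e: "exp (- (2 * \<bar>x\<bar>)) * GG (prim (p t) x) + sgn x * ((1 - exp (- (2 * \<bar>x\<bar>))) / 2) * (m * prim (p t) x + f (prim (p t) x)) * p t x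
     = wt 2 x * GG (u t x) + psi x * (g t x * p t x)" for x
    by (simp add: wt_def psi_def u_def g_def mult_ac)
  have kb: "\<bar>(1 - exp (- (2 * \<bar>x\<bar>))) / 2\<bar> \<le> 1" for x :: real
    by (rule half_one_minus_bound) simp_all
  have "(\<integral>x. exp (- (2 * \<bar>x\<bar>)) * GG (prim (p t) x) + sgn x * ((1 - exp (- (2 * \<bar>x\<bar>))) / 2) * (m * prim (p t) x + f (prim (p t) x)) * p t x \<partial>lborel) = 0"
  proof (rule chain_rule_line[OF P kd _ hd])
    show "integrable lborel (\<lambda>x. exp (- (2 * \<bar>x\<bar>)) * GG (prim (p t) x) + sgn x * ((1 - exp (- (2 * \<bar>x\<bar>))) / 2) * (m * prim (p t) x + f (prim (p t) x)) * p t x)"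
      unfolding e using iGG[OF wt_measurable w] i(4) by simp
    have "integrable lborel (\<lambda>x. (1 - exp (- (2 * \<bar>x\<bar>))) / 2 * GG (u t x))" by (rule iGG[OF _ kb]) measurable
    then show "integrable lborel (\<lambda>x. (1 - exp (- (2 * \<bar>x\<bar>))) / 2 * GG (prim (p t) x))" by (simp add: u_def)
    show "continuous_on UNIV (\<lambda>y. m * y + f y)" by (intro continuous_intros f_cont)
    show "GG 0 = 0" by (simp add: GG_def F_0)
  qed (auto intro!: continuous_intros)
  \<comment> \<open>The product \<open>g * p\<close> is the space derivative of the potential, so
    \<open>psi\<close> may be traded for its derivative \<open>wt 2\<close>.\<close>
  then have z: "(\<integral>x. wt 2 x * GG (u t x) \<partial>lborel) + (\<integral>x. psi x * (g t x * p t x) \<partial>lborel) = 0"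
    unfolding e using iGG[OF wt_measurable w] i(4) by simp
  have sq: "(\<integral>x. wt 2 x * (sgn x * u t x * p t x) \<partial>lborel) = (\<integral>x. wt 2 x * (u t x * u t x) \<partial>lborel)"
    using integral_square_identity[OF P U', of 2] by (simp add: u_def)
  have D: "virial_defect (p t) = (\<integral>x. wt 2 x * (p t x * p t x) \<partial>lborel) - (\<integral>x. wt 2 x * (u t x * u t x) \<partial>lborel)"
    using virial_defect_eq[OF P U'] by (simp add: u_def)
  have small': "\<And>x. \<bar>prim (p t) x\<bar> < \<delta>" using u_small(1)[OF t] by (simp add: u_def)
  note nl = nonlinear_term_bound[OF P U' q small' \<delta>]
  have "(\<integral>x. 1/2 * (wt 2 x * (u t x * g t x)) - wt 2 x * GG (u t x) \<partial>lborel) \<le> (\<integral>x. C * (wt 2 x * \<bar>u t x\<bar> powr q) \<partial>lborel)"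
  proof (rule integral_mono)
    show "integrable lborel (\<lambda>x. C * (wt 2 x * \<bar>u t x\<bar> powr q))" using nl(2) by (simp add: u_def)
    show "integrable lborel (\<lambda>x. 1/2 * (wt 2 x * (u t x * g t x)) - wt 2 x * GG (u t x))"
      using iGG[OF wt_measurable w] i(3) by simp
    fix x
    \<comment> \<open>Here \<open>m\<close> cancels: half of \<open>u * (m * u)\<close> is its
      potential.\<close>
    have "1/2 * (u t x * g t x) - GG (u t x) = u t x * f (u t x) / 2 - F (u t x)" by (simp add: g_def GG_def algebra_simps)
    also have "\<dots> \<le> C * \<bar>u t x\<bar> powr q" using f_F_bound[OF ub[of x]] by linarith
    finally have "1/2 * (u t x * g t x) - GG (u t x) \<le> C * \<bar>u t x\<bar> powr q" .
    from mult_left_mono[OF this less_imp_le[OF wt_pos[of 2 x]]]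
    show "1/2 * (wt 2 x * (u t x * g t x)) - wt 2 x * GG (u t x) \<le> C * (wt 2 x * \<bar>u t x\<bar> powr q)"
      by (simp add: algebra_simps)
  qed
  also have "\<dots> = C * (\<integral>x. wt 2 x * \<bar>u t x\<bar> powr q \<partial>lborel)" by simp
  also have "\<dots> \<le> C * (q\<^sup>2 * \<delta> powr (q - 2) / (q - 2)\<^sup>2 * virial_defect (p t))"
    using nl(1) C by (intro mult_left_mono) (auto simp: u_def)
  also have "\<dots> = C * (q\<^sup>2 * \<delta> powr (q - 2) / (q - 2)\<^sup>2) * virial_defect (p t)" by simp
  also have "\<dots> \<le> 1/2 * virial_defect (p t)"
  proof (rule mult_right_mono[OF \<delta>_small])
    show "0 \<le> virial_defect (p t)" unfolding virial_defect_def
      by (intro integral_nonneg_AE AE_I2 mult_nonneg_nonneg[OF less_imp_le[OF wt_pos] zero_le_square])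
  qed
  finally have N: "1/2 * (\<integral>x. wt 2 x * (u t x * g t x) \<partial>lborel) - (\<integral>x. wt 2 x * GG (u t x) \<partial>lborel) \<le> 1/2 * virial_defect (p t)"
    using iGG[OF wt_measurable w] i(3) by simp
  have "(\<integral>x. - (wt 2 x * (p t x * p t x)) + wt 2 x * (sgn x * u t x * p t x) + psi x * (g t x * p t x) + 1/2 * (wt 2 x * (u t x * g t x)) \<partial>lborel)
    = - (\<integral>x. wt 2 x * (p t x * p t x) \<partial>lborel) + (\<integral>x. wt 2 x * (sgn x * u t x * p t x) \<partial>lborel) + (\<integral>x. psi x * (g t x * p t x) \<partial>lborel)
      + 1/2 * (\<integral>x. wt 2 x * (u t x * g t x) \<partial>lborel)"
    using i j by simp
  then show ?thesis using z sq D N by linarith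
qed

end


section \<open>Decay of the local energy\<close>

text \<open>The growth bound, read backwards, says that \<open>E\<close> on
  \<open>{t - 1..t}\<close> is at least exp (-K) times \<open>E t\<close>. Hence \<open>V\<close>
  drops over that unit interval by at least this amount, and the drops of a bounded decreasing
  function tend to zero.\<close>

lemma Lyapunov_decay:
  fixes E V E' V' :: "real \<Rightarrow> real"
  assumes E: "\<And>t. t > 0 \<Longrightarrow> (E has_real_derivative E' t) (at t)"
    and V: "\<And>t. t > 0 \<Longrightarrow> (V has_real_derivative V' t) (at t)"
    and "\<And>t. t > 0 \<Longrightarrow> 0 \<le> E t" "\<And>t. t > 0 \<Longrightarrow> E' t \<le> K * E t" "\<And>t. t > 0 \<Longrightarrow> V' t \<le> - E t"
    and bd: "\<And>t. t > 0 \<Longrightarrow> \<bar>V t\<bar> \<le> M" and K: "K \<ge> 0"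
  shows "(E \<longlongrightarrow> 0) at_top"
proof -
  have key: "E t \<le> exp K * (V (t - 1) - V t)" if t: "t > 1" for t
  proof -
    have grow: "E t \<le> exp K * E s" if s: "t - 1 \<le> s" "s \<le> t" for s
    proof -
      have "exp (- K * t) * E t \<le> exp (- K * s) * E s"
      proof (rule DERIV_nonpos_imp_nonincreasing[OF s(2), of "\<lambda>x. exp (- K * x) * E x"])
        fix x assume x: "s \<le> x" "x \<le> t"
        then have "x > 0" using s t by linarith
        have "((\<lambda>x. exp (- K * x) * E x) has_real_derivative exp (- K * x) * (- K) * E x + E' x * exp (- K * x)) (at x)"
          by (rule DERIV_mult[OF _ E[OF \<open>x > 0\<close>]]) (auto intro!: derivative_eq_intros)
        moreover have "exp (- K * x) * (- K) * E x + E' x * exp (- K * x) = exp (- K * x) * (E' x - K * E x)"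
          by (simp add: algebra_simps)
        moreover have "\<dots> \<le> 0" using assms(4)[OF \<open>x > 0\<close>] by (intro mult_nonneg_nonpos) auto
        ultimately show "\<exists>y. ((\<lambda>x. exp (- K * x) * E x) has_real_derivative y) (at x) \<and> y \<le> 0" by auto
      qed
      then have "exp (K * t) * (exp (- K * t) * E t) \<le> exp (K * t) * (exp (- K * s) * E s)" by (intro mult_left_mono) auto
      then have "E t \<le> exp (K * (t - s)) * E s" by (simp add: mult.assoc[symmetric] exp_add[symmetric] right_diff_distrib)
      also have "\<dots> \<le> exp K * E s"
        using s t K assms(3)[of s] mult_left_mono[of "t - s" 1 K] by (intro mult_right_mono) auto
      finally show ?thesis .
    qed
    \<comment> \<open>Adding a linear function with frozen slope lets monotonicity replace the
      integration of \<open>E\<close> over the unit interval.\<close>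
    have "V t + exp (- K) * E t * t \<le> V (t - 1) + exp (- K) * E t * (t - 1)"
    proof (rule DERIV_nonpos_imp_nonincreasing[of "t - 1" t "\<lambda>x. V x + exp (- K) * E t * x"])
      fix x assume x: "t - 1 \<le> x" "x \<le> t"
      then have "x > 0" using t by linarith
      have "((\<lambda>x. V x + exp (- K) * E t * x) has_real_derivative V' x + exp (- K) * E t) (at x)"
        by (auto intro!: derivative_eq_intros V[OF \<open>x > 0\<close>])
      moreover have "exp (- K) * E t \<le> E x"
        using mult_left_mono[OF grow[OF x], of "exp (- K)"] by (simp add: mult.assoc[symmetric] exp_add[symmetric])
      then have "V' x + exp (- K) * E t \<le> 0" using assms(5)[OF \<open>x > 0\<close>] by linarith
      ultimately show "\<exists>y. ((\<lambda>x. V x + exp (- K) * E t * x) has_real_derivative y) (at x) \<and> y \<le> 0" by auto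
    qed simp
    then have "exp (- K) * E t \<le> V (t - 1) - V t" by (simp add: algebra_simps)
    from mult_left_mono[OF this, of "exp K"] show ?thesis by (simp add: mult.assoc[symmetric] exp_add[symmetric])
  qed
  have mono: "V b \<le> V a" if "0 < a" "a \<le> b" for a b
  proof (rule DERIV_nonpos_imp_nonincreasing[OF that(2), of V])
    fix x assume "a \<le> x" "x \<le> b"
    then have "x > 0" using that by linarith
    then show "\<exists>y. (V has_real_derivative y) (at x) \<and> y \<le> 0" using V[of x] assms(3)[of x] assms(5)[of x] by fastforce
  qed
  define L where "L = (INF t\<in>{0<..}. V t)"
  have below: "bdd_below (V ` {0<..})" 
  proof (rule bdd_belowI2)
    fix t :: real assume "t \<in> {0<..}"
    then show "- M \<le> V t" using bd[of t] by (simp add: abs_le_iff)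
  qed
  have limV: "(V \<longlongrightarrow> L) at_top"
  proof (rule order_tendstoI)
    fix y assume "y < L"
    show "\<forall>\<^sub>F t in at_top. y < V t"
      using eventually_gt_at_top[of "0::real"]
    proof eventually_elim
      case (elim t)
      have "L \<le> V t" unfolding L_def using elim by (intro cINF_lower below) auto
      with \<open>y < L\<close> show ?case by simp
    qed
  next
    fix y assume "L < y"
    then obtain s where s: "s > 0" "V s < y"
      unfolding L_def using below by (subst (asm) cINF_less_iff) auto
    show "\<forall>\<^sub>F t in at_top. V t < y"
      using eventually_ge_at_top[of s] by eventually_elim (use mono[of s] s in force)
  qed
  have "((\<lambda>t. V (t - 1)) \<longlongrightarrow> L) at_top"
    by (rule filterlim_compose[OF limV]) real_asymp
  then have "((\<lambda>t. exp K * (V (t - 1) - V t)) \<longlongrightarrow> exp K * (L - L)) at_top" by (intro tendsto_intros limV)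
  then have lim: "((\<lambda>t. exp K * (V (t - 1) - V t)) \<longlongrightarrow> 0) at_top" by simp
  show ?thesis
  proof (rule real_tendsto_sandwich[OF _ _ tendsto_const lim])
    show "\<forall>\<^sub>F t in at_top. 0 \<le> E t" using eventually_gt_at_top[of "0::real"] by eventually_elim (rule assms(3))
    show "\<forall>\<^sub>F t in at_top. E t \<le> exp K * (V (t - 1) - V t)" using eventually_gt_at_top[of "1::real"] by eventually_elim (rule key)
  qed
qed

lemma ip_weighted_bound:
  assumes "L2 a" "L2 b" "c \<in> borel_measurable borel" "\<And>x. \<bar>c x\<bar> \<le> 1" "ip a a \<le> K" "ip b b \<le> K"
  shows "\<bar>ip (\<lambda>x. c x * a x) b\<bar> \<le> K"
proof -
  have "\<bar>ip (\<lambda>x. c x * a x) b\<bar> \<le> (\<integral>x. \<bar>c x * a x * b x\<bar> \<partial>lborel)"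
    unfolding ip_def by (rule integral_abs_bound)
  also have "\<dots> \<le> (\<integral>x. 1/2 * (a x)\<^sup>2 + 1/2 * (b x)\<^sup>2 \<partial>lborel)"
  proof (rule integral_mono)
    show "integrable lborel (\<lambda>x. \<bar>c x * a x * b x\<bar>)"
      by (intro integrable_abs L2_integrable_mult L2_bounded_mult[OF assms(1,3,4)] assms(2))
    show "integrable lborel (\<lambda>x. 1/2 * (a x)\<^sup>2 + 1/2 * (b x)\<^sup>2)"
      using L2_integrable_sq[OF assms(1)] L2_integrable_sq[OF assms(2)] by simp
    fix x
    have "\<bar>c x * a x * b x\<bar> = \<bar>c x\<bar> * \<bar>a x * b x\<bar>" by (simp add: abs_mult)
    also have "\<dots> \<le> 1 * \<bar>a x * b x\<bar>" using assms(4)[of x] by (intro mult_right_mono) auto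
    finally show "\<bar>c x * a x * b x\<bar> \<le> 1/2 * (a x)\<^sup>2 + 1/2 * (b x)\<^sup>2"
      using two_mult_le_squares[of "a x" "b x"] by simp
  qed
  also have "\<dots> = 1/2 * ip a a + 1/2 * ip b b"
    using L2_integrable_sq[OF assms(1)] L2_integrable_sq[OF assms(2)] by (simp add: ip_self_eq)
  also have "\<dots> \<le> K" using assms(5,6) by linarith
  finally show ?thesis .
qed

lemma integrable_weighted':
  assumes "L2 a" "L2 b" "c \<in> borel_measurable borel" "\<And>x. \<bar>c x\<bar> \<le> M"
  shows "integrable lborel (\<lambda>x. c x * a x * b x)"
  by (rule L2_integrable_mult[OF L2_bounded_mult[OF assms(1,3,4)] assms(2)])

context virial
begin

text \<open>\<open>rp\<close> and \<open>rm\<close> are the Riemann invariants of the wave operator: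
  up to the force \<open>g\<close>, the first is carried to the left and the second to the right
  with unit speed.\<close>

definition rp :: "real \<Rightarrow> real \<Rightarrow> real" where "rp t x = u2 t x + p t x"

definition rm :: "real \<Rightarrow> real \<Rightarrow> real" where "rm t x = u2 t x - p t x"

lemma transports: "transported 1 rp g" "transported (-1) rm g" "transported 1 u rm" "transported (-1) u rp"
  using transported_characteristic[of 1] transported_characteristic[of "-1"] transported_u[of 1] transported_u[of "-1"]
  by (simp_all add: rp_def[abs_def] rm_def[abs_def])

lemma rp_rm_L2: "t \<ge> 0 \<Longrightarrow> L2 (rp t)" "t \<ge> 0 \<Longrightarrow> L2 (rm t)"
  unfolding rp_def[abs_def] rm_def[abs_def] by (intro L2_add L2_diff regularity; simp)+

lemmas psi_derivative = transported_bilinear_derivative[where c=psi and c'="wt 2" and M=1, OF _ _ _ psi_measurable psi_bound psi_Lipschitz psi_deriv wt_measurable]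

lemma wt_derivative:
  assumes "transported \<sigma> A a" "transported \<sigma> B b" "t > 0" "c \<ge> 1"
  shows "((\<lambda>t. ip (\<lambda>x. wt c x * A t x) (B t)) has_real_derivative
     - \<sigma> * ip (\<lambda>x. wtd c x * A t x) (B t) + ip (\<lambda>x. wt c x * a t x) (B t) + ip (\<lambda>x. wt c x * A t x) (b t)) (at t)"
proof (rule transported_bilinear_derivative[where M=c, OF assms(1-3) wt_measurable _ wt_Lipschitz wt_deriv wtd_measurable])
  show "\<bar>wt c x\<bar> \<le> c" for x using wt_abs_bound[of c x] assms(4) by simp
qed (use assms(4) in auto)

text \<open>The first bracket is the pairing of \<open>psi * p\<close> with \<open>u2\<close>, the
  second half that of \<open>wt 2 * u\<close> with \<open>u2\<close>. In this form each product
  consists of factors with a common direction of transport, as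
  \<open>transported_bilinear_derivative\<close> demands.\<close>

definition virial_I :: "real \<Rightarrow> real" where
  "virial_I t = 1/4 * (ip (\<lambda>x. psi x * rp t x) (rp t) - ip (\<lambda>x. psi x * rm t x) (rm t))
    + 1/4 * (ip (\<lambda>x. wt 2 x * u t x) (rp t) + ip (\<lambda>x. wt 2 x * u t x) (rm t))"

definition virial_J :: "real \<Rightarrow> real" where
  "virial_J t = 1/2 * (ip (\<lambda>x. wt 3 x * u t x) (rp t) + ip (\<lambda>x. wt 3 x * u t x) (rm t))"

definition local_energy :: "real \<Rightarrow> real" where
  "local_energy t = ip (\<lambda>x. wt 3 x * u t x) (u t) + 1/2 * ip (\<lambda>x. wt 3 x * rp t x) (rp t) + 1/2 * ip (\<lambda>x. wt 3 x * rm t x) (rm t)"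

lemma weighted_integrable:
  assumes "L2 a" "L2 b"
  shows "integrable lborel (\<lambda>x. psi x * a x * b x)" "integrable lborel (\<lambda>x. wt 2 x * a x * b x)"
    "integrable lborel (\<lambda>x. wt 3 x * a x * b x)" "integrable lborel (\<lambda>x. wtd 2 x * a x * b x)" "integrable lborel (\<lambda>x. wtd 3 x * a x * b x)"
proof -
  have d: "\<bar>wtd c x\<bar> \<le> c" if "c \<ge> 0" for c x
    using wtd_bound[OF that, of x] mult_left_mono[OF wt_bound[OF that, of x] that] by simp
  show "integrable lborel (\<lambda>x. psi x * a x * b x)" by (rule integrable_weighted'[OF assms psi_measurable psi_bound])
  show "integrable lborel (\<lambda>x. wt 2 x * a x * b x)" "integrable lborel (\<lambda>x. wt 3 x * a x * b x)"
    by (rule integrable_weighted'[OF assms wt_measurable wt_abs_bound], simp)+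
  show "integrable lborel (\<lambda>x. wtd 2 x * a x * b x)" "integrable lborel (\<lambda>x. wtd 3 x * a x * b x)"
    by (rule integrable_weighted'[OF assms wtd_measurable d], simp)+
qed

lemma virial_I_deriv:
  assumes t: "t > 0"
  shows "\<exists>d. (virial_I has_real_derivative d) (at t) \<and> d \<le> - (1/2) * virial_defect (p t)"
proof -
  have t0: "t \<ge> 0" using t by simp
  have L: "L2 (u t)" "L2 (p t)" "L2 (u2 t)" "L2 (g t)" "L2 (rp t)" "L2 (rm t)"
    using t0 by (auto intro!: u_L2 regularity g_L2 rp_rm_L2)
  note i = weighted_integrable[OF L(5,5)] weighted_integrable[OF L(6,6)] weighted_integrable[OF L(4,5)] weighted_integrable[OF L(5,4)]
    weighted_integrable[OF L(4,6)] weighted_integrable[OF L(6,4)] weighted_integrable[OF L(1,5)] weighted_integrable[OF L(1,6)] weighted_integrable[OF L(6,5)]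
    weighted_integrable[OF L(5,6)] weighted_integrable[OF L(1,4)]
  let ?d = "1/4 * ((- 1 * ip (\<lambda>x. wt 2 x * rp t x) (rp t) + ip (\<lambda>x. psi x * g t x) (rp t) + ip (\<lambda>x. psi x * rp t x) (g t))
      - (- (-1) * ip (\<lambda>x. wt 2 x * rm t x) (rm t) + ip (\<lambda>x. psi x * g t x) (rm t) + ip (\<lambda>x. psi x * rm t x) (g t)))
    + 1/4 * ((- 1 * ip (\<lambda>x. wtd 2 x * u t x) (rp t) + ip (\<lambda>x. wt 2 x * rm t x) (rp t) + ip (\<lambda>x. wt 2 x * u t x) (g t))
      + (- (-1) * ip (\<lambda>x. wtd 2 x * u t x) (rm t) + ip (\<lambda>x. wt 2 x * rp t x) (rm t) + ip (\<lambda>x. wt 2 x * u t x) (g t)))"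
  have der: "(virial_I has_real_derivative ?d) (at t)"
    unfolding virial_I_def[abs_def]
    by (intro DERIV_add DERIV_diff DERIV_cmult psi_derivative wt_derivative transports t) simp_all
  have "?d = (\<integral>x. - (wt 2 x * (p t x * p t x)) + wt 2 x * (sgn x * u t x * p t x) + psi x * (g t x * p t x) + 1/2 * (wt 2 x * (u t x * g t x)) \<partial>lborel)"
  proof -
    have "(\<integral>x. - (wt 2 x * (p t x * p t x)) + wt 2 x * (sgn x * u t x * p t x) + psi x * (g t x * p t x) + 1/2 * (wt 2 x * (u t x * g t x)) \<partial>lborel) =
     (\<integral>x. 1/4 * ((- 1 * (wt 2 x * rp t x * rp t x) + psi x * g t x * rp t x + psi x * rp t x * g t x)
      - (- (-1) * (wt 2 x * rm t x * rm t x) + psi x * g t x * rm t x + psi x * rm t x * g t x))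
    + 1/4 * ((- 1 * (wtd 2 x * u t x * rp t x) + wt 2 x * rm t x * rp t x + wt 2 x * u t x * g t x)
      + (- (-1) * (wtd 2 x * u t x * rm t x) + wt 2 x * rp t x * rm t x + wt 2 x * u t x * g t x)) \<partial>lborel)"
      \<comment> \<open>The squares of \<open>u2\<close> cancel here: the first functional gives
        \<open>- wt 2 * (u2^2 + p^2) / 2\<close> and the correction with \<open>u\<close> gives
        \<open>wt 2 * (u2^2 - p^2) / 2\<close>. This is what fixes the coefficient of the
        correction.\<close>
      by (rule Bochner_Integration.integral_cong[OF refl]) (simp add: rp_def rm_def wtd_def field_simps)
    also have "\<dots> = ?d"
      unfolding ip_def
      by (rule has_bochner_integral_integral_eq)
        (intro has_bochner_integral_add has_bochner_integral_diff has_bochner_integral_mult_right has_bochner_integral_integrable i)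
    finally show ?thesis by simp
  qed
  then have le: "?d \<le> - (1/2) * virial_defect (p t)" using virial_static[OF t0] by (rule ord_eq_le_trans)
  show ?thesis by (rule exI, rule conjI, rule der, rule le)
qed

lemma local_energy_eq:
  assumes t: "t \<ge> 0"
  shows "local_energy t = (\<integral>x. wt 3 x * u t x * u t x \<partial>lborel) + (\<integral>x. wt 3 x * p t x * p t x \<partial>lborel) + (\<integral>x. wt 3 x * u2 t x * u2 t x \<partial>lborel)"
proof -
  have L: "L2 (u t)" "L2 (p t)" "L2 (u2 t)" "L2 (rp t)" "L2 (rm t)"
    using t by (auto intro!: u_L2 regularity g_L2 rp_rm_L2)
  note i = weighted_integrable[OF L(1,1)] weighted_integrable[OF L(2,2)] weighted_integrable[OF L(3,3)] weighted_integrable[OF L(4,4)] weighted_integrable[OF L(5,5)]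
  have "local_energy t = (\<integral>x. wt 3 x * u t x * u t x + 1/2 * (wt 3 x * rp t x * rp t x) + 1/2 * (wt 3 x * rm t x * rm t x) \<partial>lborel)"
    unfolding local_energy_def ip_def using i by simp
  also have "\<dots> = (\<integral>x. wt 3 x * u t x * u t x + wt 3 x * p t x * p t x + wt 3 x * u2 t x * u2 t x \<partial>lborel)"
    by (rule Bochner_Integration.integral_cong[OF refl]) (simp add: rp_def rm_def field_simps)
  also have "\<dots> = (\<integral>x. wt 3 x * u t x * u t x \<partial>lborel) + (\<integral>x. wt 3 x * p t x * p t x \<partial>lborel) + (\<integral>x. wt 3 x * u2 t x * u2 t x \<partial>lborel)"
    using i by simp
  finally show ?thesis .
qed

lemma wtd3_mult_le: "\<bar>wtd 3 x * a * b\<bar> \<le> 3/2 * (wt 3 x * (a * a + b * b))"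
proof -
  have "\<bar>wtd 3 x * a * b\<bar> = \<bar>wtd 3 x\<bar> * \<bar>a * b\<bar>" by (simp add: abs_mult)
  also have "\<dots> \<le> (3 * wt 3 x) * ((a * a + b * b) / 2)"
    using wtd_bound[of 3 x] two_mult_le_squares[of a b] less_imp_le[OF wt_pos[of 3 x]]
    by (intro mult_mono) (auto simp: power2_eq_square)
  finally show ?thesis by simp
qed

lemma wt3_mult_le: "\<bar>wt 3 x * a * b\<bar> \<le> 1/2 * (wt 3 x * (a * a + b * b))"
proof -
  have "\<bar>wt 3 x * a * b\<bar> = wt 3 x * \<bar>a * b\<bar>" using wt_pos[of 3 x] by (simp add: abs_mult)
  also have "\<dots> \<le> wt 3 x * ((a * a + b * b) / 2)"
    using two_mult_le_squares[of a b] less_imp_le[OF wt_pos[of 3 x]]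
    by (intro mult_left_mono) (auto simp: power2_eq_square)
  finally show ?thesis by simp
qed

lemma wt3_g_le: "t \<ge> 0 \<Longrightarrow> \<bar>wt 3 x * a * g t x\<bar> \<le> (\<bar>m\<bar> + C) * (1/2 * (wt 3 x * (a * a + u t x * u t x)))"
proof -
  assume t: "t \<ge> 0"
  have "\<bar>wt 3 x * a * g t x\<bar> = wt 3 x * \<bar>a\<bar> * \<bar>g t x\<bar>" using wt_pos[of 3 x] by (simp add: abs_mult)
  also have "\<dots> \<le> wt 3 x * \<bar>a\<bar> * ((\<bar>m\<bar> + C) * \<bar>u t x\<bar>)"
    using less_imp_le[OF wt_pos[of 3 x]] by (intro mult_left_mono g_L2_bound(2)[OF t]) auto
  also have "\<dots> = (\<bar>m\<bar> + C) * \<bar>wt 3 x * a * u t x\<bar>" using wt_pos[of 3 x] by (simp add: abs_mult)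
  also have "\<dots> \<le> (\<bar>m\<bar> + C) * (1/2 * (wt 3 x * (a * a + u t x * u t x)))"
    using C by (intro mult_left_mono wt3_mult_le) auto
  finally show ?thesis .
qed

text \<open>Differentiating \<open>u * u2\<close> produces the square of \<open>u2\<close> with a
  good sign. All other terms involve only \<open>u\<close>, \<open>p\<close> and the force, and the
  defect dominates them at the rate 3.\<close>

lemma virial_J_deriv:
  assumes t: "t > 0"
  shows "\<exists>d. (virial_J has_real_derivative d) (at t) \<and>
    d \<ge> local_energy t - 14 * (7/2 + \<bar>m\<bar> + C) * virial_defect (p t)"
proof -
  have t0: "t \<ge> 0" using t by simp
  have L: "L2 (u t)" "L2 (p t)" "L2 (u2 t)" "L2 (g t)" "L2 (rp t)" "L2 (rm t)"
    using t0 by (auto intro!: u_L2 regularity g_L2 rp_rm_L2)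
  note i = weighted_integrable[OF L(5,5)] weighted_integrable[OF L(6,6)] weighted_integrable[OF L(4,5)] weighted_integrable[OF L(5,4)]
    weighted_integrable[OF L(4,6)] weighted_integrable[OF L(6,4)] weighted_integrable[OF L(1,5)] weighted_integrable[OF L(1,6)] weighted_integrable[OF L(6,5)]
    weighted_integrable[OF L(5,6)] weighted_integrable[OF L(1,4)] weighted_integrable[OF L(1,1)] weighted_integrable[OF L(2,2)] weighted_integrable[OF L(3,3)] weighted_integrable[OF L(1,2)]
  let ?d = "1/2 * ((- 1 * ip (\<lambda>x. wtd 3 x * u t x) (rp t) + ip (\<lambda>x. wt 3 x * rm t x) (rp t) + ip (\<lambda>x. wt 3 x * u t x) (g t))
      + (- (-1) * ip (\<lambda>x. wtd 3 x * u t x) (rm t) + ip (\<lambda>x. wt 3 x * rp t x) (rm t) + ip (\<lambda>x. wt 3 x * u t x) (g t)))"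
  have der: "(virial_J has_real_derivative ?d) (at t)"
    unfolding virial_J_def[abs_def]
    by (intro DERIV_add DERIV_cmult wt_derivative transports t) simp_all
  let ?U = "\<integral>x. wt 3 x * u t x * u t x \<partial>lborel" and ?P = "\<integral>x. wt 3 x * p t x * p t x \<partial>lborel" and ?W = "\<integral>x. wt 3 x * u2 t x * u2 t x \<partial>lborel"
  \<comment> \<open>One from the square of \<open>p\<close>, 3/2 from the derivative of the weight,
    and the linear bound \<open>\<bar>m\<bar> + C\<close> of the force.\<close>
  let ?k = "5/2 + \<bar>m\<bar> + C"
  have "?W - ?k * (?U + ?P) = (\<integral>x. wt 3 x * u2 t x * u2 t x - ?k * (wt 3 x * u t x * u t x + wt 3 x * p t x * p t x) \<partial>lborel)"
    by (rule has_bochner_integral_integral_eq[symmetric])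
      (intro has_bochner_integral_add has_bochner_integral_diff has_bochner_integral_mult_right has_bochner_integral_integrable i)
  also have "\<dots> \<le> (\<integral>x. wt 3 x * u2 t x * u2 t x - wt 3 x * p t x * p t x - wtd 3 x * u t x * p t x + wt 3 x * u t x * g t x \<partial>lborel)"
  proof (rule integral_mono)
    fix x
    have 1: "wtd 3 x * u t x * p t x \<le> 3/2 * (wt 3 x * (u t x * u t x + p t x * p t x))"
      using wtd3_mult_le[of x "u t x" "p t x"] by linarith
    have 2: "- (wt 3 x * u t x * g t x) \<le> (\<bar>m\<bar> + C) * (1/2 * (wt 3 x * (u t x * u t x + u t x * u t x)))"
      using wt3_g_le[OF t0, of x "u t x"] by linarith
    have 3: "0 \<le> (\<bar>m\<bar> + C) * (wt 3 x * (p t x * p t x))" "0 \<le> wt 3 x * (u t x * u t x)"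
      using C less_imp_le[OF wt_pos[of 3 x]] by auto
    show "wt 3 x * u2 t x * u2 t x - ?k * (wt 3 x * u t x * u t x + wt 3 x * p t x * p t x)
       \<le> wt 3 x * u2 t x * u2 t x - wt 3 x * p t x * p t x - wtd 3 x * u t x * p t x + wt 3 x * u t x * g t x"
      using 1 2 3 by (simp add: algebra_simps)
  qed (intro Bochner_Integration.integrable_add Bochner_Integration.integrable_diff integrable_mult_right i)+
  also have "\<dots> = (\<integral>x. 1/2 * ((- 1 * (wtd 3 x * u t x * rp t x) + wt 3 x * rm t x * rp t x + wt 3 x * u t x * g t x)
      + (- (-1) * (wtd 3 x * u t x * rm t x) + wt 3 x * rp t x * rm t x + wt 3 x * u t x * g t x)) \<partial>lborel)"
    by (rule Bochner_Integration.integral_cong[OF refl]) (simp add: rp_def rm_def field_simps)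
  also have "\<dots> = ?d"
    unfolding ip_def
    by (rule has_bochner_integral_integral_eq)
      (intro has_bochner_integral_add has_bochner_integral_diff has_bochner_integral_mult_right has_bochner_integral_integrable i)
  finally have le: "?W - ?k * (?U + ?P) \<le> ?d" .
  \<comment> \<open>14 is the sum of the constants 4 and 10 of \<open>defect_controls\<close>.
    Raising \<open>?k\<close> by one below completes \<open>?W\<close> to the whole local
    energy.\<close>
  have UP: "?U + ?P \<le> 14 * virial_defect (p t)"
    using defect_controls[of "p t"] L(1,2) by (simp add: u_def mult.assoc)
  have "(?k + 1) * (?U + ?P) \<le> (?k + 1) * (14 * virial_defect (p t))"
    using UP C by (intro mult_left_mono) auto
  moreover have "?W - ?k * (?U + ?P) = local_energy t - (?k + 1) * (?U + ?P)"
    by (simp add: local_energy_eq[OF t0] algebra_simps)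
  moreover have "(?k + 1) * (14 * virial_defect (p t)) = 14 * (7/2 + \<bar>m\<bar> + C) * virial_defect (p t)"
    by (simp add: algebra_simps)
  ultimately have le': "?d \<ge> local_energy t - 14 * (7/2 + \<bar>m\<bar> + C) * virial_defect (p t)" using le by linarith
  show ?thesis by (rule exI, rule conjI, rule der, rule le')
qed

lemma local_energy_deriv:
  assumes t: "t > 0"
  shows "\<exists>d. (local_energy has_real_derivative d) (at t) \<and> d \<le> (5 + \<bar>m\<bar> + C) * local_energy t"
proof -
  have t0: "t \<ge> 0" using t by simp
  have L: "L2 (u t)" "L2 (p t)" "L2 (u2 t)" "L2 (g t)" "L2 (rp t)" "L2 (rm t)"
    using t0 by (auto intro!: u_L2 regularity g_L2 rp_rm_L2)
  note i = weighted_integrable[OF L(5,5)] weighted_integrable[OF L(6,6)] weighted_integrable[OF L(4,5)] weighted_integrable[OF L(5,4)]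
    weighted_integrable[OF L(4,6)] weighted_integrable[OF L(6,4)] weighted_integrable[OF L(1,6)] weighted_integrable[OF L(6,1)]
    weighted_integrable[OF L(1,1)] weighted_integrable[OF L(2,2)] weighted_integrable[OF L(3,3)]
  let ?d = "(- 1 * ip (\<lambda>x. wtd 3 x * u t x) (u t) + ip (\<lambda>x. wt 3 x * rm t x) (u t) + ip (\<lambda>x. wt 3 x * u t x) (rm t))
    + 1/2 * (- 1 * ip (\<lambda>x. wtd 3 x * rp t x) (rp t) + ip (\<lambda>x. wt 3 x * g t x) (rp t) + ip (\<lambda>x. wt 3 x * rp t x) (g t))
    + 1/2 * (- (-1) * ip (\<lambda>x. wtd 3 x * rm t x) (rm t) + ip (\<lambda>x. wt 3 x * g t x) (rm t) + ip (\<lambda>x. wt 3 x * rm t x) (g t))"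
  have der: "(local_energy has_real_derivative ?d) (at t)"
    unfolding local_energy_def[abs_def]
    by (intro DERIV_add DERIV_cmult wt_derivative transports t) simp_all
  \<comment> \<open>The largest coefficient in the estimate below, that of the square of
    \<open>u\<close>: 3 from the derivative of the weight, 1 from each of the two products with
    \<open>u2\<close> and \<open>p\<close>, and the rest from the force.\<close>
  let ?k = "5 + \<bar>m\<bar> + C"
  have "?d = (\<integral>x. (- 1 * (wtd 3 x * u t x * u t x) + wt 3 x * rm t x * u t x + wt 3 x * u t x * rm t x)
    + 1/2 * (- 1 * (wtd 3 x * rp t x * rp t x) + wt 3 x * g t x * rp t x + wt 3 x * rp t x * g t x)
    + 1/2 * (- (-1) * (wtd 3 x * rm t x * rm t x) + wt 3 x * g t x * rm t x + wt 3 x * rm t x * g t x) \<partial>lborel)"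
    unfolding ip_def
    by (rule has_bochner_integral_integral_eq[symmetric])
      (intro has_bochner_integral_add has_bochner_integral_diff has_bochner_integral_mult_right has_bochner_integral_integrable i)
  also have "\<dots> \<le> (\<integral>x. ?k * (wt 3 x * u t x * u t x + wt 3 x * p t x * p t x + wt 3 x * u2 t x * u2 t x) \<partial>lborel)"
  proof (rule integral_mono)
    fix x
    have "(- 1 * (wtd 3 x * u t x * u t x) + wt 3 x * rm t x * u t x + wt 3 x * u t x * rm t x)
    + 1/2 * (- 1 * (wtd 3 x * rp t x * rp t x) + wt 3 x * g t x * rp t x + wt 3 x * rp t x * g t x)
    + 1/2 * (- (-1) * (wtd 3 x * rm t x * rm t x) + wt 3 x * g t x * rm t x + wt 3 x * rm t x * g t x)
     = - (wtd 3 x * u t x * u t x) + 2 * (wt 3 x * u t x * u2 t x) - 2 * (wt 3 x * u t x * p t x) - 2 * (wtd 3 x * u2 t x * p t x) + 2 * (wt 3 x * u2 t x * g t x)"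
      by (simp add: rp_def rm_def field_simps)
    also have "\<dots> \<le> 3/2 * (wt 3 x * (u t x * u t x + u t x * u t x)) + wt 3 x * (u t x * u t x + u2 t x * u2 t x)
       + wt 3 x * (u t x * u t x + p t x * p t x) + 3 * (wt 3 x * (u2 t x * u2 t x + p t x * p t x)) + (\<bar>m\<bar> + C) * (wt 3 x * (u2 t x * u2 t x + u t x * u t x))"
      using wtd3_mult_le[of x "u t x" "u t x"] wt3_mult_le[of x "u t x" "u2 t x"] wt3_mult_le[of x "u t x" "p t x"]
        wtd3_mult_le[of x "u2 t x" "p t x"] wt3_g_le[OF t0, of x "u2 t x"] by linarith
    also have "\<dots> \<le> ?k * (wt 3 x * u t x * u t x + wt 3 x * p t x * p t x + wt 3 x * u2 t x * u2 t x)"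
    proof -
      have "0 \<le> (\<bar>m\<bar> + C) * (wt 3 x * (p t x * p t x))" "0 \<le> wt 3 x * (p t x * p t x)" "0 \<le> wt 3 x * (u2 t x * u2 t x)"
        using C less_imp_le[OF wt_pos[of 3 x]] by auto
      then show ?thesis by (simp add: algebra_simps)
    qed
    finally show "(- 1 * (wtd 3 x * u t x * u t x) + wt 3 x * rm t x * u t x + wt 3 x * u t x * rm t x)
    + 1/2 * (- 1 * (wtd 3 x * rp t x * rp t x) + wt 3 x * g t x * rp t x + wt 3 x * rp t x * g t x)
    + 1/2 * (- (-1) * (wtd 3 x * rm t x * rm t x) + wt 3 x * g t x * rm t x + wt 3 x * rm t x * g t x)
     \<le> ?k * (wt 3 x * u t x * u t x + wt 3 x * p t x * p t x + wt 3 x * u2 t x * u2 t x)" .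
  qed (intro Bochner_Integration.integrable_add Bochner_Integration.integrable_diff integrable_mult_right i)+
  also have "\<dots> = ?k * local_energy t"
    unfolding local_energy_eq[OF t0]
    by (rule has_bochner_integral_integral_eq)
      (intro has_bochner_integral_add has_bochner_integral_diff has_bochner_integral_mult_right has_bochner_integral_integrable i)
  finally have le: "?d \<le> ?k * local_energy t" .
  show ?thesis by (rule exI, rule conjI, rule der, rule le)
qed

lemma local_energy_nonneg:
  assumes "t \<ge> 0"
  shows "0 \<le> local_energy t"
  unfolding local_energy_eq[OF assms] mult.assoc
  by (intro add_nonneg_nonneg integral_nonneg_AE AE_I2 mult_nonneg_nonneg[OF less_imp_le[OF wt_pos] zero_le_square])

lemma norms_le_2:
  assumes t: "t \<ge> 0"
  shows "ip (u t) (u t) \<le> 2" "ip (rp t) (rp t) \<le> 2" "ip (rm t) (rm t) \<le> 2"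
proof -
  have "\<delta>\<^sup>2 \<le> 1" using \<delta> norm_bound(2)[OF t] by (simp add: power_le_one)
  then have b: "ip (u t) (u t) + ip (p t) (p t) + ip (u2 t) (u2 t) \<le> 1" using norm_bound(1)[OF t] by linarith
  note nn = ip_nonneg[of "u t"] ip_nonneg[of "p t"] ip_nonneg[of "u2 t"]
  show "ip (u t) (u t) \<le> 2" using b nn by linarith
  show "ip (rp t) (rp t) \<le> 2" using ip_add_le[OF regularity(3)[OF t] regularity(4)[OF t]] b nn unfolding rp_def[abs_def] by linarith
  show "ip (rm t) (rm t) \<le> 2" using ip_diff_le[OF regularity(3)[OF t] regularity(4)[OF t]] b nn unfolding rm_def[abs_def] by linarith
qed

lemma virial_bounds:
  assumes t: "t \<ge> 0"
  shows "\<bar>virial_I t\<bar> \<le> 2" "\<bar>virial_J t\<bar> \<le> 2"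
proof -
  note n = norms_le_2[OF t]
  have psi: "\<bar>ip (\<lambda>x. psi x * rp t x) (rp t)\<bar> \<le> 2" "\<bar>ip (\<lambda>x. psi x * rm t x) (rm t)\<bar> \<le> 2"
    by (rule ip_weighted_bound[OF _ _ psi_measurable psi_bound]; intro rp_rm_L2 t n)+
  have w: "\<bar>ip (\<lambda>x. wt c x * u t x) (rp t)\<bar> \<le> 2" "\<bar>ip (\<lambda>x. wt c x * u t x) (rm t)\<bar> \<le> 2" if "c \<ge> 0" for c
    by (rule ip_weighted_bound[OF _ _ wt_measurable wt_abs_bound[OF that]]; intro rp_rm_L2 u_L2 t n)+
  have w2: "\<bar>ip (\<lambda>x. wt 2 x * u t x) (rp t)\<bar> \<le> 2" "\<bar>ip (\<lambda>x. wt 2 x * u t x) (rm t)\<bar> \<le> 2"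
    and w3: "\<bar>ip (\<lambda>x. wt 3 x * u t x) (rp t)\<bar> \<le> 2" "\<bar>ip (\<lambda>x. wt 3 x * u t x) (rm t)\<bar> \<le> 2"
    by (rule w, simp)+
  have quarter: "\<bar>1/4 * (a - b) + 1/4 * (c + d)\<bar> \<le> 2"
    if "\<bar>a\<bar> \<le> 2" "\<bar>b\<bar> \<le> 2" "\<bar>c\<bar> \<le> 2" "\<bar>d\<bar> \<le> 2" for a b c d :: real
    using that unfolding abs_le_iff by (auto simp: field_simps)
  show "\<bar>virial_I t\<bar> \<le> 2" unfolding virial_I_def by (rule quarter[OF psi w2])
  have half: "\<bar>1/2 * (a + b)\<bar> \<le> 2" if "\<bar>a\<bar> \<le> 2" "\<bar>b\<bar> \<le> 2" for a b :: real
    using that unfolding abs_le_iff by (auto simp: field_simps)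
  show "\<bar>virial_J t\<bar> \<le> 2" unfolding virial_J_def by (rule half[OF w3])
qed

lemma local_energy_decay: "(local_energy \<longlongrightarrow> 0) at_top"
proof -
  \<comment> \<open>Twice the constant of \<open>virial_J_deriv\<close>: the factor 2 undoes the 1/2
    of \<open>virial_I_deriv\<close>, so that the defect disappears from the derivative of
    \<open>l * virial_I - virial_J\<close>.\<close>
  define l where "l = 28 * (7/2 + \<bar>m\<bar> + C)"
  have l: "l \<ge> 0" using C by (simp add: l_def)
  obtain I' where I': "\<And>t. t > 0 \<Longrightarrow> (virial_I has_real_derivative I' t) (at t)" "\<And>t. t > 0 \<Longrightarrow> I' t \<le> - (1/2) * virial_defect (p t)"
    using virial_I_deriv by metis
  obtain J' where J': "\<And>t. t > 0 \<Longrightarrow> (virial_J has_real_derivative J' t) (at t)"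
    "\<And>t. t > 0 \<Longrightarrow> J' t \<ge> local_energy t - 14 * (7/2 + \<bar>m\<bar> + C) * virial_defect (p t)"
    using virial_J_deriv by metis
  obtain E' where E': "\<And>t. t > 0 \<Longrightarrow> (local_energy has_real_derivative E' t) (at t)"
    "\<And>t. t > 0 \<Longrightarrow> E' t \<le> (5 + \<bar>m\<bar> + C) * local_energy t"
    using local_energy_deriv by metis
  show ?thesis
  proof (rule Lyapunov_decay[OF E'(1) _ local_energy_nonneg E'(2)])
    fix t :: real assume t: "t > 0"
    show "((\<lambda>t. l * virial_I t - virial_J t) has_real_derivative l * I' t - J' t) (at t)"
      by (intro DERIV_diff DERIV_cmult I'(1) J'(1) t)
    have "l * I' t \<le> l * (- (1/2) * virial_defect (p t))" using I'(2)[OF t] l by (rule mult_left_mono)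
    also have "\<dots> = - (14 * (7/2 + \<bar>m\<bar> + C) * virial_defect (p t))" by (simp add: l_def algebra_simps)
    finally show "l * I' t - J' t \<le> - local_energy t" using J'(2)[OF t] by linarith
    have "\<bar>l * virial_I t\<bar> \<le> l * 2" unfolding abs_mult using l virial_bounds(1)[of t] t by (intro mult_mono) auto
    then show "\<bar>l * virial_I t - virial_J t\<bar> \<le> l * 2 + 2" using virial_bounds(2)[of t] t by linarith
  qed (use C in auto)
qed

end

section \<open>From the weighted energy to bounded intervals\<close>

lemma bounded_interval_cases:
  fixes I :: "real set"
  assumes "is_interval I" "bounded I"
  obtains a b where "{a<..<b} \<subseteq> I" "I \<subseteq> {a..b}"
proof (cases "I = {}")
  case True
  then show ?thesis by (intro that[of 0 0]) auto
next
  case False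
  have bdd: "bdd_below I" "bdd_above I" using assms(2) bounded_imp_bdd_below bounded_imp_bdd_above by auto
  show ?thesis
  proof (rule that[of "Inf I" "Sup I"])
    show "I \<subseteq> {Inf I..Sup I}" using bdd by (auto intro: cInf_lower cSup_upper)
    show "{Inf I<..<Sup I} \<subseteq> I"
    proof
      fix x assume x: "x \<in> {Inf I<..<Sup I}"
      then obtain y z where "y \<in> I" "y < x" "z \<in> I" "x < z"
        using cInf_lessD[OF False, of x] less_cSupD[OF False, of x] by auto
      then show "x \<in> I" using assms(1) unfolding is_interval_1 by (meson less_imp_le)
    qed
  qed
qed

lemma L2_norm_on_square: "(L2_norm_on S w)\<^sup>2 = (LBINT x:S. (w x)\<^sup>2)"
  unfolding L2_norm_on_def set_lebesgue_integral_def
  by (intro real_sqrt_pow2 integral_nonneg_AE AE_I2) simp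

text \<open>The derivative chosen on \<open>I\<close> is unrelated to the one chosen on the line,
  but both satisfy the weak identity for test functions inside \<open>I\<close>, so they agree there
  almost everywhere; at most two endpoints remain.\<close>

lemma weak_deriv_on_bounded_interval:
  fixes I :: "real set"
  assumes ab: "{a<..<b} \<subseteq> I" "I \<subseteq> {a..b}" and w: "L2 w" and p: "L2 p" and wd: "weak_derivative_on UNIV w p"
  shows "AE x in lborel. x \<in> I \<longrightarrow> weak_deriv I w x = p x" "I \<in> sets borel"
    "set_borel_measurable lborel I (weak_deriv I w)"
proof -
  have "I = {a<..<b} \<union> (I \<inter> {a, b})" using ab by force
  moreover have "finite (I \<inter> {a, b})" by simp
  ultimately show I: "I \<in> sets borel"
    by (metis borel_open open_greaterThanLessThan sets.Un sets.sets_into_space finite_imp_closed borel_closed)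
  have int: "(LBINT x:I. h x * \<phi> x) = ip h \<phi>" if "\<And>x. x \<notin> I \<Longrightarrow> \<phi> x = 0" for h \<phi> :: "real \<Rightarrow> real"
    unfolding set_lebesgue_integral_def ip_def
    by (rule Bochner_Integration.integral_cong[OF refl]) (use that in \<open>auto simp: indicator_def\<close>)
  have supp: "\<phi> x = 0" "deriv \<phi> x = 0" if "test_function_on (interior I) \<phi>" "x \<notin> I" for \<phi> x
    using test_function_onD(3)[OF that(1)] closure_subset[of "{x. \<phi> x \<noteq> 0}"] interior_subset[of I]
      test_function_onD(3)[OF test_function_on_deriv[OF that(1)]] closure_subset[of "{x. deriv \<phi> x \<noteq> 0}"] that(2) by auto
  have ex: "L2_on I p \<and> weak_derivative_on I w p"
  proof
    have m: "p \<in> borel_measurable borel" using p by (rule L2_measurable)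
    show "L2_on I p" unfolding L2_on_def set_borel_measurable_def set_integrable_def
      using m I integrable_mult_indicator[OF _ L2_integrable_sq[OF p], of I] by auto
    show "weak_derivative_on I w p" unfolding weak_derivative_on_def
    proof (intro allI impI)
      fix \<phi> assume \<phi>: "test_function_on (interior I) \<phi>"
      have "test_fun \<phi>" using test_function_on_mono[OF \<phi>] by simp
      then have "ip w (deriv \<phi>) = - ip p \<phi>" using wd by (simp add: weak_derivative_on_UNIV)
      then show "(LBINT x:I. w x * deriv \<phi> x) = - (LBINT x:I. p x * \<phi> x)"
        using int[of "deriv \<phi>" w] int[of \<phi> p] supp[OF \<phi>] by simp
    qed
  qed
  from exI[of "\<lambda>v. L2_on I v \<and> weak_derivative_on I w v", OF this]
  have v: "L2_on I (weak_deriv I w) \<and> weak_derivative_on I w (weak_deriv I w)"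
    unfolding weak_deriv_def by (rule someI_ex)
  then show "set_borel_measurable lborel I (weak_deriv I w)" by (simp add: L2_on_def)
  let ?v = "\<lambda>x. indicator I x * weak_deriv I w x"
  have vL: "L2 ?v"
  proof -
    have "(indicator I x * weak_deriv I w x)\<^sup>2 = indicator I x *\<^sub>R (weak_deriv I w x)\<^sup>2" for x
      by (simp add: indicator_def)
    then show ?thesis using v unfolding L2_on_def L2_def set_borel_measurable_def set_integrable_def by simp
  qed
  have "AE x in lborel. a < x \<and> x < b \<longrightarrow> ?v x - p x = 0"
  proof (rule L2_zero_on_interval[OF L2_diff[OF vL p]])
    fix \<eta> assume \<eta>: "test_function_on {a<..<b} \<eta>"
    have \<eta>': "test_function_on (interior I) \<eta>"
      by (rule test_function_on_mono[OF \<eta>]) (use ab(1) in \<open>simp add: interior_maximal\<close>)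
    have "(LBINT x:I. weak_deriv I w x * \<eta> x) = (LBINT x:I. p x * \<eta> x)"
      using v[THEN conjunct2, unfolded weak_derivative_on_def, rule_format, OF \<eta>']
        ex[THEN conjunct2, unfolded weak_derivative_on_def, rule_format, OF \<eta>'] by linarith
    moreover have "(LBINT x:I. weak_deriv I w x * \<eta> x) = ip ?v \<eta>"
      unfolding set_lebesgue_integral_def ip_def by (simp add: mult.assoc)
    moreover have "L2 \<eta>" by (rule test_fun_L2[OF test_function_on_mono[OF \<eta>]]) simp
    ultimately show "ip (\<lambda>x. ?v x - p x) \<eta> = 0"
      using int[of \<eta> p] supp[OF \<eta>'] by (simp add: ip_diff_left[OF vL p])
  qed
  then show "AE x in lborel. x \<in> I \<longrightarrow> weak_deriv I w x = p x"
    using AE_lborel_singleton[of a] AE_lborel_singleton[of b]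
  proof eventually_elim
    case (elim x)
    show ?case
    proof
      assume "x \<in> I"
      then have "a < x \<and> x < b" using ab(2) elim(2,3) by force
      then show "weak_deriv I w x = p x" using elim(1) \<open>x \<in> I\<close> by simp
    qed
  qed
qed

context virial
begin

lemma local_norm_decay:
  assumes "is_interval I" "bounded I"
  shows "((\<lambda>t. H1L2_norm_on I (u1 t) (u2 t)) \<longlongrightarrow> 0) at_top"
proof -
  obtain a b where ab: "{a<..<b} \<subseteq> I" "I \<subseteq> {a..b}" using bounded_interval_cases[OF assms] by blast
  define K where "K = \<bar>a\<bar> + \<bar>b\<bar>"
  have K: "\<bar>x\<bar> \<le> K" if "x \<in> I" for x 
  proof -
    have "a \<le> x" "x \<le> b" using ab(2) that by auto
    then show ?thesis unfolding K_def by linarith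
  qed
  have le: "(H1L2_norm_on I (u1 t) (u2 t))\<^sup>2 \<le> exp (3 * K) * local_energy t" if t: "t \<ge> 0" for t
  proof -
    note wd = weak_deriv_on_bounded_interval[OF ab regularity(2,4,5)[OF t]]
    have bound: "(LBINT x:I. (w x)\<^sup>2) \<le> exp (3 * K) * (\<integral>x. wt 3 x * h x * h x \<partial>lborel)"
      if h: "L2 h" and wm: "set_borel_measurable lborel I w" and ae: "AE x in lborel. x \<in> I \<longrightarrow> w x = h x" for w h
    proof -
      have hm: "h \<in> borel_measurable borel" using h by (rule L2_measurable)
      have e: "indicator I x *\<^sub>R (w x)\<^sup>2 = (indicator I x *\<^sub>R w x)\<^sup>2" for x by (simp add: indicator_def)
      have "(LBINT x:I. (w x)\<^sup>2) = (\<integral>x. indicator I x * (h x)\<^sup>2 \<partial>lborel)"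
        unfolding set_lebesgue_integral_def
      proof (rule integral_cong_AE)
        show "(\<lambda>x. indicator I x *\<^sub>R (w x)\<^sup>2) \<in> borel_measurable lborel"
          unfolding e using wm unfolding set_borel_measurable_def by (rule borel_measurable_power)
        show "AE x in lborel. indicator I x *\<^sub>R (w x)\<^sup>2 = indicator I x * (h x)\<^sup>2"
          using ae by eventually_elim (auto simp: indicator_def)
      qed (use hm wd(2) in simp)
      also have "\<dots> \<le> (\<integral>x. exp (3 * K) * (wt 3 x * h x * h x) \<partial>lborel)"
      proof (rule integral_mono)
        show "integrable lborel (\<lambda>x. indicator I x * (h x)\<^sup>2)"
          using integrable_mult_indicator[OF _ L2_integrable_sq[OF h], of I] wd(2) by simp
        show "integrable lborel (\<lambda>x. exp (3 * K) * (wt 3 x * h x * h x))" using weighted_integrable(3)[OF h h] by simp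
        fix x
        show "indicator I x * (h x)\<^sup>2 \<le> exp (3 * K) * (wt 3 x * h x * h x)"
        proof (cases "x \<in> I")
          case True
          \<comment> \<open>On a bounded interval the weight is bounded below, so the weighted
            energy dominates the unweighted norm.\<close>
          have "1 \<le> exp (3 * K) * wt 3 x" using K[OF True] by (simp add: wt_def exp_add[symmetric])
          then have "1 * (h x)\<^sup>2 \<le> exp (3 * K) * wt 3 x * (h x)\<^sup>2" by (rule mult_right_mono) simp
          then show ?thesis using True by (simp add: power2_eq_square mult_ac)
        next
          case False
          have "0 \<le> wt 3 x * (h x * h x)" using less_imp_le[OF wt_pos[of 3 x]] by simp
          then show ?thesis using False by (simp add: mult.assoc)
        qed
      qed
      finally show ?thesis by simp
    qed
    have sm: "set_borel_measurable lborel I h" if "L2 h" for h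
      using L2_measurable[OF that] wd(2) by (simp add: set_borel_measurable_def)
    have "(LBINT x:I. (u1 t x)\<^sup>2) \<le> exp (3 * K) * (\<integral>x. wt 3 x * u t x * u t x \<partial>lborel)"
      by (rule bound[OF u_L2[OF t] sm[OF regularity(2)[OF t]]]) (use u1_eq[OF t] in \<open>eventually_elim, simp\<close>)
    moreover have "(LBINT x:I. (u2 t x)\<^sup>2) \<le> exp (3 * K) * (\<integral>x. wt 3 x * u2 t x * u2 t x \<partial>lborel)"
      by (rule bound[OF regularity(3)[OF t] sm[OF regularity(3)[OF t]]]) simp
    moreover have "(LBINT x:I. (weak_deriv I (u1 t) x)\<^sup>2) \<le> exp (3 * K) * (\<integral>x. wt 3 x * p t x * p t x \<partial>lborel)"
      by (rule bound[OF regularity(4)[OF t] wd(3,1)])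
    moreover have "(H1L2_norm_on I (u1 t) (u2 t))\<^sup>2 = (LBINT x:I. (u1 t x)\<^sup>2) + (LBINT x:I. (weak_deriv I (u1 t) x)\<^sup>2) + (LBINT x:I. (u2 t x)\<^sup>2)"
      by (simp add: H1L2_norm_on_def H1_norm_on_def L2_norm_on_square[symmetric])
    ultimately show ?thesis unfolding local_energy_eq[OF t] by (simp add: distrib_left)
  qed
  have "((\<lambda>t. sqrt (exp (3 * K) * local_energy t)) \<longlongrightarrow> sqrt (exp (3 * K) * 0)) at_top"
    by (intro tendsto_intros local_energy_decay)
  then have lim: "((\<lambda>t. sqrt (exp (3 * K) * local_energy t)) \<longlongrightarrow> 0) at_top" by simp
  show ?thesis
  proof (rule real_tendsto_sandwich[OF _ _ tendsto_const lim])
    show "\<forall>\<^sub>F t in at_top. 0 \<le> H1L2_norm_on I (u1 t) (u2 t)" by (simp add: H1L2_norm_on_def)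
    show "\<forall>\<^sub>F t in at_top. H1L2_norm_on I (u1 t) (u2 t) \<le> sqrt (exp (3 * K) * local_energy t)"
      using eventually_ge_at_top[of "0::real"] by eventually_elim (use le real_le_rsqrt in blast)
  qed
qed

text \<open>The local norms at the times \<open>t + n T\<close> tend to zero, whereas the
  \<open>L2\<close> parts in them do not depend on \<open>n\<close>. They therefore vanish on every
  interval \<open>{- k..k}\<close>.\<close>

lemma periodic_imp_zero:
  assumes "time_periodic u1 u2"
  shows "identically_zero u1 u2"
  unfolding identically_zero_def
proof (intro allI impI)
  fix t :: real assume t: "t \<ge> 0"
  obtain T where "T > 0 \<and> (\<forall>t\<ge>0. AE x in lborel. u1 (t + T) x = u1 t x \<and> u2 (t + T) x = u2 t x)"
    using assms unfolding time_periodic_def ..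
  then have T: "T > 0" "\<And>t. t \<ge> 0 \<Longrightarrow> AE x in lborel. u1 (t + T) x = u1 t x \<and> u2 (t + T) x = u2 t x"
    by simp_all
  have per: "AE x in lborel. u1 (t + real n * T) x = u1 t x \<and> u2 (t + real n * T) x = u2 t x" for n
  proof (induction n)
    case (Suc n)
    have e: "t + real (Suc n) * T = t + real n * T + T" by (simp add: algebra_simps)
    have "t + real n * T \<ge> 0" using t T(1) by simp
    from T(2)[OF this] Suc show ?case unfolding e by eventually_elim simp
  qed simp
  have lim: "filterlim (\<lambda>n. t + real n * T) at_top sequentially" using T(1) by real_asymp
  have zero: "AE x in lborel. x \<in> {- real k..real k} \<longrightarrow> u1 t x = 0 \<and> u2 t x = 0" for k
  proof -
    let ?I = "{- real k..real k}"
    have N: "(\<lambda>n. H1L2_norm_on ?I (u1 (t + real n * T)) (u2 (t + real n * T))) \<longlonglongrightarrow> 0"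
      by (rule filterlim_compose[OF local_norm_decay lim]) (auto simp: is_interval_1)
    have tn: "t + real n * T \<ge> 0" for n using t T(1) by simp
    have eq: "(LBINT x:?I. (w s x)\<^sup>2) = (LBINT x:?I. (w t x)\<^sup>2)"
      if "L2 (w s)" "L2 (w t)" "AE x in lborel. w s x = w t x" for s and w :: "real \<Rightarrow> real \<Rightarrow> real"
      unfolding set_lebesgue_integral_def
      by (rule integral_cong_AE) (use L2_measurable[OF that(1)] L2_measurable[OF that(2)] in measurable, use that(3) in \<open>eventually_elim, simp\<close>)
    \<comment> \<open>The derivative part is dropped: the two remaining terms already determine both
      functions up to null sets.\<close>
    have sq: "(H1L2_norm_on ?I (u1 s) (u2 s))\<^sup>2 \<ge> (LBINT x:?I. (u1 s x)\<^sup>2) + (LBINT x:?I. (u2 s x)\<^sup>2)" for s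
      by (simp add: H1L2_norm_on_def H1_norm_on_def L2_norm_on_square[symmetric])
    have le: "(LBINT x:?I. (u1 t x)\<^sup>2) + (LBINT x:?I. (u2 t x)\<^sup>2) \<le> (H1L2_norm_on ?I (u1 (t + real n * T)) (u2 (t + real n * T)))\<^sup>2" for n
    proof -
      have 1: "(LBINT x:?I. (u1 (t + real n * T) x)\<^sup>2) = (LBINT x:?I. (u1 t x)\<^sup>2)"
        by (rule eq[OF regularity(2)[OF tn] regularity(2)[OF t]]) (use per[of n] in \<open>eventually_elim, simp\<close>)
      have 2: "(LBINT x:?I. (u2 (t + real n * T) x)\<^sup>2) = (LBINT x:?I. (u2 t x)\<^sup>2)"
        by (rule eq[OF regularity(3)[OF tn] regularity(3)[OF t]]) (use per[of n] in \<open>eventually_elim, simp\<close>)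
      show ?thesis using sq[of "t + real n * T"] unfolding 1 2 .
    qed
    have "(LBINT x:?I. (u1 t x)\<^sup>2) + (LBINT x:?I. (u2 t x)\<^sup>2) \<le> 0\<^sup>2"
      by (rule LIMSEQ_le_const[OF tendsto_power[OF N]]) (use le in blast)
    moreover have nn: "0 \<le> (LBINT x:?I. (w x)\<^sup>2)" for w :: "real \<Rightarrow> real" by (simp add: L2_norm_on_square[symmetric])
    ultimately have z: "(LBINT x:?I. (u1 t x)\<^sup>2) = 0" "(LBINT x:?I. (u2 t x)\<^sup>2) = 0"
      using nn[of "u1 t"] nn[of "u2 t"] unfolding zero_power2 by linarith+
    have ae: "AE x in lborel. x \<in> ?I \<longrightarrow> w x = 0" if "L2 w" "(LBINT x:?I. (w x)\<^sup>2) = 0" for w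
    proof -
      have "integrable lborel (\<lambda>x. indicator ?I x *\<^sub>R (w x)\<^sup>2)"
        by (rule integrable_mult_indicator[OF _ L2_integrable_sq[OF that(1)]]) simp
      then have "AE x in lborel. indicator ?I x *\<^sub>R (w x)\<^sup>2 = 0"
        using that(2) unfolding set_lebesgue_integral_def by (subst (asm) integral_nonneg_eq_0_iff_AE) auto
      then show ?thesis by eventually_elim (auto simp: indicator_def)
    qed
    show ?thesis using ae[OF regularity(2)[OF t] z(1)] ae[OF regularity(3)[OF t] z(2)] by eventually_elim auto
  qed
  then have "AE x in lborel. \<forall>k. x \<in> {- real k..real k} \<longrightarrow> u1 t x = 0 \<and> u2 t x = 0"
    unfolding AE_all_countable by (rule allI)
  then show "AE x in lborel. u1 t x = 0 \<and> u2 t x = 0"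
  proof eventually_elim
    case (elim x)
    obtain k where "\<bar>x\<bar> \<le> real k" using real_arch_simple by blast
    then have "x \<in> {- real k..real k}" by auto
    then show ?case using elim by blast
  qed
qed

end

section \<open>Bounds on the nonlinearity and choice of the threshold\<close>

lemma sup_H1L2_norm_less:
  assumes "sup_H1L2_norm u1 u2 < ereal e" "t \<ge> 0"
  shows "H1L2_norm_on UNIV (u1 t) (u2 t) < e"
proof -
  have "ereal (H1L2_norm_on UNIV (u1 t) (u2 t)) \<le> sup_H1L2_norm u1 u2"
    unfolding sup_H1L2_norm_def using assms(2) by (intro SUP_upper) auto
  with assms(1) have "ereal (H1L2_norm_on UNIV (u1 t) (u2 t)) < ereal e" by (rule le_less_trans[rotated])
  then show ?thesis by simp
qed

text \<open>The mean value theorem, applied to \<open>f\<close> and then to \<open>F\<close>, raises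
  the exponent by one each time. The two parts of the second bound contribute C/2 and C, rounded up
  to 2 C.\<close>

lemma nonlinearity_bounds:
  fixes f :: "real \<Rightarrow> real"
  assumes f: "\<And>x. (f has_real_derivative f' x) (at x)" and f0: "f 0 = 0" and p: "p > 1" and C: "C > 0"
    and growth: "\<forall>y. \<bar>y\<bar> < 1 \<longrightarrow> \<bar>f' y\<bar> \<le> C * \<bar>y\<bar> powr (p - 1)"
    and F: "\<And>y. (F has_real_derivative f y) (at y)" and F0: "F 0 = 0"
  shows "\<bar>a\<bar> < 1 \<Longrightarrow> \<bar>b\<bar> < 1 \<Longrightarrow> \<bar>f a - f b\<bar> \<le> C * \<bar>a - b\<bar>"
    and "\<bar>y\<bar> < 1 \<Longrightarrow> \<bar>y * f y / 2 - F y\<bar> \<le> 2 * C * \<bar>y\<bar> powr (p + 1)"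
proof -
  have mv: "\<exists>z. \<bar>z\<bar> \<le> \<bar>y\<bar> \<and> h y - h 0 = y * h' z" if "\<And>x. (h has_real_derivative h' x) (at x)" for h h' :: "real \<Rightarrow> real" and y
  proof (cases "y = 0")
    case False
    then have "\<exists>z. \<bar>z - 0\<bar> \<le> \<bar>y\<bar> \<and> h (0 + y) - h 0 = y * h' z"
      by (rule mean_value_symmetric) (rule that)
    then show ?thesis by simp
  qed (auto intro!: exI[of _ 0])
  have powr_le: "\<bar>z\<bar> powr r \<le> \<bar>y\<bar> powr r" if "\<bar>z\<bar> \<le> \<bar>y\<bar>" "r \<ge> 0" for z y r :: real
    using that by (intro powr_mono2) auto
  have le1: "\<bar>y\<bar> powr (p - 1) \<le> 1" if "\<bar>y\<bar> < 1" for y :: real using powr_le[of y 1 "p - 1"] that p by simp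
  have lip: "\<bar>f a - f b\<bar> \<le> C * \<bar>a - b\<bar>" if ab: "\<bar>a\<bar> < 1" "\<bar>b\<bar> < 1" "b < a" for a b
  proof -
    obtain z where z: "b < z" "z < a" "f a - f b = (a - b) * f' z" using MVT2[OF ab(3) f] by blast
    have z1: "\<bar>z\<bar> < 1" using z ab by auto
    have "\<bar>f' z\<bar> \<le> C * 1" using growth[rule_format, OF z1] mult_left_mono[OF le1[OF z1] less_imp_le[OF C]] by linarith
    then have "\<bar>a - b\<bar> * \<bar>f' z\<bar> \<le> \<bar>a - b\<bar> * C" by (intro mult_left_mono) auto
    then show ?thesis unfolding z(3) by (simp add: abs_mult mult.commute)
  qed
  show "\<bar>f a - f b\<bar> \<le> C * \<bar>a - b\<bar>" if "\<bar>a\<bar> < 1" "\<bar>b\<bar> < 1"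
    using lip[OF that] lip[OF that(2,1)] by (cases a b rule: linorder_cases) (auto simp: abs_minus_commute)
  have fb: "\<bar>f y\<bar> \<le> C * \<bar>y\<bar> powr p" if "\<bar>y\<bar> < 1" for y
  proof -
    obtain z where z: "\<bar>z\<bar> \<le> \<bar>y\<bar>" "f y - f 0 = y * f' z" using mv[OF f] by blast
    have "\<bar>f y\<bar> = \<bar>y\<bar> * \<bar>f' z\<bar>" using z(2) f0 by (simp add: abs_mult)
    also have "\<dots> \<le> \<bar>y\<bar> * (C * \<bar>y\<bar> powr (p - 1))"
    proof (rule mult_left_mono)
      have "\<bar>f' z\<bar> \<le> C * \<bar>z\<bar> powr (p - 1)" using growth z(1) that by simp
      also have "\<dots> \<le> C * \<bar>y\<bar> powr (p - 1)" using powr_le[OF z(1), of "p - 1"] p C by (intro mult_left_mono) auto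
      finally show "\<bar>f' z\<bar> \<le> C * \<bar>y\<bar> powr (p - 1)" .
    qed simp
    also have "\<dots> = C * (\<bar>y\<bar> powr 1 * \<bar>y\<bar> powr (p - 1))" by simp
    also have "\<dots> = C * \<bar>y\<bar> powr p" unfolding powr_add[symmetric] by simp
    finally show ?thesis .
  qed
  show "\<bar>y * f y / 2 - F y\<bar> \<le> 2 * C * \<bar>y\<bar> powr (p + 1)" if y: "\<bar>y\<bar> < 1"
  proof -
    have e: "\<bar>y\<bar> * (C * \<bar>y\<bar> powr p) = C * \<bar>y\<bar> powr (p + 1)"
    proof -
      have "\<bar>y\<bar> * (C * \<bar>y\<bar> powr p) = C * (\<bar>y\<bar> powr p * \<bar>y\<bar> powr 1)" by simp
      then show ?thesis unfolding powr_add[symmetric] .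
    qed
    obtain z where z: "\<bar>z\<bar> \<le> \<bar>y\<bar>" "F y - F 0 = y * f z" using mv[OF F] by blast
    have "\<bar>z\<bar> < 1" using z(1) y by linarith
    moreover have "C * \<bar>z\<bar> powr p \<le> C * \<bar>y\<bar> powr p" using powr_le[OF z(1), of p] p C by (intro mult_left_mono) auto
    ultimately have "\<bar>f z\<bar> \<le> C * \<bar>y\<bar> powr p" using fb[of z] by linarith
    then have "\<bar>F y\<bar> \<le> C * \<bar>y\<bar> powr (p + 1)"
      using z(2) F0 mult_left_mono[of "\<bar>f z\<bar>" "C * \<bar>y\<bar> powr p" "\<bar>y\<bar>"] e by (simp add: abs_mult)
    moreover have "\<bar>y * f y\<bar> \<le> C * \<bar>y\<bar> powr (p + 1)"
      using mult_left_mono[OF fb[OF y], of "\<bar>y\<bar>"] e by (simp add: abs_mult)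
    moreover have "\<bar>y * f y / 2 - F y\<bar> \<le> \<bar>y * f y\<bar> / 2 + \<bar>F y\<bar>" using abs_triangle_ineq4[of "y * f y / 2" "F y"] by simp
    ultimately show ?thesis using abs_ge_zero[of "y * f y"] by linarith
  qed
qed

theorem theorem1p1:
  fixes m :: real and f :: "real \<Rightarrow> real"
  assumes f_C1: "f C1_differentiable_on UNIV"
    and f_odd: "\<And>u. f (- u) = - f u"
    and f_growth: "\<exists>p>1. \<exists>C>0. \<forall>u. \<bar>u\<bar> < 1 \<longrightarrow> \<bar>deriv f u\<bar> \<le> C * \<bar>u\<bar> powr (p - 1)"
  shows "\<exists>\<epsilon>>0.
    (\<forall>u1 u2. global_solution m f u1 u2 \<longrightarrow> odd_in_space u1 \<longrightarrow> odd_in_space u2 \<longrightarrow>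
       sup_H1L2_norm u1 u2 < ereal \<epsilon> \<longrightarrow>
       (\<forall>I. is_interval I \<longrightarrow> bounded I \<longrightarrow>
          ((\<lambda>t. H1L2_norm_on I (u1 t) (u2 t)) \<longlongrightarrow> 0) at_top)) \<and>
    \<not> (\<exists>u1 u2. breather m f u1 u2 \<and> odd_in_space u1 \<and> odd_in_space u2 \<and>
         sup_H1L2_norm u1 u2 < ereal \<epsilon> \<and> \<not> identically_zero u1 u2)"
proof -
  obtain p C where p: "p > 1" and C: "C > 0"
    and growth: "\<forall>y. \<bar>y\<bar> < 1 \<longrightarrow> \<bar>deriv f y\<bar> \<le> C * \<bar>y\<bar> powr (p - 1)"
    using f_growth by blast
  have f0: "f 0 = 0" using f_odd[of 0] by simp
  have fd: "(f has_real_derivative deriv f x) (at x)" for x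
  proof -
    obtain D where "(f has_vector_derivative D x) (at x)" using f_C1 unfolding C1_differentiable_on_def by blast
    then have "(f has_real_derivative D x) (at x)" by (simp add: has_real_derivative_iff_has_vector_derivative)
    then show ?thesis using DERIV_imp_deriv by metis
  qed
  have fc: "isCont f x" for x using fd DERIV_isCont by blast
  obtain F0 where F0: "\<And>x. (F0 has_vector_derivative f x) (at x)"
    using einterval_antiderivative[of "-\<infinity>" \<infinity> f] fc by auto
  define F where "F y = F0 y - F0 0" for y
  have Fd: "(F has_real_derivative f y) (at y)" for y
    using F0[of y] unfolding F_def has_real_derivative_iff_has_vector_derivative
    by (auto intro!: derivative_eq_intros)
  have FZ: "F 0 = 0" by (simp add: F_def)
  note nb = nonlinearity_bounds[OF fd f0 p C growth Fd FZ]
  \<comment> \<open>Both \<open>y * f y\<close> and \<open>F y\<close> have this order, and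
    \<open>p > 1\<close> is exactly \<open>q > 2\<close>, the condition for a positive surplus in
    the nonlinear estimate.\<close>
  define q where "q = p + 1"
  have q: "q > 2" using p by (simp add: q_def)
  define L where "L = 2 * C * q\<^sup>2 / (q - 2)\<^sup>2"
  have L: "L > 0" using C q by (simp add: L_def)
  \<comment> \<open>The second entry solves \<open>L * \<delta> powr (q - 2) = 1/2\<close>, so the
    nonlinear term takes at most half of the defect; the first keeps \<open>\<delta>\<close> below
    1.\<close>
  define \<delta> where "\<delta> = min (1/2) ((1 / (2 * L)) powr (1 / (q - 2)))"
  have \<delta>: "0 < \<delta>" "\<delta> < 1" using L by (auto simp: \<delta>_def)
  have "\<delta> powr (q - 2) \<le> ((1 / (2 * L)) powr (1 / (q - 2))) powr (q - 2)"
    using \<delta> q by (intro powr_mono2) (auto simp: \<delta>_def)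
  also have "\<dots> = 1 / (2 * L)" using L q by (simp add: powr_powr)
  finally have "L * \<delta> powr (q - 2) \<le> L * (1 / (2 * L))" using L by (intro mult_left_mono) auto
  then have "L * \<delta> powr (q - 2) \<le> 1/2" using L by simp
  moreover have "2 * C * (q\<^sup>2 * \<delta> powr (q - 2) / (q - 2)\<^sup>2) = L * \<delta> powr (q - 2)" by (simp add: L_def)
  ultimately have \<delta>s: "2 * C * (q\<^sup>2 * \<delta> powr (q - 2) / (q - 2)\<^sup>2) \<le> 1/2" by simp
  \<comment> \<open>The locale has one constant for the Lipschitz bound and for the growth of
    \<open>y * f y / 2 - F y\<close>; the latter requires \<open>2 * C\<close>.\<close>
  have vir: "virial m (2 * C) \<delta> f u1 u2 F q"
    if "global_solution m f u1 u2" "odd_in_space u1" "sup_H1L2_norm u1 u2 < ereal \<delta>" for u1 u2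
  proof
    show "continuous_on UNIV f" using fc by (simp add: continuous_on_eq_continuous_at)
    show "\<bar>f a - f b\<bar> \<le> 2 * C * \<bar>a - b\<bar>" if "\<bar>a\<bar> < 1" "\<bar>b\<bar> < 1" for a b
    proof -
      have "0 \<le> C * \<bar>a - b\<bar>" using C by simp
      then show ?thesis using nb(1)[OF that] by linarith
    qed
    show "\<bar>y * f y / 2 - F y\<bar> \<le> 2 * C * \<bar>y\<bar> powr q" if "\<bar>y\<bar> < 1" for y
      using nb(2)[OF that] by (simp add: q_def)
    show "H1L2_norm_on UNIV (u1 t) (u2 t) < \<delta>" if "t \<ge> 0" for t
      by (rule sup_H1L2_norm_less[OF \<open>sup_H1L2_norm u1 u2 < ereal \<delta>\<close> that])
  qed (use C f0 that \<delta> Fd FZ q \<delta>s in auto)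
  show ?thesis
  proof (intro exI[of _ \<delta>] conjI allI impI notI)
    fix u1 u2 and I :: "real set"
    assume "global_solution m f u1 u2" "odd_in_space u1" "sup_H1L2_norm u1 u2 < ereal \<delta>" "is_interval I" "bounded I"
    then show "((\<lambda>t. H1L2_norm_on I (u1 t) (u2 t)) \<longlongrightarrow> 0) at_top"
      using virial.local_norm_decay[OF vir] by blast
  next
    assume "\<exists>u1 u2. breather m f u1 u2 \<and> odd_in_space u1 \<and> odd_in_space u2 \<and>
         sup_H1L2_norm u1 u2 < ereal \<delta> \<and> \<not> identically_zero u1 u2"
    then show False
      using virial.periodic_imp_zero[OF vir] unfolding breather_def by blast
  qed (rule \<delta>(1))
qed

end
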